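(* Let $s\in(0,1)$, $a>0$, let $\Omega\subset\mathbb{R}^n$ be a bounded domain with volume $|\Omega|$, and let $\lambda_k(\Omega)$ denote the $k$-th eigenvalue of the mixed local-nonlocal Dirichlet problem $$-a\Delta u(x)+b(-\Delta)^s u(x)=\lambda u(x),\ x\in\Omega,\qquad u(x)=0,\ x\in\mathbb{R}^n\setminus\Omega .$$ Then the following hold for $k=1,2,3,\ldots$. (i) If $b>0$, then $$\sum_{i=1}^{k}\lambda_{i}(\Omega)\geq nk\max\left\{\frac{4a\pi }{n+2}\left(\frac{\Gamma\left(1+\frac{n}{2}\right)}{|\Omega|}\right)^{\frac{2}{n}}k^{\frac{2}{n}},\ \frac{(4\pi)^{s}b}{n+2s}\left(\frac{\Gamma\left(1+\frac{n}{2}\right)}{|\Omega|}\right)^{\frac{2s}{n}}k^{\frac{2s}{n}}\right\}.$$ (ii) If $-\frac{a}{C_{E}}<b<0$, where $C_E\ge 1$, depending only on $n$ and $s$, is the constant in the embedding inequality $$\int_{\Omega}\int_{\Omega}\frac{|u(x)-u(y)|^{2}}{|x-y|^{n+2s}}\,dx\,dy\leq C_{E}\|\nabla u\|^{2}_{L^{2}(\Omega)},$$ then $$\sum_{i=1}^{k}\lambda_{i}(\Omega)\geq nk(a+C_{E}b)\max\left\{\frac{4\pi}{n+2}\left(\frac{\Gamma\left(1+\frac{n}{2}\right)}{|\Omega|}\right)^{\frac{2}{n}}k^{\frac{2}{n}},\ \frac{(4\pi)^{s}}{(n+2s)C_{E}}\left(\frac{\Gamma\left(1+\frac{n}{2}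\right)}{|\Omega|}\right)^{\frac{2s}{n}}k^{\frac{2s}{n}}\right\}.$$
   Context: The fractional Laplacian is $$(-\Delta)^{s}u(x)=\frac{c_{n,s}}{2}\int_{\mathbb{R}^{n}}\frac{2u(x)-u(x+y)-u(x-y)}{|y|^{n+2s}}\,dy,\qquad c_{n,s}=\left(\int_{\mathbb{R}^{n}}\frac{1-\cos\zeta_{1}}{|\zeta|^{n+2s}}\,d\zeta\right)^{-1}.$$ Standing assumption: $\Omega$ is a connected bounded open set with $C^1$-smooth boundary. Let $\mathbb{X}(\Omega)=\{u\in H^1(\mathbb{R}^n): u\equiv 0 \text{ a.e. on } \mathbb{R}^n\setminus\Omega\}$, identified with $H^1_0(\Omega)$ via extension by zero. A number $\lambda(\Omega)$ is a (variational) eigenvalue of the problem if there is a nonzero weak solution $u\in\mathbb{X}(\Omega)$, $u:\mathbb{R}^n\to\mathbb{R}$ (then called an eigenfunction), that is, $$a\int_{\Omega}\langle\nabla u,\nabla\varphi\rangle\,dx+b\int_{\Omega}\int_{\Omega}\frac{(u(x)-u(y))(\varphi(x)-\varphi(y))}{|x-y|^{n+2s}}\,dx\,dy=\lambda(\Omega)\int_{\Omega}u(x)\varphi(x)\,dx\quad\text{for every }\varphi\in\mathbb{X}(\Omega).$$ The eigenvalues are listed in nondecreasing order, repeated according to multiplicity, with corresponding eigenfunctions $u_1,u_2,\ldots$ orthonormal in $L^2(\Omega)$. The embedding inequality defining $C_E$ is stated for $s\in(0,1)$, for $\Omega$ an open set in $\mathbb{R}^n$ of class $C^{0,1}$ with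 bounded boundary, and for measurable $u:\Omega\to\mathbb{R}$, with $C_E\ge1$ depending only on $n$ and $s$. It expresses the continuous embedding $H^1_0(\Omega)\subset H^s_0(\Omega)$.
   Formalization: The nonlocal energy, in the weak form and in the embedding inequality, is c_{n,s}/2 times the double integral over R^n×R^n, not the plain one over Ω×Ω (for which (i) fails); C_E≥1 is any constant valid for the given Ω, since none depending only on n and s exists. *)

theory Defs
  imports "HOL-Analysis.Analysis"
begin

text \<open>
  The ambient space \<open>\<real>\<^sup>n\<close> is a Euclidean space \<open>'a\<close> with \<open>n = DIM('a)\<close>.  Elements of Lebesgue and
  Sobolev spaces are represented by Borel functions on all of \<open>'a\<close> (every class modulo equality
  almost everywhere has a Borel representative).
\<close>

section \<open>Smooth functions and domains\<close>

primrec Ck :: "nat \<Rightarrow> ('a::euclidean_space \<Rightarrow> real) \<Rightarrow> bool" where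
  "Ck 0 f \<longleftrightarrow> continuous_on UNIV f"
| "Ck (Suc k) f \<longleftrightarrow>
     (\<exists>g. (\<forall>x. (f has_derivative (\<lambda>h. g x \<bullet> h)) (at x)) \<and> (\<forall>i\<in>Basis. Ck k (\<lambda>x. g x \<bullet> i)))"

definition test_function :: "('a::euclidean_space \<Rightarrow> real) \<Rightarrow> bool" where
  "test_function \<phi> \<longleftrightarrow> (\<forall>k. Ck k \<phi>) \<and> compact (closure {x. \<phi> x \<noteq> 0})"

text \<open>
  Near each boundary point the set is the strict epigraph, in some direction \<open>\<nu>\<close>, of a \<open>C\<^sup>1\<close>
  function of the component orthogonal to \<open>\<nu>\<close>; only the values of \<open>\<gamma>\<close> on the hyperplane
  orthogonal to \<open>\<nu>\<close> are used.
\<close>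

definition C1_boundary :: "'a::euclidean_space set \<Rightarrow> bool" where
  "C1_boundary \<Omega> \<longleftrightarrow>
     (\<forall>p\<in>frontier \<Omega>. \<exists>r>0. \<exists>\<nu> \<gamma>. norm \<nu> = 1 \<and> Ck 1 \<gamma> \<and>
        (\<forall>x\<in>ball p r. x \<in> \<Omega> \<longleftrightarrow> \<gamma> (x - (x \<bullet> \<nu>) *\<^sub>R \<nu>) < x \<bullet> \<nu>))"

definition C1_bounded_domain :: "'a::euclidean_space set \<Rightarrow> bool" where
  "C1_bounded_domain \<Omega> \<longleftrightarrow>
     open \<Omega> \<and> connected \<Omega> \<and> \<Omega> \<noteq> {} \<and> bounded \<Omega> \<and> C1_boundary \<Omega>"

section \<open>Sobolev spaces\<close>

definition L2_function :: "('a::euclidean_space \<Rightarrow> 'b::euclidean_space) \<Rightarrow> bool" where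
  "L2_function u \<longleftrightarrow> u \<in> borel_measurable lborel \<and> integrable lborel (\<lambda>x. (norm (u x))\<^sup>2)"

definition is_weak_gradient :: "('a::euclidean_space \<Rightarrow> real) \<Rightarrow> ('a \<Rightarrow> 'a) \<Rightarrow> bool" where
  "is_weak_gradient u g \<longleftrightarrow>
     (\<forall>\<phi>. test_function \<phi> \<longrightarrow> (\<forall>i\<in>Basis.
        (LINT x|lborel. u x * frechet_derivative \<phi> (at x) i) = - (LINT x|lborel. (g x \<bullet> i) * \<phi> x)))"

definition H1 :: "('a::euclidean_space \<Rightarrow> real) set" where
  "H1 = {u. L2_function u \<and> (\<exists>g. L2_function g \<and> is_weak_gradient u g)}"

text \<open>For \<open>u \<in> H1\<close> the choice is unique up to equality almost everywhere.\<close>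

definition weak_grad :: "('a::euclidean_space \<Rightarrow> real) \<Rightarrow> 'a \<Rightarrow> 'a" where
  "weak_grad u = (SOME g. L2_function g \<and> is_weak_gradient u g)"

definition XX :: "'a::euclidean_space set \<Rightarrow> ('a \<Rightarrow> real) set" where
  "XX \<Omega> = {u \<in> H1. AE x in lborel. x \<notin> \<Omega> \<longrightarrow> u x = 0}"

section \<open>The fractional Laplacian\<close>

text \<open>
  The normalising constant \<open>c\<^sub>n\<^sub>,\<^sub>s\<close>.  The coordinate \<open>\<zeta>\<^sub>1\<close> is taken along an arbitrarily chosen
  basis vector; by rotation invariance the value does not depend on the choice.
\<close>

definition frac_const :: "'a::euclidean_space itself \<Rightarrow> real \<Rightarrow> real" where
  "frac_const _ s =
     inverse (LINT \<zeta>::'a|lborel.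
       (1 - cos (\<zeta> \<bullet> (SOME i. i \<in> Basis))) / norm \<zeta> powr (real DIM('a) + 2 * s))"

text \<open>
  The bilinear form of \<open>(-\<Delta>)\<^sup>s u(x) = c\<^sub>n\<^sub>,\<^sub>s/2 \<integral> (2 u(x) - u(x+y) - u(x-y)) / |y|\<^sup>n\<^sup>+\<^sup>2\<^sup>s dy\<close>:
  pairing the operator with \<open>\<phi>\<close> and symmetrising gives the double integral over
  \<open>\<real>\<^sup>n \<times> \<real>\<^sup>n\<close> with the factor \<open>c\<^sub>n\<^sub>,\<^sub>s/2\<close>.  Integrating over \<open>\<Omega> \<times> \<Omega>\<close> only would instead give the
  regional (censored) operator, even for functions vanishing outside \<open>\<Omega>\<close>.
\<close>

definition frac_form :: "real \<Rightarrow> ('a::euclidean_space \<Rightarrow> real) \<Rightarrow> ('a \<Rightarrow> real) \<Rightarrow> real" where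
  "frac_form s u \<phi> =
     frac_const TYPE('a) s / 2 *
       (LINT y|lborel. LINT x|lborel.
          (u x - u y) * (\<phi> x - \<phi> y) / norm (x - y) powr (real DIM('a) + 2 * s))"

section \<open>The mixed local-nonlocal eigenvalue problem\<close>

definition mixed_eigenfunction ::
  "real \<Rightarrow> real \<Rightarrow> real \<Rightarrow> 'a::euclidean_space set \<Rightarrow> real \<Rightarrow> ('a \<Rightarrow> real) \<Rightarrow> bool" where
  "mixed_eigenfunction a b s \<Omega> \<mu> u \<longleftrightarrow>
     u \<in> XX \<Omega> \<and> \<not> (AE x in lborel. u x = 0) \<and>
     (\<forall>\<phi>\<in>XX \<Omega>.
        a * (LINT x:\<Omega>|lborel. weak_grad u x \<bullet> weak_grad \<phi> x) + b * frac_form s u \<phi>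
          = \<mu> * (LINT x:\<Omega>|lborel. u x * \<phi> x))"

text \<open>
  \<open>lam 1, lam 2, \<dots>\<close> lists all eigenvalues in nondecreasing order, repeated according to multiplicity,
  with \<open>L\<^sup>2(\<Omega>)\<close>-orthonormal eigenfunctions \<open>u 1, u 2, \<dots>\<close>.  The last clause says that each
  eigenspace is spanned by the listed eigenfunctions, so no eigenvalue is missing and each one
  occurs as often as its multiplicity.  The values at index 0 are irrelevant.
\<close>

definition mixed_eigen_listing ::
  "real \<Rightarrow> real \<Rightarrow> real \<Rightarrow> 'a::euclidean_space set \<Rightarrow> (nat \<Rightarrow> real) \<Rightarrow> (nat \<Rightarrow> 'a \<Rightarrow> real) \<Rightarrow> bool"
where
  "mixed_eigen_listing a b s \<Omega> lam u \<longleftrightarrow>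
     (\<forall>i\<ge>1. mixed_eigenfunction a b s \<Omega> (lam i) (u i)) \<and>
     (\<forall>i\<ge>1. \<forall>j\<ge>i. lam i \<le> lam j) \<and>
     (\<forall>i\<ge>1. \<forall>j\<ge>1. (LINT x:\<Omega>|lborel. u i x * u j x) = (if i = j then 1 else 0)) \<and>
     (\<forall>\<mu> v. mixed_eigenfunction a b s \<Omega> \<mu> v \<longrightarrow>
        (\<exists>I c. finite I \<and> I \<subseteq> {i. 1 \<le> i \<and> lam i = \<mu>} \<and>
               (AE x in lborel. v x = (\<Sum>i\<in>I. c i * u i x))))"

text \<open>The inequality expressing the continuous embedding \<open>H\<^sup>1\<^sub>0(\<Omega>) \<subseteq> H\<^sup>s\<^sub>0(\<Omega>)\<close> with constant \<open>C\<close>.\<close>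

definition embedding_inequality :: "real \<Rightarrow> 'a::euclidean_space set \<Rightarrow> real \<Rightarrow> bool" where
  "embedding_inequality s \<Omega> C \<longleftrightarrow>
     (\<forall>u\<in>XX \<Omega>. frac_form s u u \<le> C * (LINT x:\<Omega>|lborel. (norm (weak_grad u x))\<^sup>2))"

end

theory Submission
  imports Defs "HOL-Probability.Probability" "HOL-Real_Asymp.Real_Asymp"
begin

text \<open>
  The argument is that of Berezin and Li-Yau.  Both quadratic forms are diagonal in Fourier space:
  up to the factor \<open>(2 * pi) ^ DIM('a)\<close> the gradient term of an eigenfunction is the second moment, and the
  fractional term the \<open>2 * s\<close>-th moment, of its power spectrum.  By Plancherel and Bessel the summed
  spectrum \<open>F\<close> of \<open>k\<close> orthonormal functions supported in \<open>\<Omega>\<close> has mass \<open>(2 * pi) ^ DIM('a) * k\<close> and satisfies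
  \<open>0 \<le> F \<le> |\<Omega>|\<close>, so each moment is at least that of \<open>|\<Omega>|\<close> times the indicator of a ball of the same
  mass.  For negative \<open>b\<close> the embedding inequality first absorbs the fractional term into the
  gradient term.  Fourier transforms are handled through real cosine and sine transforms;
  Plancherel's theorem comes from Gaussian regularisation and the continuity at 0 of the
  autocorrelation function.
\<close>

section \<open>Lebesgue measure and Gaussian integrals\<close>

text \<open>Only squared moduli of Fourier transforms enter, so a scalar Plancherel identity
  suffices: the power spectrum is the cosine transform of the autocorrelation, whose value at 0 is
  the squared norm. No inversion formula is involved. The gradient term poses two obstacles. It is
  integrated over \<open>\<Omega>\<close> alone, while the spectrum sees the whole space; hence the
  weak gradient has to vanish almost everywhere off \<open>\<Omega>\<close>. Away from the closure
  this is a local fact, and on the frontier it rests on measure zero, which the boundary regularity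
  supplies. Moreover weak gradients are tested against compactly supported functions, so cosines and
  sines must be cut off by bumps of growing radius. For the fractional term no explicit value of
  \<open>frac_const\<close> is computed: it is the reciprocal of the constant that the kernel
  integral produces, and the two cancel. The height bound |\<Omega>| is Bessel's inequality for the
  restrictions of cosine and sine to \<open>\<Omega>\<close>, whose squared norms add up to the
  volume. The \<open>4 * pi\<close> in the result is \<open>(2 * pi)^2 / pi\<close>, from
  Plancherel's factor and the volume of the unit ball.\<close>

lemma nn_integral_lborel_affine:
  fixes f :: "'a::euclidean_space \<Rightarrow> ennreal"
  assumes [measurable]: "f \<in> borel_measurable borel" and c: "c \<noteq> 0"
  shows "(\<integral>\<^sup>+x. f x \<partial>lborel) = ennreal (\<bar>c\<bar> ^ DIM('a)) * (\<integral>\<^sup>+x. f (t + c *\<^sub>R x) \<partial>lborel)"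
  by (subst lborel_affine[OF c, of t])
     (simp add: nn_integral_density nn_integral_distr nn_integral_cmult ennreal_power)

lemma nn_integral_lborel_shift:
  fixes f :: "'a::euclidean_space \<Rightarrow> ennreal"
  assumes "f \<in> borel_measurable borel"
  shows "(\<integral>\<^sup>+x. f (x + t) \<partial>lborel) = (\<integral>\<^sup>+x. f x \<partial>lborel)"
  using nn_integral_lborel_affine[OF assms, of 1 t] by (simp add: add.commute)

lemma integrable_lborel_affine:
  fixes f :: "'a::euclidean_space \<Rightarrow> 'b :: {banach, second_countable_topology}"
  assumes f: "integrable lborel f" and c: "c \<noteq> 0"
  shows "integrable lborel (\<lambda>x. f (t + c *\<^sub>R x))"
proof -
  have [measurable]: "f \<in> borel_measurable borel" using f by (simp add: borel_measurable_integrable)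
  have "(\<integral>\<^sup>+x. ennreal (norm (f x)) \<partial>lborel) < \<infinity>"
    using f by (simp add: integrable_iff_bounded)
  then show ?thesis
    using c by (subst (asm) nn_integral_lborel_affine[where c=c and t=t])
      (auto simp: integrable_iff_bounded ennreal_mult_less_top)
qed

lemma integral_lborel_affine:
  fixes f :: "'a::euclidean_space \<Rightarrow> 'b :: {banach, second_countable_topology}"
  assumes f: "integrable lborel f" and c: "c \<noteq> 0"
  shows "(\<integral>x. f x \<partial>lborel) = (\<bar>c\<bar> ^ DIM('a)) *\<^sub>R (\<integral>x. f (t + c *\<^sub>R x) \<partial>lborel)"
proof -
  have [measurable]: "f \<in> borel_measurable borel" using f by (simp add: borel_measurable_integrable)
  show ?thesis
    using c integrable_lborel_affine[OF f c, of t]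
    by (subst lborel_affine[OF c, of t]) (simp add: integral_density integral_distr)
qed

lemma integral_lborel_shift:
  fixes f :: "'a::euclidean_space \<Rightarrow> 'b :: {banach, second_countable_topology}"
  assumes f: "integrable lborel f"
  shows "(\<integral>x. f (x + t) \<partial>lborel) = (\<integral>x. f x \<partial>lborel)"
  using integral_lborel_affine[OF f, of 1 t] by (simp add: add.commute)

lemma integrable_lborel_shift:
  fixes f :: "'a::euclidean_space \<Rightarrow> 'b :: {banach, second_countable_topology}"
  assumes f: "integrable lborel f"
  shows "integrable lborel (\<lambda>x. f (x + t))"
  using integrable_lborel_affine[OF f, of 1 t] by (simp add: add.commute)

section \<open>Fourier transforms of Gaussians\<close>

text \<open>The characteristic function of the standard normal distribution, rescaled by
  \<open>sqrt e\<close>.\<close>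

lemma gaussian_fourier_1:
  assumes "0 < (e::real)"
  shows "integrable lborel (\<lambda>t. cis (w * t) * exp (- e * t\<^sup>2 / 2))"
    and "(LBINT t. cis (w * t) * exp (- e * t\<^sup>2 / 2)) = complex_of_real (sqrt (2 * pi / e) * exp (- w\<^sup>2 / (2 * e)))"
proof -
  have i: "integrable lborel (\<lambda>t. std_normal_density t *\<^sub>R cis (v * t))" for v
  proof (rule Bochner_Integration.integrable_bound)
    show "integrable lborel std_normal_density" by simp
  qed (auto intro!: borel_measurable_continuous_onI continuous_intros simp: cis_conv_exp)
  have c: "(LBINT t. std_normal_density t *\<^sub>R cis (v * t)) = exp (- v\<^sup>2 / 2)" for v
    using fun_cong[OF char_std_normal_distribution, of v]
    by (subst (asm) char_def, subst (asm) integral_density) (auto simp: cis_conv_exp exp_of_real)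
  define d where "d = sqrt e"
  have d: "d > 0" "e = d\<^sup>2" using assms by (auto simp: d_def)
  have eq: "cis (w * t) * exp (- e * t\<^sup>2 / 2) = sqrt (2 * pi) *\<^sub>R (std_normal_density (0 + d * t) *\<^sub>R cis (w / d * (0 + d * t)))" for t
    using d by (simp add: std_normal_density_def scaleR_conv_of_real power_mult_distrib)
  show "integrable lborel (\<lambda>t. cis (w * t) * exp (- e * t\<^sup>2 / 2))"
    unfolding eq using d by (intro integrable_scaleR_right lborel_integrable_real_affine i) auto
  have "exp (- (w / d)\<^sup>2 / 2) = (LBINT t. std_normal_density t *\<^sub>R cis (w/d * t))"
    using c[of "w/d"] by simp
  also have "\<dots> = d *\<^sub>R (LBINT t. std_normal_density (0 + d * t) *\<^sub>R cis (w / d * (0 + d * t)))"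
    using d by (subst lborel_integral_real_affine[of d _ 0]) auto
  finally show "(LBINT t. cis (w * t) * exp (- e * t\<^sup>2 / 2)) = complex_of_real (sqrt (2 * pi / e) * exp (- w\<^sup>2 / (2 * e)))"
    unfolding eq integral_scaleR_right using d
    by (simp add: scaleR_conv_of_real real_sqrt_divide power_divide field_simps exp_of_real)
qed

text \<open>Complex factors are allowed because \<open>cis\<close> of an inner product factorises
  over the coordinates, whereas its cosine does not.\<close>

lemma product_basis_integral:
  fixes f :: "'a::euclidean_space \<Rightarrow> real \<Rightarrow> complex"
  assumes i: "\<And>b. b \<in> Basis \<Longrightarrow> integrable lborel (f b)"
  shows "integrable lborel (\<lambda>x::'a. \<Prod>b\<in>Basis. f b (x \<bullet> b))"
    and "(LINT x|lborel. (\<Prod>b\<in>Basis. f b (x \<bullet> b))) = (\<Prod>b\<in>(Basis::'a set). (LBINT t. f b t))"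
proof -
  interpret product_sigma_finite "\<lambda>_::'a. lborel :: real measure" ..
  have [measurable]: "f b \<in> borel_measurable borel" if "b \<in> Basis" for b
    using i[OF that] by (simp add: borel_measurable_integrable)
  have ip: "integrable (Pi\<^sub>M Basis (\<lambda>_. lborel)) (\<lambda>g. \<Prod>b\<in>(Basis::'a set). f b (g b))"
    by (rule product_integrable_prod) (auto intro: i)
  have e: "(\<Prod>b\<in>Basis. f b ((\<Sum>b\<in>Basis. g b *\<^sub>R b) \<bullet> b)) = (\<Prod>b\<in>(Basis::'a set). f b (g b))" for g
    by (intro prod.cong) auto
  have m: "(\<lambda>x::'a. \<Prod>b\<in>Basis. f b (x \<bullet> b)) \<in> borel_measurable borel"
    by measurable
  show "integrable lborel (\<lambda>x::'a. \<Prod>b\<in>Basis. f b (x \<bullet> b))"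
    using ip by (subst lborel_eq, subst integrable_distr_eq) (auto simp: e m)
  show "(LINT x|lborel. (\<Prod>b\<in>Basis. f b (x \<bullet> b))) = (\<Prod>b\<in>(Basis::'a set). (LBINT t. f b t))"
    by (subst lborel_eq, subst integral_distr) (auto simp: e m i intro!: product_integral_prod)
qed

lemma gaussian_fourier:
  fixes w :: "'a::euclidean_space"
  assumes "0 < (e::real)"
  shows "integrable lborel (\<lambda>x::'a. exp (- e * (norm x)\<^sup>2 / 2))"
    and "(LINT x|lborel. cos (w \<bullet> x) * exp (- e * (norm x)\<^sup>2 / 2))
      = sqrt (2 * pi / e) ^ DIM('a) * exp (- (norm w)\<^sup>2 / (2 * e))"
proof -
  have n2: "(norm x)\<^sup>2 = (\<Sum>b\<in>Basis. (x \<bullet> b)\<^sup>2)" for x :: 'a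
    unfolding power2_norm_eq_inner by (subst euclidean_inner) (simp add: power2_eq_square)
  have ex: "exp (- e * (norm x)\<^sup>2 / 2) = (\<Prod>b\<in>Basis. exp (- e * (x \<bullet> b)\<^sup>2 / 2))" for x :: 'a
    by (subst exp_sum[symmetric]) (auto simp: n2 sum_distrib_left sum_divide_distrib sum_negf)
  have ew: "exp (- (norm w)\<^sup>2 / (2 * e)) = (\<Prod>b\<in>Basis. exp (- (w \<bullet> b)\<^sup>2 / (2 * e)))"
    by (subst exp_sum[symmetric]) (auto simp: n2 sum_distrib_left sum_divide_distrib sum_negf)
  have cx: "cis (v \<bullet> x) = (\<Prod>b\<in>Basis. cis ((v \<bullet> b) * (x \<bullet> b)))" for v x :: 'a
    by (simp add: cis_conv_exp euclidean_inner[of v x] sum_distrib_left flip: exp_sum)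
  have eq: "cis (v \<bullet> x) * exp (- e * (norm x)\<^sup>2 / 2) = (\<Prod>b\<in>Basis. cis ((v \<bullet> b) * (x \<bullet> b)) * exp (- e * (x \<bullet> b)\<^sup>2 / 2))" for v x :: 'a
    unfolding ex cx by (simp add: prod.distrib)
  have i: "integrable lborel (\<lambda>x::'a. cis (v \<bullet> x) * exp (- e * (norm x)\<^sup>2 / 2))" for v
    unfolding eq by (rule product_basis_integral) (rule gaussian_fourier_1[OF assms])
  show "integrable lborel (\<lambda>x::'a. exp (- e * (norm x)\<^sup>2 / 2))"
    using i[of 0] by (simp add: complex_of_real_integrable_eq)
  have "(LINT x|lborel. cis (w \<bullet> x) * exp (- e * (norm x)\<^sup>2 / 2))
      = (\<Prod>b\<in>Basis. complex_of_real (sqrt (2 * pi / e) * exp (- (w \<bullet> b)\<^sup>2 / (2 * e))))"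
    unfolding eq
    by (simp only: product_basis_integral(2)[OF gaussian_fourier_1(1)[OF assms]] gaussian_fourier_1(2)[OF assms])
  also have "\<dots> = complex_of_real (sqrt (2 * pi / e) ^ DIM('a) * exp (- (norm w)\<^sup>2 / (2 * e)))"
    unfolding ew by (simp add: prod.distrib)
  finally have "Re (LINT x|lborel. cis (w \<bullet> x) * exp (- e * (norm x)\<^sup>2 / 2))
      = sqrt (2 * pi / e) ^ DIM('a) * exp (- (norm w)\<^sup>2 / (2 * e))"
    by (metis Re_complex_of_real)
  then show "(LINT x|lborel. cos (w \<bullet> x) * exp (- e * (norm x)\<^sup>2 / 2))
      = sqrt (2 * pi / e) ^ DIM('a) * exp (- (norm w)\<^sup>2 / (2 * e))"
    by (subst (asm) integral_Re[OF i, symmetric]) simp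
qed

section \<open>Continuity of translation in \<open>L\<^sup>2\<close>\<close>

definition L2_shift_diff :: "('a::euclidean_space \<Rightarrow> real) \<Rightarrow> 'a \<Rightarrow> real" where
  "L2_shift_diff u h = (LINT x|lborel. (u (x + h) - u x)\<^sup>2)"

lemma integrable_L2_mult:
  fixes u v :: "'a \<Rightarrow> real"
  assumes [measurable]: "u \<in> borel_measurable M" "v \<in> borel_measurable M"
    and "integrable M (\<lambda>x. (u x)\<^sup>2)" "integrable M (\<lambda>x. (v x)\<^sup>2)"
  shows "integrable M (\<lambda>x. u x * v x)"
proof (rule Bochner_Integration.integrable_bound)
  show "integrable M (\<lambda>x. (u x)\<^sup>2 + (v x)\<^sup>2)" using assms by auto
  have "\<bar>a * b\<bar> \<le> a\<^sup>2 + b\<^sup>2" for a b :: real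
  proof -
    have "2 * (\<bar>a\<bar> * \<bar>b\<bar>) \<le> a\<^sup>2 + b\<^sup>2" using sum_squares_bound[of "\<bar>a\<bar>" "\<bar>b\<bar>"] by (simp add: mult.assoc)
    moreover have "0 \<le> \<bar>a\<bar> * \<bar>b\<bar>" by simp
    ultimately show ?thesis unfolding abs_mult by linarith
  qed
  then show "AE x in M. norm (u x * v x) \<le> norm ((u x)\<^sup>2 + (v x)\<^sup>2)" by auto
qed auto

lemma integrable_L2_diff:
  fixes u v :: "'a \<Rightarrow> real"
  assumes [measurable]: "u \<in> borel_measurable M" "v \<in> borel_measurable M"
    and "integrable M (\<lambda>x. (u x)\<^sup>2)" "integrable M (\<lambda>x. (v x)\<^sup>2)"
  shows "integrable M (\<lambda>x. (u x - v x)\<^sup>2)"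
proof -
  have "integrable M (\<lambda>x. (u x)\<^sup>2 + (v x)\<^sup>2 - 2 * (u x * v x))"
    using assms integrable_L2_mult[OF assms] by auto
  then show ?thesis by (simp add: power2_diff mult.assoc)
qed

lemma integrable_indicator_cball:
  "integrable lborel (\<lambda>x::'a::euclidean_space. indicator (cball z r) x * (c::real))"
  using emeasure_lborel_cball_finite[of z r]
  by (intro integrable_mult_left integrable_real_indicator) (auto simp: top.not_eq_extremum)

lemma L2_shift_diff_continuous:
  fixes v :: "'a::euclidean_space \<Rightarrow> real"
  assumes v: "continuous_on UNIV v" and b: "\<And>x. \<bar>v x\<bar> \<le> B" and R: "\<And>x. norm x > R \<Longrightarrow> v x = 0"
    and h: "h \<longlonglongrightarrow> (0::'a)"
  shows "(\<lambda>k. L2_shift_diff v (h k)) \<longlonglongrightarrow> 0"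
proof -
  have [measurable]: "v \<in> borel_measurable borel" using v by (rule borel_measurable_continuous_onI)
  \<comment> \<open>A convergent sequence of shifts is bounded, so a single ball of radius
    \<open>R + H\<close> contains the supports of \<open>v\<close> and of all its translates and
    carries an integrable majorant.\<close>
  obtain H where H: "\<And>k. norm (h k) \<le> H"
    using h convergent_imp_Bseq[of h] unfolding convergent_def Bseq_def by blast
  have "(\<lambda>k. (LINT x|lborel. (v (x + h k) - v x)\<^sup>2)) \<longlonglongrightarrow> (LINT x::'a|lborel. 0)"
  proof (rule integral_dominated_convergence)
    show "integrable lborel (\<lambda>x::'a. indicator (cball 0 (R + H)) x * (2 * B)\<^sup>2)"
      by (rule integrable_indicator_cball)
    show "AE x in lborel. (\<lambda>k. (v (x + h k) - v x)\<^sup>2) \<longlonglongrightarrow> 0"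
    proof (intro AE_I2)
      fix x
      have "(\<lambda>k. v (x + h k)) \<longlonglongrightarrow> v (x + 0)"
        using v by (intro isCont_tendsto_compose[of _ v] tendsto_intros h) (auto simp: continuous_on_eq_continuous_at)
      then have "(\<lambda>k. (v (x + h k) - v x)\<^sup>2) \<longlonglongrightarrow> (v (x + 0) - v x)\<^sup>2"
        by (intro tendsto_intros)
      then show "(\<lambda>k. (v (x + h k) - v x)\<^sup>2) \<longlonglongrightarrow> 0" by simp
    qed
    show "AE x in lborel. norm ((v (x + h k) - v x)\<^sup>2) \<le> indicator (cball 0 (R + H)) x * (2 * B)\<^sup>2" for k
    proof (intro AE_I2)
      fix x
      show "norm ((v (x + h k) - v x)\<^sup>2) \<le> indicator (cball 0 (R + H)) x * (2 * B)\<^sup>2"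
      proof (cases "norm x \<le> R + H")
        case True
        have "\<bar>v (x + h k) - v x\<bar> \<le> 2 * B" using b[of x] b[of "x + h k"] by linarith
        then have "(v (x + h k) - v x)\<^sup>2 \<le> (2 * B)\<^sup>2" by (metis abs_ge_zero power2_abs power_mono)
        with True show ?thesis by (simp add: indicator_def)
      next
        case False
        have "norm x \<le> norm (x + h k) + norm (h k)" by (metis add_diff_cancel norm_triangle_ineq4)
        with False H[of k] have "norm (x + h k) > R" by linarith
        moreover have "norm x > R" using False H[of k] norm_ge_zero[of "h k"] by linarith
        ultimately show ?thesis using R by simp
      qed
    qed
  qed auto
  then show ?thesis by (simp add: L2_shift_diff_def)
qed

lemma measurable_truncation:
  fixes m :: real
  assumes "u \<in> borel_measurable borel"
  shows "(\<lambda>x::'a::euclidean_space. indicator (cball 0 r) x * max (- m) (min m (u x))) \<in> borel_measurable borel"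
  by (intro borel_measurable_times borel_measurable_indicator borel_measurable_max
      borel_measurable_min borel_measurable_const assms) auto

text \<open>At a given point the error is eventually zero, once \<open>m\<close> exceeds both
  \<open>norm x\<close> and \<open>|u x|\<close>. It never exceeds \<open>|u x|\<close>, which
  supplies the majorant.\<close>

lemma L2_truncation:
  fixes u :: "'a::euclidean_space \<Rightarrow> real"
  assumes [measurable]: "u \<in> borel_measurable borel" and u2: "integrable lborel (\<lambda>x. (u x)\<^sup>2)"
  shows "(\<lambda>m::nat. LINT x|lborel. (u x - indicator (cball 0 m) x * max (- real m) (min (real m) (u x)))\<^sup>2) \<longlonglongrightarrow> 0"
proof -
  have "(\<lambda>m::nat. LINT x|lborel. (u x - indicator (cball 0 m) x * max (- real m) (min (real m) (u x)))\<^sup>2) \<longlonglongrightarrow> (LINT x::'a|lborel. 0)"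
  proof (rule integral_dominated_convergence[where w="\<lambda>x. (u x)\<^sup>2"])
    show "AE x in lborel. (\<lambda>m::nat. (u x - indicator (cball 0 m) x * max (- real m) (min (real m) (u x)))\<^sup>2) \<longlonglongrightarrow> 0"
    proof (intro AE_I2 tendsto_eventually)
      fix x
      obtain m0 :: nat where m0: "max (norm x) \<bar>u x\<bar> \<le> m0" using real_arch_simple by blast
      show "\<forall>\<^sub>F m::nat in sequentially. (u x - indicator (cball 0 m) x * max (- real m) (min (real m) (u x)))\<^sup>2 = 0"
        using eventually_ge_at_top[of m0]
      proof eventually_elim
        case (elim m)
        then have "real m0 \<le> real m" by simp
        with m0 have "norm x \<le> m" "u x \<le> m" "- u x \<le> m" by linarith+
        then show ?case by (simp add: indicator_def max_def min_def)
      qed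
    qed
    fix m :: nat
    have "\<bar>u x - indicator (cball 0 m) x * max (- real m) (min (real m) (u x))\<bar> \<le> \<bar>u x\<bar>" for x
      by (auto simp: indicator_def max_def min_def)
    then show "AE x in lborel. norm ((u x - indicator (cball 0 m) x * max (- real m) (min (real m) (u x)))\<^sup>2) \<le> (u x)\<^sup>2"
      by (simp add: abs_le_square_iff)
    show "integrable lborel (\<lambda>x. (u x)\<^sup>2)" by (rule u2)
  qed (use measurable_truncation[OF assms(1)] in simp_all)
  then show ?thesis by simp
qed

text \<open>Off a null set a measurable function is a pointwise limit of continuous ones, which is
  what \<open>measurable_on\<close> provides. These come without uniform bounds, so they are clipped
  at height \<open>m\<close> and multiplied by a continuous cutoff \<open>c\<close>; the limit is
  undisturbed because \<open>w\<close> already obeys both restrictions.\<close>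

lemma L2_approx_bounded:
  fixes w :: "'a::euclidean_space \<Rightarrow> real" and m :: real
  assumes [measurable]: "w \<in> borel_measurable borel"
    and w: "\<And>x. \<bar>w x\<bar> \<le> m" and w0: "\<And>x. norm x > m \<Longrightarrow> w x = 0"
  obtains v :: "nat \<Rightarrow> 'a \<Rightarrow> real" where "\<And>k. continuous_on UNIV (v k)" "\<And>k x. \<bar>v k x\<bar> \<le> m"
    "\<And>k x. norm x > m + 1 \<Longrightarrow> v k x = 0" "(\<lambda>k. LINT x|lborel. (w x - v k x)\<^sup>2) \<longlonglongrightarrow> 0"
proof -
  have m: "0 \<le> m" using w[of 0] by linarith
  have "w measurable_on UNIV"
    by (rule lebesgue_measurable_imp_measurable_on_real) (auto intro: borel_measurable_if_I measurable_completion)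
  then obtain N g where N: "negligible N" and g: "\<And>k::nat. continuous_on UNIV (g k)"
    and lim: "\<And>x. x \<notin> N \<Longrightarrow> (\<lambda>k. g k x) \<longlonglongrightarrow> w x"
    unfolding measurable_on_def by auto
  define c where "c x = max 0 (min 1 (m + 1 - norm x))" for x :: 'a
  have c: "continuous_on UNIV c" "\<And>x. 0 \<le> c x" "\<And>x. c x \<le> 1" "\<And>x. norm x \<le> m \<Longrightarrow> c x = 1"
    "\<And>x. norm x > m + 1 \<Longrightarrow> c x = 0"
    unfolding c_def by (auto intro!: continuous_intros)
  define v where "v k x = c x * max (- m) (min m (g k x))" for k x
  have v1: "continuous_on UNIV (v k)" for k unfolding v_def by (intro continuous_intros c g)
  have v2: "\<bar>v k x\<bar> \<le> m" for k x
  proof -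
    have "\<bar>max (- m) (min m (g k x))\<bar> \<le> m" using m by (auto simp: max_def min_def)
    moreover have "\<bar>c x\<bar> \<le> 1" using c(2)[of x] c(3)[of x] by auto
    ultimately have "\<bar>c x\<bar> * \<bar>max (- m) (min m (g k x))\<bar> \<le> 1 * m"
      by (intro mult_mono) auto
    then show ?thesis by (simp add: v_def abs_mult)
  qed
  have v3: "norm x > m + 1 \<Longrightarrow> v k x = 0" for k x using c by (simp add: v_def)
  have [measurable]: "v k \<in> borel_measurable borel" for k using v1 by (rule borel_measurable_continuous_onI)
  have "(\<lambda>k. LINT x|lborel. (w x - v k x)\<^sup>2) \<longlonglongrightarrow> (LINT x::'a|lborel. 0)"
  proof (rule integral_dominated_convergence)
    show "integrable lborel (\<lambda>x::'a. indicator (cball 0 (m + 1)) x * (2 * m)\<^sup>2)"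
      by (rule integrable_indicator_cball)
    have "AE x in lebesgue. x \<notin> N"
      using N by (simp add: negligible_iff_null_sets AE_not_in)
    then have "AE x in lborel. x \<notin> N" by (simp add: AE_completion_iff)
    then show "AE x in lborel. (\<lambda>k. (w x - v k x)\<^sup>2) \<longlonglongrightarrow> 0"
    proof eventually_elim
      case (elim x)
      have "(\<lambda>k. c x * max (- m) (min m (g k x))) \<longlonglongrightarrow> c x * max (- m) (min m (w x))"
        by (intro tendsto_intros lim elim)
      moreover have "max (- m) (min m (w x)) = w x" using w[of x] by (auto simp: max_def min_def)
      moreover have "c x * w x = w x"
        using w0[of x] c(4)[of x] by (cases "norm x > m") auto
      ultimately have "(\<lambda>k. v k x) \<longlonglongrightarrow> w x" by (simp add: v_def)
      then have "(\<lambda>k. (w x - v k x)\<^sup>2) \<longlonglongrightarrow> (w x - w x)\<^sup>2" by (intro tendsto_intros)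
      then show ?case by simp
    qed
    show "AE x in lborel. norm ((w x - v k x)\<^sup>2) \<le> indicator (cball 0 (m + 1)) x * (2 * m)\<^sup>2" for k
    proof (intro AE_I2)
      fix x
      show "norm ((w x - v k x)\<^sup>2) \<le> indicator (cball 0 (m + 1)) x * (2 * m)\<^sup>2"
      proof (cases "norm x \<le> m + 1")
        case True
        have "\<bar>w x - v k x\<bar> \<le> 2 * m" using w[of x] v2[of k x] by linarith
        then have "(w x - v k x)\<^sup>2 \<le> (2 * m)\<^sup>2" by (metis abs_ge_zero power2_abs power_mono)
        with True show ?thesis by (simp add: indicator_def)
      qed (use w0 v3 in auto)
    qed
  qed auto
  then have "(\<lambda>k. LINT x|lborel. (w x - v k x)\<^sup>2) \<longlonglongrightarrow> 0" by simp
  with that v1 v2 v3 show ?thesis by blast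
qed

lemma L2_approx_continuous:
  fixes u :: "'a::euclidean_space \<Rightarrow> real"
  assumes [measurable]: "u \<in> borel_measurable borel" and u2: "integrable lborel (\<lambda>x. (u x)\<^sup>2)"
    and "0 < e"
  obtains v R B where "continuous_on UNIV v" "\<And>x. \<bar>v x\<bar> \<le> B" "\<And>x. norm x > R \<Longrightarrow> v x = 0"
    "integrable lborel (\<lambda>x. (v x)\<^sup>2)" "(LINT x|lborel. (u x - v x)\<^sup>2) < e"
proof -
  define w where "w m x = indicator (cball 0 (real m)) x * max (- real m) (min (real m) (u x))" for m x
  have "(\<lambda>m. LINT x|lborel. (u x - w m x)\<^sup>2) \<longlonglongrightarrow> 0"
    unfolding w_def by (rule L2_truncation[OF assms(1,2)])
  then have "\<forall>\<^sub>F m in sequentially. (LINT x|lborel. (u x - w m x)\<^sup>2) < e / 4"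
    using \<open>0 < e\<close> by (intro order_tendstoD) auto
  then obtain m where m: "(LINT x|lborel. (u x - w m x)\<^sup>2) < e / 4"
    by (meson eventually_sequentially order_refl)
  have [measurable]: "w m \<in> borel_measurable borel" unfolding w_def[abs_def] by (rule measurable_truncation) measurable
  have w: "\<bar>w m x\<bar> \<le> m" "norm x > m \<Longrightarrow> w m x = 0" for x
    by (auto simp: w_def indicator_def max_def min_def)
  obtain v :: "nat \<Rightarrow> 'a \<Rightarrow> real" where v: "\<And>k. continuous_on UNIV (v k)" "\<And>k x. \<bar>v k x\<bar> \<le> m"
    "\<And>k x. norm x > real m + 1 \<Longrightarrow> v k x = 0" "(\<lambda>k. LINT x|lborel. (w m x - v k x)\<^sup>2) \<longlonglongrightarrow> 0"
    by (rule L2_approx_bounded[of "w m" "real m"]) (measurable, rule w(1), erule w(2), rule that, assumption+)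
  have "\<forall>\<^sub>F k in sequentially. (LINT x|lborel. (w m x - v k x)\<^sup>2) < e / 4"
    using \<open>0 < e\<close> v(4) by (intro order_tendstoD) auto
  then obtain k where k: "(LINT x|lborel. (w m x - v k x)\<^sup>2) < e / 4"
    by (meson eventually_sequentially order_refl)
  have [measurable]: "v k \<in> borel_measurable borel" using v(1) by (rule borel_measurable_continuous_onI)
  have sq: "integrable lborel (\<lambda>x. (f x)\<^sup>2)"
    if [measurable]: "f \<in> borel_measurable borel" and f: "\<And>x. \<bar>f x\<bar> \<le> m" "\<And>x. norm x > real m + 1 \<Longrightarrow> f x = 0" for f :: "'a \<Rightarrow> real"
  proof (rule Bochner_Integration.integrable_bound)
    show "integrable lborel (\<lambda>x::'a. indicator (cball 0 (real m + 1)) x * (real m)\<^sup>2)"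
      by (rule integrable_indicator_cball)
    have "(f x)\<^sup>2 \<le> (real m)\<^sup>2" for x using f(1)[of x] by (metis abs_ge_zero power2_abs power_mono)
    then show "AE x in lborel. norm ((f x)\<^sup>2) \<le> norm (indicator (cball 0 (real m + 1)) x * (real m)\<^sup>2)"
      using f(2) by (auto simp: indicator_def not_le)
  qed auto
  have iw: "integrable lborel (\<lambda>x. (w m x)\<^sup>2)" by (rule sq) (use w in auto)
  have iv: "integrable lborel (\<lambda>x. (v k x)\<^sup>2)" by (rule sq) (use v in auto)
  \<comment> \<open>The squared triangle inequality costs a factor 2, which is why both errors were
    made smaller than \<open>e / 4\<close>.\<close>
  have "(LINT x|lborel. (u x - v k x)\<^sup>2) \<le> (LINT x|lborel. 2 * (u x - w m x)\<^sup>2 + 2 * (w m x - v k x)\<^sup>2)"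
  proof (rule integral_mono)
    show "integrable lborel (\<lambda>x. (u x - v k x)\<^sup>2)"
      by (intro integrable_L2_diff u2 iv) auto
    show "integrable lborel (\<lambda>x. 2 * (u x - w m x)\<^sup>2 + 2 * (w m x - v k x)\<^sup>2)"
      by (intro Bochner_Integration.integrable_add integrable_mult_right integrable_L2_diff u2 iv iw) auto
    have "(a - c)\<^sup>2 \<le> 2 * (a - b)\<^sup>2 + 2 * (b - c)\<^sup>2" for a b c :: real
      using zero_le_power2[of "(a - b) - (b - c)"] by (simp add: power2_eq_square algebra_simps)
    then show "(u x - v k x)\<^sup>2 \<le> 2 * (u x - w m x)\<^sup>2 + 2 * (w m x - v k x)\<^sup>2" for x .
  qed
  also have "\<dots> = 2 * (LINT x|lborel. (u x - w m x)\<^sup>2) + 2 * (LINT x|lborel. (w m x - v k x)\<^sup>2)"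
    by (subst Bochner_Integration.integral_add)
      (auto intro!: integrable_mult_right integrable_L2_diff u2 iv iw)
  also have "\<dots> < e" using m k by linarith
  finally have "(LINT x|lborel. (u x - v k x)\<^sup>2) < e" .
  from that[OF v(1) v(2) v(3) iv this] show ?thesis .
qed

text \<open>Inherited from a continuous, compactly supported \<open>v\<close> near \<open>u\<close>.
  The error \<open>u - v\<close> enters at \<open>x + d\<close> and at \<open>x\<close>, with equal
  integrals by translation invariance. The squared three-term triangle inequality has factor 3, and
  \<open>3 * (2 * (e/12) + e/6) = e\<close>.\<close>

lemma L2_shift_continuous:
  fixes u :: "'a::euclidean_space \<Rightarrow> real"
  assumes [measurable]: "u \<in> borel_measurable borel" and u2: "integrable lborel (\<lambda>x. (u x)\<^sup>2)"
    and h: "h \<longlonglongrightarrow> (0::'a)"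
  shows "(\<lambda>k. L2_shift_diff u (h k)) \<longlonglongrightarrow> 0"
proof (rule order_tendstoI)
  fix a :: real assume "a < 0"
  have "L2_shift_diff u (h k) \<ge> 0" for k unfolding L2_shift_diff_def by simp
  with \<open>a < 0\<close> show "\<forall>\<^sub>F k in sequentially. a < L2_shift_diff u (h k)"
    by (intro always_eventually allI) (rule less_le_trans)
next
  fix e :: real assume "0 < e"
  obtain v R B where v: "continuous_on UNIV v" "\<And>x. \<bar>v x\<bar> \<le> B" "\<And>x. norm x > R \<Longrightarrow> v x = 0"
    "integrable lborel (\<lambda>x. (v x)\<^sup>2)" "(LINT x|lborel. (u x - v x)\<^sup>2) < e / 12"
    by (rule L2_approx_continuous[OF assms(1,2), of "e/12"]) (use \<open>0 < e\<close> in auto)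
  have [measurable]: "v \<in> borel_measurable borel" using v(1) by (rule borel_measurable_continuous_onI)
  have iuv: "integrable lborel (\<lambda>x. (u x - v x)\<^sup>2)" by (intro integrable_L2_diff u2 v) auto
  have "\<forall>\<^sub>F k in sequentially. L2_shift_diff v (h k) < e / 6"
    using L2_shift_diff_continuous[OF v(1-3) h] \<open>0 < e\<close> by (intro order_tendstoD) auto
  then show "\<forall>\<^sub>F k in sequentially. L2_shift_diff u (h k) < e"
  proof eventually_elim
    case (elim k)
    define d where "d = h k"
    have i1: "integrable lborel (\<lambda>x. (u (x + d) - v (x + d))\<^sup>2)" using integrable_lborel_shift[OF iuv] .
    have i2: "integrable lborel (\<lambda>x. (v (x + d) - v x)\<^sup>2)"
      using integrable_lborel_shift[OF v(4), of d] by (intro integrable_L2_diff v) auto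
    have "L2_shift_diff u d \<le> (LINT x|lborel. 3 * ((u (x + d) - v (x + d))\<^sup>2 + (v (x + d) - v x)\<^sup>2 + (u x - v x)\<^sup>2))"
      unfolding L2_shift_diff_def
    proof (rule integral_mono)
      show "integrable lborel (\<lambda>x. (u (x + d) - u x)\<^sup>2)"
        using integrable_lborel_shift[OF u2, of d] by (intro integrable_L2_diff u2) auto
      show "integrable lborel (\<lambda>x. 3 * ((u (x + d) - v (x + d))\<^sup>2 + (v (x + d) - v x)\<^sup>2 + (u x - v x)\<^sup>2))"
        using i1 i2 iuv by auto
      have "(a - c)\<^sup>2 \<le> 3 * ((a - p)\<^sup>2 + (p - q)\<^sup>2 + (c - q)\<^sup>2)" for a c p q :: real
        using zero_le_power2[of "(a - p) - (p - q)"] zero_le_power2[of "(p - q) - (q - c)"] zero_le_power2[of "(a - p) - (q - c)"]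
        by (simp add: power2_eq_square algebra_simps)
      then show "(u (x + d) - u x)\<^sup>2 \<le> 3 * ((u (x + d) - v (x + d))\<^sup>2 + (v (x + d) - v x)\<^sup>2 + (u x - v x)\<^sup>2)" for x .
    qed
    also have "\<dots> = 3 * ((LINT x|lborel. (u (x + d) - v (x + d))\<^sup>2) + (LINT x|lborel. (v (x + d) - v x)\<^sup>2) + (LINT x|lborel. (u x - v x)\<^sup>2))"
      using i1 i2 iuv by simp
    also have "\<dots> = 3 * (2 * (LINT x|lborel. (u x - v x)\<^sup>2) + L2_shift_diff v d)"
      using integral_lborel_shift[OF iuv, of d] by (simp add: L2_shift_diff_def)
    also have "\<dots> < e" using v(5) elim by (simp add: d_def)
    finally show ?case by (simp add: d_def)
  qed
qed

section \<open>Plancherel's theorem\<close>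

definition cos_transform :: "('a::euclidean_space \<Rightarrow> real) \<Rightarrow> 'a \<Rightarrow> real" where
  "cos_transform u \<xi> = (LINT x|lborel. u x * cos (\<xi> \<bullet> x))"

definition sin_transform :: "('a::euclidean_space \<Rightarrow> real) \<Rightarrow> 'a \<Rightarrow> real" where
  "sin_transform u \<xi> = (LINT x|lborel. u x * sin (\<xi> \<bullet> x))"

text \<open>The squared modulus of the Fourier transform without normalising factor, hence the power
  of \<open>2 * pi\<close> in Plancherel's theorem.\<close>

definition power_spectrum :: "('a::euclidean_space \<Rightarrow> real) \<Rightarrow> 'a \<Rightarrow> real" where
  "power_spectrum u \<xi> = (cos_transform u \<xi>)\<^sup>2 + (sin_transform u \<xi>)\<^sup>2"

definition autocorrelation :: "('a::euclidean_space \<Rightarrow> real) \<Rightarrow> 'a \<Rightarrow> real" where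
  "autocorrelation u z = (LINT x|lborel. u x * u (x + z))"

lemma power_spectrum_nonneg: "0 \<le> power_spectrum u \<xi>"
  by (simp add: power_spectrum_def)

lemma measurable_cos_transform [measurable]:
  assumes [measurable]: "u \<in> borel_measurable borel"
  shows "cos_transform u \<in> borel_measurable borel"
  unfolding cos_transform_def[abs_def] by measurable

lemma measurable_sin_transform [measurable]:
  assumes [measurable]: "u \<in> borel_measurable borel"
  shows "sin_transform u \<in> borel_measurable borel"
  unfolding sin_transform_def[abs_def] by measurable

lemma measurable_power_spectrum [measurable]:
  assumes [measurable]: "u \<in> borel_measurable borel"
  shows "power_spectrum u \<in> borel_measurable borel"
  unfolding power_spectrum_def[abs_def] by measurable

lemma integrable_mult_cos_sin:
  fixes u :: "'a::euclidean_space \<Rightarrow> real"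
  assumes u: "integrable lborel u"
  shows "integrable lborel (\<lambda>x. u x * cos (\<xi> \<bullet> x))" "integrable lborel (\<lambda>x. u x * sin (\<xi> \<bullet> x))"
proof -
  have [measurable]: "u \<in> borel_measurable borel" using u by (simp add: borel_measurable_integrable)
  show "integrable lborel (\<lambda>x. u x * cos (\<xi> \<bullet> x))"
    by (rule Bochner_Integration.integrable_bound[OF u]) (auto simp: abs_mult intro!: mult_left_le)
  show "integrable lborel (\<lambda>x. u x * sin (\<xi> \<bullet> x))"
    by (rule Bochner_Integration.integrable_bound[OF u]) (auto simp: abs_mult intro!: mult_left_le)
qed

lemma transforms_shift:
  fixes u :: "'a::euclidean_space \<Rightarrow> real"
  assumes u: "integrable lborel u"
  shows "(LINT x|lborel. u (x + y) * cos (\<xi> \<bullet> x)) = cos (\<xi> \<bullet> y) * cos_transform u \<xi> + sin (\<xi> \<bullet> y) * sin_transform u \<xi>"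
    and "(LINT x|lborel. u (x + y) * sin (\<xi> \<bullet> x)) = cos (\<xi> \<bullet> y) * sin_transform u \<xi> - sin (\<xi> \<bullet> y) * cos_transform u \<xi>"
proof -
  have 1: "u x * cos (\<xi> \<bullet> (x - y)) = cos (\<xi> \<bullet> y) * (u x * cos (\<xi> \<bullet> x)) + sin (\<xi> \<bullet> y) * (u x * sin (\<xi> \<bullet> x))" for x
    by (simp add: inner_diff_right cos_diff algebra_simps)
  have i: "integrable lborel (\<lambda>x. u x * cos (\<xi> \<bullet> (x - y)))"
    unfolding 1 by (intro Bochner_Integration.integrable_add integrable_mult_right integrable_mult_cos_sin u)
  show "(LINT x|lborel. u (x + y) * cos (\<xi> \<bullet> x)) = cos (\<xi> \<bullet> y) * cos_transform u \<xi> + sin (\<xi> \<bullet> y) * sin_transform u \<xi>"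
    using integral_lborel_shift[OF i, of y]
    by (simp add: 1 cos_transform_def sin_transform_def integrable_mult_cos_sin u)
  have 2: "u x * sin (\<xi> \<bullet> (x - y)) = cos (\<xi> \<bullet> y) * (u x * sin (\<xi> \<bullet> x)) - sin (\<xi> \<bullet> y) * (u x * cos (\<xi> \<bullet> x))" for x
    by (simp add: inner_diff_right sin_diff algebra_simps)
  have i: "integrable lborel (\<lambda>x. u x * sin (\<xi> \<bullet> (x - y)))"
    unfolding 2 by (intro Bochner_Integration.integrable_diff integrable_mult_right integrable_mult_cos_sin u)
  show "(LINT x|lborel. u (x + y) * sin (\<xi> \<bullet> x)) = cos (\<xi> \<bullet> y) * sin_transform u \<xi> - sin (\<xi> \<bullet> y) * cos_transform u \<xi>"
    using integral_lborel_shift[OF i, of y]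
    by (simp add: 2 cos_transform_def sin_transform_def integrable_mult_cos_sin u)
qed

text \<open>A shift multiplies the Fourier transform by a phase; the factor is the squared modulus
  of that phase minus 1.\<close>

lemma power_spectrum_shift_diff:
  fixes u :: "'a::euclidean_space \<Rightarrow> real"
  assumes u: "integrable lborel u"
  shows "power_spectrum (\<lambda>x. u (x + y) - u x) \<xi> = 2 * (1 - cos (\<xi> \<bullet> y)) * power_spectrum u \<xi>"
proof -
  let ?c = "cos (\<xi> \<bullet> y)" and ?s = "sin (\<xi> \<bullet> y)" and ?C = "cos_transform u \<xi>" and ?S = "sin_transform u \<xi>"
  have c: "cos_transform (\<lambda>x. u (x + y) - u x) \<xi> = ?c * ?C + ?s * ?S - ?C"
    using transforms_shift(1)[OF u] integrable_mult_cos_sin(1)[OF u] integrable_mult_cos_sin(1)[OF integrable_lborel_shift[OF u, of y]]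
    by (simp add: cos_transform_def left_diff_distrib)
  have s: "sin_transform (\<lambda>x. u (x + y) - u x) \<xi> = ?c * ?S - ?s * ?C - ?S"
    using transforms_shift(2)[OF u] integrable_mult_cos_sin(2)[OF u] integrable_mult_cos_sin(2)[OF integrable_lborel_shift[OF u, of y]]
    by (simp add: sin_transform_def left_diff_distrib)
  have "(c * C + s * S - C)\<^sup>2 + (c * S - s * C - S)\<^sup>2 = (c\<^sup>2 + s\<^sup>2 + 1 - 2 * c) * (C\<^sup>2 + S\<^sup>2)" for c s C S :: real
    by (simp add: power2_eq_square algebra_simps)
  then have "(?c * ?C + ?s * ?S - ?C)\<^sup>2 + (?c * ?S - ?s * ?C - ?S)\<^sup>2 = (?c\<^sup>2 + ?s\<^sup>2 + 1 - 2 * ?c) * (?C\<^sup>2 + ?S\<^sup>2)" .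
  also have "?c\<^sup>2 + ?s\<^sup>2 + 1 - 2 * ?c = 2 * (1 - ?c)" by simp
  finally show ?thesis by (simp add: power_spectrum_def c s)
qed

lemma autocorrelation_pair_integrable:
  fixes u :: "'a::euclidean_space \<Rightarrow> real"
  assumes u: "integrable lborel u"
  shows "integrable (lborel \<Otimes>\<^sub>M lborel) (\<lambda>(z, x). u x * u (x + z))"
proof -
  have [measurable]: "u \<in> borel_measurable borel" using u by (simp add: borel_measurable_integrable)
  have "integrable (lborel \<Otimes>\<^sub>M lborel) (\<lambda>(x, z). u x * u (x + z))"
  proof (rule lborel_pair.Fubini_integrable)
    have "(LINT z|lborel. norm (u x * u (x + z))) = \<bar>u x\<bar> * (LINT z|lborel. \<bar>u z\<bar>)" for x
      using integral_lborel_shift[OF integrable_abs[OF u], of x] by (simp add: abs_mult add.commute)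
    then show "integrable lborel (\<lambda>x. LINT z|lborel. norm (case (x, z) of (x, z) \<Rightarrow> u x * u (x + z)))"
      using u by simp
    show "AE x in lborel. integrable lborel (\<lambda>z. case (x, z) of (x, z) \<Rightarrow> u x * u (x + z))"
      using integrable_lborel_shift[OF u] by (auto simp: add.commute)
  qed measurable
  then show ?thesis by (subst (asm) lborel_pair.integrable_product_swap_iff[symmetric]) (simp add: case_prod_beta')
qed

lemma integrable_autocorrelation:
  fixes u :: "'a::euclidean_space \<Rightarrow> real"
  assumes u: "integrable lborel u"
  shows "integrable lborel (autocorrelation u)"
  using lborel_pair.integrable_fst'[OF autocorrelation_pair_integrable[OF u]]
  by (simp add: autocorrelation_def[abs_def])

text \<open>The Wiener-Khinchin relation. Integrating in \<open>z\<close> first turns the shift into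
  a phase, and the addition theorem recombines the two transforms into a sum of squares.\<close>

lemma cos_transform_autocorrelation:
  fixes u :: "'a::euclidean_space \<Rightarrow> real"
  assumes u: "integrable lborel u"
  shows "cos_transform (autocorrelation u) \<xi> = power_spectrum u \<xi>"
proof -
  have [measurable]: "u \<in> borel_measurable borel" using u by (simp add: borel_measurable_integrable)
  have i: "integrable (lborel \<Otimes>\<^sub>M lborel) (\<lambda>(z, x). u x * u (x + z) * cos (\<xi> \<bullet> z))"
    by (rule Bochner_Integration.integrable_bound[OF autocorrelation_pair_integrable[OF u]])
      (auto simp: abs_mult split_beta intro!: AE_I2 mult_left_le)
  have "cos_transform (autocorrelation u) \<xi> = (LINT z|lborel. LINT x|lborel. u x * u (x + z) * cos (\<xi> \<bullet> z))"
    by (simp add: cos_transform_def autocorrelation_def)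
  also have "\<dots> = (LINT x|lborel. LINT z|lborel. u x * u (x + z) * cos (\<xi> \<bullet> z))"
    by (rule lborel_pair.Fubini_integral[OF i, symmetric])
  also have "\<dots> = (LINT x|lborel. u x * (cos (\<xi> \<bullet> x) * cos_transform u \<xi> + sin (\<xi> \<bullet> x) * sin_transform u \<xi>))"
    using transforms_shift(1)[OF u, of _ \<xi>]
    by (intro Bochner_Integration.integral_cong) (simp_all add: mult.assoc add.commute)
  also have "\<dots> = (LINT x|lborel. u x * cos (\<xi> \<bullet> x) * cos_transform u \<xi> + u x * sin (\<xi> \<bullet> x) * sin_transform u \<xi>)"
    by (intro Bochner_Integration.integral_cong) (simp_all add: algebra_simps)
  also have "\<dots> = power_spectrum u \<xi>"
    using integrable_mult_cos_sin[OF u]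
    by (simp add: power_spectrum_def power2_eq_square cos_transform_def sin_transform_def)
  finally show ?thesis .
qed

lemma autocorrelation_0: "autocorrelation u 0 = (LINT x|lborel. (u x)\<^sup>2)"
  by (simp add: autocorrelation_def power2_eq_square)

text \<open>Polarisation: continuity of the autocorrelation at 0 becomes continuity of translation
  in L^2.\<close>

lemma autocorrelation_shift_diff:
  fixes u :: "'a::euclidean_space \<Rightarrow> real"
  assumes [measurable]: "u \<in> borel_measurable borel" and u2: "integrable lborel (\<lambda>x. (u x)\<^sup>2)"
  shows "autocorrelation u z = autocorrelation u 0 - L2_shift_diff u z / 2"
proof -
  have i1: "integrable lborel (\<lambda>x. (u (x + z))\<^sup>2)" using integrable_lborel_shift[OF u2] .
  have i2: "integrable lborel (\<lambda>x. u x * u (x + z))"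
    by (rule integrable_L2_mult) (use u2 i1 in auto)
  have "L2_shift_diff u z = (LINT x|lborel. (u (x + z))\<^sup>2 + (u x)\<^sup>2 - 2 * (u x * u (x + z)))"
    unfolding L2_shift_diff_def by (intro Bochner_Integration.integral_cong) (simp_all add: power2_diff)
  also have "\<dots> = (LINT x|lborel. (u (x + z))\<^sup>2) + (LINT x|lborel. (u x)\<^sup>2) - 2 * autocorrelation u z"
    using i1 i2 u2 by (simp add: autocorrelation_def)
  finally show ?thesis using integral_lborel_shift[OF u2, of z] by (simp add: autocorrelation_0 diff_divide_distrib)
qed

lemma abs_autocorrelation_le:
  fixes u :: "'a::euclidean_space \<Rightarrow> real"
  assumes [measurable]: "u \<in> borel_measurable borel" and u2: "integrable lborel (\<lambda>x. (u x)\<^sup>2)"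
  shows "\<bar>autocorrelation u z\<bar> \<le> autocorrelation u 0"
proof -
  have i1: "integrable lborel (\<lambda>x. (u (x + z))\<^sup>2)" using integrable_lborel_shift[OF u2] .
  have "\<bar>autocorrelation u z\<bar> \<le> (LINT x|lborel. ((u x)\<^sup>2 + (u (x + z))\<^sup>2) / 2)"
    unfolding autocorrelation_def
  proof (rule order_trans[OF integral_abs_bound integral_mono])
    show "integrable lborel (\<lambda>x. \<bar>u x * u (x + z)\<bar>)"
      by (intro integrable_abs integrable_L2_mult) (use u2 i1 in auto)
    show "integrable lborel (\<lambda>x. ((u x)\<^sup>2 + (u (x + z))\<^sup>2) / 2)" using u2 i1 by auto
    show "\<bar>u x * u (x + z)\<bar> \<le> ((u x)\<^sup>2 + (u (x + z))\<^sup>2) / 2" for x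
      using sum_squares_bound[of "\<bar>u x\<bar>" "\<bar>u (x + z)\<bar>"] by (simp add: abs_mult)
  qed
  also have "\<dots> = autocorrelation u 0"
    using u2 i1 integral_lborel_shift[OF u2, of z] by (simp add: autocorrelation_0)
  finally show ?thesis .
qed

text \<open>Integrability of the bare spectrum is not yet available. The Gaussian weight makes the
  double integral over frequency and shift absolutely convergent, so that Fubini applies.\<close>

lemma integral_power_spectrum_gaussian:
  fixes u :: "'a::euclidean_space \<Rightarrow> real"
  assumes u: "integrable lborel u" and r: "0 < r"
  shows "integrable lborel (\<lambda>\<xi>. power_spectrum u \<xi> * exp (- r\<^sup>2 * (norm \<xi>)\<^sup>2 / 2))"
    and "(LINT \<xi>|lborel. power_spectrum u \<xi> * exp (- r\<^sup>2 * (norm \<xi>)\<^sup>2 / 2))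
      = sqrt (2 * pi) ^ DIM('a) * (LINT z|lborel. autocorrelation u (r *\<^sub>R z) * exp (- (norm z)\<^sup>2 / 2))"
proof -
  define A where "A = autocorrelation u"
  have A: "integrable lborel A" unfolding A_def by (rule integrable_autocorrelation[OF u])
  have [measurable]: "A \<in> borel_measurable borel" using A by (simp add: borel_measurable_integrable)
  define G where "G \<xi> = exp (- r\<^sup>2 * (norm \<xi>)\<^sup>2 / 2)" for \<xi> :: 'a
  have r2: "0 < r\<^sup>2" using r by simp
  have G: "integrable lborel G" unfolding G_def[abs_def] by (rule gaussian_fourier(1)[OF r2])
  have [measurable]: "G \<in> borel_measurable borel" using G by (simp add: borel_measurable_integrable)
  have i0: "integrable (lborel \<Otimes>\<^sub>M lborel) (\<lambda>(\<xi>, z). G \<xi> * A z)"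
    by (rule lborel_pair.Fubini_integrable) (use G A in \<open>auto simp: abs_mult\<close>)
  have i: "integrable (lborel \<Otimes>\<^sub>M lborel) (\<lambda>(\<xi>, z). G \<xi> * A z * cos (\<xi> \<bullet> z))"
    by (rule Bochner_Integration.integrable_bound[OF i0])
      (auto simp: abs_mult split_beta intro!: AE_I2 mult_left_le)
  have P: "power_spectrum u \<xi> * G \<xi> = (LINT z|lborel. G \<xi> * A z * cos (\<xi> \<bullet> z))" for \<xi>
    unfolding cos_transform_autocorrelation[OF u, symmetric] cos_transform_def A_def integral_mult_left_zero[symmetric]
    by (intro Bochner_Integration.integral_cong refl) (simp add: ac_simps)
  have "integrable lborel (\<lambda>\<xi>. power_spectrum u \<xi> * G \<xi>)"
    using lborel_pair.integrable_fst'[OF i] by (simp add: P)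
  then show "integrable lborel (\<lambda>\<xi>. power_spectrum u \<xi> * exp (- r\<^sup>2 * (norm \<xi>)\<^sup>2 / 2))"
    unfolding G_def .
  have "(LINT \<xi>|lborel. power_spectrum u \<xi> * G \<xi>) = (LINT \<xi>|lborel. LINT z|lborel. G \<xi> * A z * cos (\<xi> \<bullet> z))"
    by (simp add: P)
  also have "\<dots> = (LINT z|lborel. LINT \<xi>|lborel. G \<xi> * A z * cos (\<xi> \<bullet> z))"
    by (rule lborel_pair.Fubini_integral[OF i, symmetric])
  also have "\<dots> = (LINT z|lborel. A z * (LINT \<xi>|lborel. cos (z \<bullet> \<xi>) * G \<xi>))"
    unfolding integral_mult_right_zero[symmetric]
    by (intro Bochner_Integration.integral_cong refl) (simp add: inner_commute ac_simps)
  also have "\<dots> = (LINT z|lborel. A z * (sqrt (2 * pi / r\<^sup>2) ^ DIM('a) * exp (- (norm z)\<^sup>2 / (2 * r\<^sup>2))))"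
    unfolding G_def gaussian_fourier(2)[OF r2] ..
  \<comment> \<open>Rescaling by \<open>r\<close> moves the parameter from the Gaussian into the
    argument of the autocorrelation: a fixed Gaussian remains, and \<open>r\<close> can tend to
    0.\<close>
  also have "\<dots> = \<bar>r\<bar> ^ DIM('a) *\<^sub>R (LINT z|lborel. A (0 + r *\<^sub>R z) * (sqrt (2 * pi / r\<^sup>2) ^ DIM('a) * exp (- (norm (0 + r *\<^sub>R z))\<^sup>2 / (2 * r\<^sup>2))))"
  proof (rule integral_lborel_affine)
    show "integrable lborel (\<lambda>z. A z * (sqrt (2 * pi / r\<^sup>2) ^ DIM('a) * exp (- (norm z)\<^sup>2 / (2 * r\<^sup>2))))"
    proof (rule Bochner_Integration.integrable_bound)
      show "integrable lborel (\<lambda>z. sqrt (2 * pi / r\<^sup>2) ^ DIM('a) * A z)" using A by auto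
      show "AE x in lborel. norm (A x * (sqrt (2 * pi / r\<^sup>2) ^ DIM('a) * exp (- (norm x)\<^sup>2 / (2 * r\<^sup>2))))
         \<le> norm (sqrt (2 * pi / r\<^sup>2) ^ DIM('a) * A x)"
        using r by (intro AE_I2) (auto simp: abs_mult mult.commute mult.left_commute intro!: mult_left_mono mult_left_le)
    qed measurable
  qed (use r in simp)
  also have "\<dots> = (LINT z|lborel. sqrt (2 * pi) ^ DIM('a) * (A (r *\<^sub>R z) * exp (- (norm z)\<^sup>2 / 2)))"
  proof -
    have e: "(norm (r *\<^sub>R z))\<^sup>2 / (2 * r\<^sup>2) = (norm z)\<^sup>2 / 2" for z :: 'a
      using r by (simp add: power_mult_distrib)
    have s: "r ^ DIM('a) * sqrt (2 * pi / r\<^sup>2) ^ DIM('a) = sqrt (2 * pi) ^ DIM('a)"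
      using r by (simp add: power_mult_distrib[symmetric] real_sqrt_divide)
    show ?thesis
      unfolding real_scaleR_def integral_mult_right_zero[symmetric]
      using r by (intro Bochner_Integration.integral_cong)
        (simp_all add: e s[symmetric] minus_divide_left[symmetric] mult.assoc mult.left_commute, simp add: power_mult_distrib)
  qed
  finally show "(LINT \<xi>|lborel. power_spectrum u \<xi> * exp (- r\<^sup>2 * (norm \<xi>)\<^sup>2 / 2))
      = sqrt (2 * pi) ^ DIM('a) * (LINT z|lborel. autocorrelation u (r *\<^sub>R z) * exp (- (norm z)\<^sup>2 / 2))"
    by (simp add: G_def A_def)
qed

text \<open>The Gaussian weight is widened to 1. The weighted integrals converge because the
  autocorrelation is continuous at 0 and bounded by its value there; monotone convergence then
  yields integrability of the spectrum together with its integral.\<close>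

theorem plancherel:
  fixes u :: "'a::euclidean_space \<Rightarrow> real"
  assumes u: "integrable lborel u" and u2: "integrable lborel (\<lambda>x. (u x)\<^sup>2)"
  shows "integrable lborel (power_spectrum u)"
    and "(LINT \<xi>|lborel. power_spectrum u \<xi>) = (2 * pi) ^ DIM('a) * (LINT x|lborel. (u x)\<^sup>2)"
proof -
  have [measurable]: "u \<in> borel_measurable borel" using u by (simp add: borel_measurable_integrable)
  define A where "A = autocorrelation u"
  have [measurable]: "A \<in> borel_measurable borel"
    using integrable_autocorrelation[OF u] by (simp add: borel_measurable_integrable A_def)
  define G where "G z = exp (- (norm z)\<^sup>2 / 2)" for z :: 'a
  have Gi: "integrable lborel G" unfolding G_def[abs_def] using gaussian_fourier(1)[of 1] by simp
  have G1: "(LINT z|lborel. G z) = sqrt (2 * pi) ^ DIM('a)"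
    unfolding G_def[abs_def] using gaussian_fourier(2)[of 1 "0::'a"] by simp
  have [measurable]: "G \<in> borel_measurable borel" using Gi by (simp add: borel_measurable_integrable)
  \<comment> \<open>Decreasing, so that the Gaussian weights increase with \<open>k\<close>, as
    monotone convergence demands.\<close>
  define r where "r k = inverse (real (Suc k))" for k
  have r: "0 < r k" for k by (simp add: r_def)
  have r0: "r \<longlonglongrightarrow> 0" unfolding r_def by (rule LIMSEQ_inverse_real_of_nat)
  have lim: "(\<lambda>k. LINT z|lborel. A (r k *\<^sub>R z) * G z) \<longlonglongrightarrow> (LINT z|lborel. A 0 * G z)"
  proof (rule integral_dominated_convergence)
    show "integrable lborel (\<lambda>z. A 0 * G z)" using Gi by simp
    show "AE z in lborel. (\<lambda>k. A (r k *\<^sub>R z) * G z) \<longlonglongrightarrow> A 0 * G z"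
    proof (intro AE_I2 tendsto_intros)
      fix z :: 'a
      have "(\<lambda>k. r k *\<^sub>R z) \<longlonglongrightarrow> 0 *\<^sub>R z" by (intro tendsto_intros r0)
      then have "(\<lambda>k. L2_shift_diff u (r k *\<^sub>R z)) \<longlonglongrightarrow> 0"
        by (intro L2_shift_continuous u2) auto
      then have "(\<lambda>k. A 0 - L2_shift_diff u (r k *\<^sub>R z) / 2) \<longlonglongrightarrow> A 0 - 0 / 2"
        by (intro tendsto_intros) auto
      then show "(\<lambda>k. A (r k *\<^sub>R z)) \<longlonglongrightarrow> A 0"
        unfolding A_def autocorrelation_shift_diff[OF \<open>u \<in> borel_measurable borel\<close> u2, of "r _ *\<^sub>R z"] by simp
    qed
    show "AE z in lborel. norm (A (r k *\<^sub>R z) * G z) \<le> A 0 * G z" for k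
      using abs_autocorrelation_le[OF _ u2] by (auto simp: A_def abs_mult G_def intro!: mult_right_mono)
  qed measurable
  have "has_bochner_integral lborel (power_spectrum u) ((2 * pi) ^ DIM('a) * A 0)"
  proof (rule has_bochner_integral_monotone_convergence)
    show "integrable lborel (\<lambda>\<xi>. power_spectrum u \<xi> * exp (- (r k)\<^sup>2 * (norm \<xi>)\<^sup>2 / 2))" for k
      by (rule integral_power_spectrum_gaussian(1)[OF u r])
    show "AE \<xi> in lborel. mono (\<lambda>k. power_spectrum u \<xi> * exp (- (r k)\<^sup>2 * (norm \<xi>)\<^sup>2 / 2))"
    proof (intro AE_I2 incseq_SucI mult_left_mono power_spectrum_nonneg)
      fix \<xi> :: 'a and k
      have "(r (Suc k))\<^sup>2 \<le> (r k)\<^sup>2" by (intro power_mono) (auto simp: r_def field_simps)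
      then have "(r (Suc k))\<^sup>2 * (norm \<xi>)\<^sup>2 \<le> (r k)\<^sup>2 * (norm \<xi>)\<^sup>2" by (intro mult_right_mono) auto
      then show "exp (- (r k)\<^sup>2 * (norm \<xi>)\<^sup>2 / 2) \<le> exp (- (r (Suc k))\<^sup>2 * (norm \<xi>)\<^sup>2 / 2)" by simp
    qed
    show "AE \<xi> in lborel. (\<lambda>k. power_spectrum u \<xi> * exp (- (r k)\<^sup>2 * (norm \<xi>)\<^sup>2 / 2)) \<longlonglongrightarrow> power_spectrum u \<xi>"
    proof (intro AE_I2)
      fix \<xi> :: 'a
      have "(\<lambda>k. power_spectrum u \<xi> * exp (- (r k)\<^sup>2 * (norm \<xi>)\<^sup>2 / 2)) \<longlonglongrightarrow> power_spectrum u \<xi> * exp (- 0\<^sup>2 * (norm \<xi>)\<^sup>2 / 2)"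
        by (intro tendsto_intros r0) auto
      then show "(\<lambda>k. power_spectrum u \<xi> * exp (- (r k)\<^sup>2 * (norm \<xi>)\<^sup>2 / 2)) \<longlonglongrightarrow> power_spectrum u \<xi>" by simp
    qed
    have "(\<lambda>k. sqrt (2 * pi) ^ DIM('a) * (LINT z|lborel. A (r k *\<^sub>R z) * G z)) \<longlonglongrightarrow> sqrt (2 * pi) ^ DIM('a) * (LINT z|lborel. A 0 * G z)"
      by (intro tendsto_intros lim)
    \<comment> \<open>One factor is left by the transform of the Gaussian weight, the other is the
      total mass of \<open>G\<close>.\<close>
    also have "sqrt (2 * pi) ^ DIM('a) * (LINT z|lborel. A 0 * G z) = (2 * pi) ^ DIM('a) * A 0"
    proof -
      have "sqrt (2 * pi) ^ DIM('a) * sqrt (2 * pi) ^ DIM('a) = (2 * pi) ^ DIM('a)"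
        by (subst power_mult_distrib[symmetric]) simp
      then show ?thesis by (simp only: integral_mult_right_zero G1 ac_simps)
    qed
    finally show "(\<lambda>k. LINT \<xi>|lborel. power_spectrum u \<xi> * exp (- (r k)\<^sup>2 * (norm \<xi>)\<^sup>2 / 2)) \<longlonglongrightarrow> (2 * pi) ^ DIM('a) * A 0"
      by (simp add: integral_power_spectrum_gaussian(2)[OF u r, simplified] A_def G_def)
  qed simp
  then show "integrable lborel (power_spectrum u)"
    and "(LINT \<xi>|lborel. power_spectrum u \<xi>) = (2 * pi) ^ DIM('a) * (LINT x|lborel. (u x)\<^sup>2)"
    by (auto simp: has_bochner_integral_iff A_def autocorrelation_0)
qed

section \<open>Smooth bumps and null boundaries\<close>

text \<open>The derivative of \<open>exp (- (1/t)) / t ^ m\<close> is a combination of the same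
  expressions with larger exponents. Keeping the whole family makes it closed under differentiation,
  so smoothness follows by induction.\<close>

definition flat_exp :: "nat \<Rightarrow> real \<Rightarrow> real" where
  "flat_exp m t = (if t \<le> 0 then 0 else exp (- (1 / t)) / t ^ m)"

lemma flat_exp_nonneg: "0 \<le> flat_exp m t" by (simp add: flat_exp_def)

lemma flat_exp_0_pos: "0 < t \<Longrightarrow> 0 < flat_exp 0 t" by (simp add: flat_exp_def)

lemma flat_exp_eq_0: "t \<le> 0 \<Longrightarrow> flat_exp m t = 0" by (simp add: flat_exp_def)

lemma flat_exp_0_le_1: "flat_exp 0 t \<le> 1" by (simp add: flat_exp_def)

text \<open>From \<open>x^2 / 2 \<le> exp x\<close> at \<open>x = 1/t\<close>. The bound controls
  the derivative of a bump independently of its radius.\<close>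

lemma flat_exp_2_le_2: "flat_exp 2 t \<le> 2"
proof (cases "t \<le> 0")
  case False
  have "(1 / t)\<^sup>2 / 2 \<le> exp (1 / t)"
    using exp_lower_Taylor_quadratic[of "1 / t"] False by (smt (verit) divide_nonneg_nonneg)
  then have "exp (- (1 / t)) * (1 / t)\<^sup>2 \<le> exp (- (1 / t)) * (2 * exp (1 / t))"
    by (intro mult_left_mono) auto
  also have "\<dots> = 2" by (simp add: exp_minus)
  finally show ?thesis using False by (simp add: flat_exp_def power_divide)
qed (simp add: flat_exp_def)

lemma flat_exp_tendsto_0: "((flat_exp m) \<longlongrightarrow> 0) (at 0)"
proof -
  have "((\<lambda>x. x ^ m / exp x) \<longlongrightarrow> (0::real)) at_top" by (rule tendsto_power_div_exp_0)
  then have "((\<lambda>t. inverse t ^ m / exp (inverse t)) \<longlongrightarrow> (0::real)) (at_right 0)"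
    by (rule filterlim_compose[OF _ filterlim_inverse_at_top_right])
  moreover have "\<forall>\<^sub>F t in at_right 0. inverse t ^ m / exp (inverse t) = flat_exp m t"
    using eventually_at_right_less[of 0]
    by eventually_elim (simp add: flat_exp_def exp_minus field_simps)
  ultimately have r: "((flat_exp m) \<longlongrightarrow> 0) (at_right 0)" by (rule Lim_transform_eventually)
  have "\<forall>\<^sub>F t in at_left (0::real). t < 0" by (auto simp: eventually_at_filter)
  then have "\<forall>\<^sub>F t in at_left 0. flat_exp m t = 0" by eventually_elim (simp add: flat_exp_def)
  then have "((flat_exp m) \<longlongrightarrow> 0) (at_left 0)" by (rule tendsto_eventually)
  with r show ?thesis by (simp add: filterlim_at_split)
qed

lemma DERIV_flat_exp: "(flat_exp m has_real_derivative (flat_exp (m + 2) t - real m * flat_exp (m + 1) t)) (at t)"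
proof -
  consider "t < 0" | "t = 0" | "0 < t" by linarith
  then show ?thesis
  proof cases
    case 1
    have "((\<lambda>_. 0) has_real_derivative 0) (at t)" by simp
    moreover have "\<forall>\<^sub>F x in nhds t. (0::real) = flat_exp m x"
      using 1 eventually_nhds_in_open[of "{..<0}" t] by (auto elim!: eventually_mono simp: flat_exp_def)
    ultimately show ?thesis using 1 by (subst (asm) DERIV_cong_ev[OF refl _ refl]) (auto simp: flat_exp_def)
  next
    case 2
    \<comment> \<open>Division by the increment merely raises the index, so the difference quotient
      at 0 again belongs to the family.\<close>
    have "flat_exp m h / h = flat_exp (m + 1) h" for h by (simp add: flat_exp_def)
    then have "((\<lambda>h. flat_exp m h / h) \<longlongrightarrow> 0) (at 0)" using flat_exp_tendsto_0[of "m + 1"] by simp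
    then show ?thesis using 2 by (simp add: DERIV_def flat_exp_def)
  next
    case 3
    have "((\<lambda>t. exp (- (1 / t)) / t ^ m) has_real_derivative
        (exp (- (1 / t)) * (1 / t\<^sup>2) * t ^ m - exp (- (1 / t)) * (real m * t ^ (m - 1))) / (t ^ m * t ^ m)) (at t)"
      using 3 by (auto intro!: derivative_eq_intros simp: power2_eq_square)
    also have "(exp (- (1 / t)) * (1 / t\<^sup>2) * t ^ m - exp (- (1 / t)) * (real m * t ^ (m - 1))) / (t ^ m * t ^ m)
        = flat_exp (m + 2) t - real m * flat_exp (m + 1) t"
      using 3 by (cases m) (simp_all add: flat_exp_def field_simps power2_eq_square)
    finally have *: "((\<lambda>t. exp (- (1 / t)) / t ^ m) has_real_derivative (flat_exp (m + 2) t - real m * flat_exp (m + 1) t)) (at t)" .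
    moreover have "\<forall>\<^sub>F x in nhds t. exp (- (1 / x)) / x ^ m = flat_exp m x"
      using 3 eventually_nhds_in_open[of "{0<..}" t] by (auto elim!: eventually_mono simp: flat_exp_def)
    ultimately show ?thesis by (subst (asm) DERIV_cong_ev[OF refl _ refl]) auto
  qed
qed

lemma continuous_on_flat_exp [continuous_intros]:
  "continuous_on S f \<Longrightarrow> continuous_on S (\<lambda>x. flat_exp m (f x))"
proof -
  have "continuous_on UNIV (flat_exp m)"
    using DERIV_flat_exp by (intro continuous_at_imp_continuous_on ballI DERIV_isCont)
  then show "continuous_on S f \<Longrightarrow> continuous_on S (\<lambda>x. flat_exp m (f x))"
    by (rule continuous_on_compose2) auto
qed

section \<open>Calculus of continuously differentiable functions\<close>

lemma Ck_SucI:
  assumes "\<And>x. (f has_derivative (\<lambda>h. g x \<bullet> h)) (at x)" "\<And>i. i \<in> Basis \<Longrightarrow> Ck k (\<lambda>x. g x \<bullet> i)"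
  shows "Ck (Suc k) f"
  using assms by auto

lemma Ck_SucE:
  assumes "Ck (Suc k) f"
  obtains g where "\<And>x. (f has_derivative (\<lambda>h. g x \<bullet> h)) (at x)" "\<And>i. i \<in> Basis \<Longrightarrow> Ck k (\<lambda>x. g x \<bullet> i)"
  using assms by auto

lemma Ck_Suc_imp: "Ck (Suc k) f \<Longrightarrow> Ck k f"
proof (induction k arbitrary: f)
  case 0
  then show ?case
    by (auto elim!: Ck_SucE simp del: Ck.simps(2) simp: continuous_on_eq_continuous_at intro: has_derivative_continuous)
next
  case (Suc k)
  from Suc.prems obtain g where "\<And>x. (f has_derivative (\<lambda>h. g x \<bullet> h)) (at x)"
    "\<And>i. i \<in> Basis \<Longrightarrow> Ck (Suc k) (\<lambda>x. g x \<bullet> i)" by (rule Ck_SucE) blast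
  then show ?case by (intro Ck_SucI[of f g]) (auto intro: Suc.IH simp del: Ck.simps(2))
qed

lemma Ck_const: "Ck k (\<lambda>x. c)"
proof (induction k arbitrary: c)
  case (Suc k)
  show ?case by (rule Ck_SucI[where g = "\<lambda>_. 0"]) (use Suc in \<open>auto intro!: derivative_eq_intros\<close>)
qed auto

lemma Ck_inner: "Ck k (\<lambda>x. x \<bullet> v)"
proof (cases k)
  case (Suc j)
  show ?thesis unfolding Suc
    by (rule Ck_SucI[where g = "\<lambda>_. v"]) (auto intro!: derivative_eq_intros Ck_const simp: inner_commute)
qed (auto intro!: continuous_intros)

lemma Ck_add: "Ck k f \<Longrightarrow> Ck k g \<Longrightarrow> Ck k (\<lambda>x. f x + g x)"
proof (induction k arbitrary: f g)
  case (Suc k)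
  from Suc.prems(1) obtain f' where f: "\<And>x. (f has_derivative (\<lambda>h. f' x \<bullet> h)) (at x)"
    "\<And>i. i \<in> Basis \<Longrightarrow> Ck k (\<lambda>x. f' x \<bullet> i)" by (rule Ck_SucE) blast
  from Suc.prems(2) obtain g' where g: "\<And>x. (g has_derivative (\<lambda>h. g' x \<bullet> h)) (at x)"
    "\<And>i. i \<in> Basis \<Longrightarrow> Ck k (\<lambda>x. g' x \<bullet> i)" by (rule Ck_SucE) blast
  show ?case
    by (rule Ck_SucI[where g = "\<lambda>x. f' x + g' x"])
      (auto intro!: derivative_eq_intros f g Suc.IH simp: inner_add_left)
qed (auto intro!: continuous_intros)

lemma Ck_mult: "Ck k f \<Longrightarrow> Ck k g \<Longrightarrow> Ck k (\<lambda>x. f x * g x)"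
proof (induction k arbitrary: f g)
  case (Suc k)
  from Suc.prems(1) obtain f' where f: "\<And>x. (f has_derivative (\<lambda>h. f' x \<bullet> h)) (at x)"
    "\<And>i. i \<in> Basis \<Longrightarrow> Ck k (\<lambda>x. f' x \<bullet> i)" by (rule Ck_SucE) blast
  from Suc.prems(2) obtain g' where g: "\<And>x. (g has_derivative (\<lambda>h. g' x \<bullet> h)) (at x)"
    "\<And>i. i \<in> Basis \<Longrightarrow> Ck k (\<lambda>x. g' x \<bullet> i)" by (rule Ck_SucE) blast
  have fg: "Ck k f" "Ck k g" using Suc.prems Ck_Suc_imp by blast+
  show ?case
  proof (rule Ck_SucI[where g = "\<lambda>x. f x *\<^sub>R g' x + g x *\<^sub>R f' x"])
    show "((\<lambda>x. f x * g x) has_derivative (\<lambda>h. (f x *\<^sub>R g' x + g x *\<^sub>R f' x) \<bullet> h)) (at x)" for x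
      by (rule has_derivative_eq_rhs[OF has_derivative_mult[OF f(1) g(1)]])
        (auto simp: inner_add_left algebra_simps)
    show "Ck k (\<lambda>x. (f x *\<^sub>R g' x + g x *\<^sub>R f' x) \<bullet> i)" if "i \<in> Basis" for i
      using that by (simp add: inner_add_left) (intro Ck_add Suc.IH fg f g)
  qed
qed (auto intro!: continuous_intros)

lemma has_derivative_compose_real:
  assumes "\<And>x. (q has_derivative (\<lambda>h. q' x \<bullet> h)) (at x)" "(f has_real_derivative d) (at (q x))"
  shows "((\<lambda>x. f (q x)) has_derivative (\<lambda>h. (d *\<^sub>R q' x) \<bullet> h)) (at x)"
  using has_derivative_compose[OF assms(1), of f "(*) d"] assms(2) by (simp add: has_field_derivative_def)

text \<open>The index \<open>m\<close> has to vary in the induction, because the derivative involves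
  \<open>m + 1\<close> and \<open>m + 2\<close>.\<close>

lemma Ck_flat_exp: "(\<And>j. Ck j q) \<Longrightarrow> Ck k (\<lambda>x. flat_exp m (q x))"
proof (induction k arbitrary: m)
  case 0
  have "Ck 0 q" by (rule 0)
  then show ?case by (auto intro!: continuous_intros)
next
  case (Suc k)
  obtain q' where q': "\<And>x. (q has_derivative (\<lambda>h. q' x \<bullet> h)) (at x)"
    "\<And>i. i \<in> Basis \<Longrightarrow> Ck k (\<lambda>x. q' x \<bullet> i)" by (rule Ck_SucE[OF Suc.prems[of "Suc k"]]) blast
  show ?case
  proof (rule Ck_SucI)
    show "((\<lambda>x. flat_exp m (q x)) has_derivative (\<lambda>h. ((flat_exp (m + 2) (q x) - real m * flat_exp (m + 1) (q x)) *\<^sub>R q' x) \<bullet> h)) (at x)" for x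
      by (rule has_derivative_compose_real[OF q'(1) DERIV_flat_exp])
    show "Ck k (\<lambda>x. ((flat_exp (m + 2) (q x) - real m * flat_exp (m + 1) (q x)) *\<^sub>R q' x) \<bullet> i)" if "i \<in> Basis" for i
      using Ck_mult[OF Ck_add[OF Suc.IH[of "m + 2"] Ck_mult[OF Ck_const[of k "- real m"] Suc.IH[of "m + 1"]]] q'(2)[OF that]] Suc.prems
      by simp
  qed
qed

text \<open>A simultaneous induction, as each function is, up to constants, the derivative of the
  other.\<close>

lemma Ck_sin_cos:
  "Ck k (\<lambda>x. cos (\<xi> \<bullet> x)) \<and> Ck k (\<lambda>x. sin (\<xi> \<bullet> x))"
proof (induction k)
  case (Suc k)
  have d: "((\<lambda>x. cos (\<xi> \<bullet> x)) has_derivative (\<lambda>h. (- sin (\<xi> \<bullet> x) *\<^sub>R \<xi>) \<bullet> h)) (at x)"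
    "((\<lambda>x. sin (\<xi> \<bullet> x)) has_derivative (\<lambda>h. (cos (\<xi> \<bullet> x) *\<^sub>R \<xi>) \<bullet> h)) (at x)" for x
    by (auto intro!: derivative_eq_intros)
  have c: "Ck k (\<lambda>x. (- sin (\<xi> \<bullet> x) *\<^sub>R \<xi>) \<bullet> i)" "Ck k (\<lambda>x. (cos (\<xi> \<bullet> x) *\<^sub>R \<xi>) \<bullet> i)" for i
    using Ck_mult[OF Ck_const[of k "- (\<xi> \<bullet> i)"] conjunct2[OF Suc]] Ck_mult[OF Ck_const[of k "\<xi> \<bullet> i"] conjunct1[OF Suc]]
    by (simp_all add: mult.commute)
  show ?case using Ck_SucI[OF d(1) c(1)] Ck_SucI[OF d(2) c(2)] by blast
qed (auto intro!: continuous_intros)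

section \<open>Radial bumps and cut-off test functions\<close>

text \<open>The square of the norm keeps the argument smooth at the centre as well. The index is
  carried along because the derivative of \<open>bump 0\<close> is expressed through
  \<open>bump 2\<close>.\<close>

definition bump :: "nat \<Rightarrow> 'a::euclidean_space \<Rightarrow> real \<Rightarrow> 'a \<Rightarrow> real" where
  "bump m c R x = flat_exp m (R\<^sup>2 - (norm (x - c))\<^sup>2)"

lemma bump_eq_0: "0 \<le> R \<Longrightarrow> R \<le> norm (x - c) \<Longrightarrow> bump m c R x = 0"
  unfolding bump_def by (intro flat_exp_eq_0) (simp add: power_mono)

lemma bump_0_pos: "norm (x - c) < R \<Longrightarrow> 0 < bump 0 c R x"
  unfolding bump_def by (intro flat_exp_0_pos) (simp add: power_strict_mono)

lemma continuous_on_bump: "continuous_on S (bump m c R)"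
  unfolding bump_def[abs_def] by (intro continuous_intros)

lemma measurable_bump [measurable]: "bump m c R \<in> borel_measurable borel"
  by (rule borel_measurable_continuous_onI[OF continuous_on_bump])

lemma abs_bump: "\<bar>bump 0 c R x\<bar> \<le> 1" "\<bar>bump 2 c R x\<bar> \<le> 2"
  using flat_exp_nonneg flat_exp_0_le_1 flat_exp_2_le_2 by (auto simp: bump_def)

text \<open>At index 0 the second term in the derivative of \<open>flat_exp\<close> drops out;
  \<open>- 2 * (x - c)\<close> is the gradient of the inner quadratic.\<close>

lemma has_derivative_bump:
  "(bump 0 c R has_derivative (\<lambda>h. (- 2 * bump 2 c R x) * ((x - c) \<bullet> h))) (at x)"
proof -
  have q: "((\<lambda>x. R\<^sup>2 - (norm (x - c))\<^sup>2) has_derivative (\<lambda>h. (- 2 *\<^sub>R (x - c)) \<bullet> h)) (at x)" for x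
    unfolding power2_norm_eq_inner
    by (rule has_derivative_eq_rhs, (rule derivative_intros)+) (auto simp: fun_eq_iff inner_commute)
  show ?thesis
    using has_derivative_compose_real[OF q DERIV_flat_exp[of 0]] by (simp add: bump_def[abs_def] numeral_2_eq_2 ac_simps)
qed

lemma Ck_bump: "Ck k (bump m c R)"
proof -
  have "Ck j (\<lambda>x. R\<^sup>2 - (norm (x - c))\<^sup>2)" for j
  proof (cases j)
    case (Suc i)
    show ?thesis unfolding Suc
    proof (rule Ck_SucI)
      show "((\<lambda>x. R\<^sup>2 - (norm (x - c))\<^sup>2) has_derivative (\<lambda>h. (- 2 *\<^sub>R (x - c)) \<bullet> h)) (at x)" for x
        unfolding power2_norm_eq_inner
        by (rule has_derivative_eq_rhs, (rule derivative_intros)+) (auto simp: fun_eq_iff inner_commute)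
      show "Ck i (\<lambda>x. (- 2 *\<^sub>R (x - c)) \<bullet> b)" for b
        using Ck_add[OF Ck_mult[OF Ck_const[of i "-2"] Ck_inner[of i b]] Ck_const[of i "2 * (c \<bullet> b)"]]
        by (simp add: inner_diff_left algebra_simps)
    qed
  qed (auto intro!: continuous_intros)
  then show ?thesis unfolding bump_def[abs_def] by (rule Ck_flat_exp)
qed

lemma test_function_bump_mult:
  assumes "\<And>k. Ck k f" "0 \<le> R"
  shows "test_function (\<lambda>x. bump 0 c R x * f x)"
proof -
  have "closure {x. bump 0 c R x * f x \<noteq> 0} \<subseteq> cball c R"
    by (rule closure_minimal)
      (use assms(2) bump_eq_0 in \<open>force simp: dist_norm norm_minus_commute\<close>, simp)
  then have "bounded (closure {x. bump 0 c R x * f x \<noteq> 0})"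
    using bounded_cball bounded_subset by blast
  then show ?thesis
    using assms by (auto simp: test_function_def compact_eq_bounded_closed intro!: Ck_mult Ck_bump)
qed

section \<open>The frontier of the domain has measure zero\<close>

text \<open>The measure is averaged over the translates by \<open>t *\<^sub>R \<nu>\<close> with
  \<open>t\<close> in the unit interval. After Fubini the inner integral runs along a line parallel
  to \<open>\<nu>\<close>, which meets \<open>E\<close> in at most one point. No change of
  coordinates is involved.\<close>

lemma null_set_if_sparse_lines:
  fixes E :: "'a::euclidean_space set"
  assumes [measurable]: "E \<in> sets borel"
    and unique: "\<And>x t t'. x + t *\<^sub>R \<nu> \<in> E \<Longrightarrow> x + t' *\<^sub>R \<nu> \<in> E \<Longrightarrow> t = t'"
  shows "emeasure lborel E = 0"
proof -
  have "emeasure lborel E = (\<integral>\<^sup>+t. indicator {0..1::real} t * emeasure lborel E \<partial>lborel)"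
    by (simp add: nn_integral_multc)
  also have "\<dots> = (\<integral>\<^sup>+t. (\<integral>\<^sup>+x. indicator {0..1::real} t * indicator E (x + t *\<^sub>R \<nu>) \<partial>lborel) \<partial>lborel)"
    by (simp add: nn_integral_cmult nn_integral_lborel_shift[of "indicator E"])
  also have "\<dots> = (\<integral>\<^sup>+x. (\<integral>\<^sup>+t. indicator {0..1::real} t * indicator E (x + t *\<^sub>R \<nu>) \<partial>lborel) \<partial>lborel)"
    by (rule lborel_pair.Fubini') measurable
  also have "\<dots> = (\<integral>\<^sup>+x. 0 \<partial>(lborel::'a measure))"
  proof (intro nn_integral_cong)
    fix x
    have "\<exists>s. \<forall>t. x + t *\<^sub>R \<nu> \<in> E \<longrightarrow> t = s" using unique[of x] by blast
    then obtain s where s: "\<And>t. x + t *\<^sub>R \<nu> \<in> E \<Longrightarrow> t = s" by blast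
    have "(\<integral>\<^sup>+t. indicator {0..1::real} t * indicator E (x + t *\<^sub>R \<nu>) \<partial>lborel) = (\<integral>\<^sup>+t. 0 \<partial>(lborel :: real measure))"
    proof (rule nn_integral_cong_AE)
      show "AE t in lborel. indicator {0..1::real} t * indicator E (x + t *\<^sub>R \<nu>) = (0::ennreal)"
        using AE_lborel_singleton[of s] by eventually_elim (use s in \<open>auto simp: indicator_def\<close>)
    qed
    then show "(\<integral>\<^sup>+t. indicator {0..1::real} t * indicator E (x + t *\<^sub>R \<nu>) \<partial>lborel) = (0::ennreal)" by simp
  qed
  finally show ?thesis by simp
qed

text \<open>Near each of its points the frontier lies in the graph of \<open>\<gamma>\<close> over
  the hyperplane orthogonal to \<open>\<nu>\<close>, and a line parallel to \<open>\<nu>\<close>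
  meets this graph at most once. By compactness finitely many such neighbourhoods suffice.\<close>

lemma frontier_null_set:
  fixes \<Omega> :: "'a::euclidean_space set"
  assumes C1: "C1_boundary \<Omega>" and op: "open \<Omega>" and bd: "bounded \<Omega>"
  shows "frontier \<Omega> \<in> null_sets lborel"
proof -
  have "\<exists>r>0. frontier \<Omega> \<inter> ball p r \<in> null_sets lborel" if "p \<in> frontier \<Omega>" for p
  proof -
    from C1 that obtain r \<nu> \<gamma> where r: "r > 0" "norm \<nu> = 1" "Ck 1 \<gamma>"
      and eq: "\<And>x. x \<in> ball p r \<Longrightarrow> x \<in> \<Omega> \<longleftrightarrow> \<gamma> (x - (x \<bullet> \<nu>) *\<^sub>R \<nu>) < x \<bullet> \<nu>"
      unfolding C1_boundary_def by blast
    have "Ck 0 \<gamma>" using r(3) Ck_Suc_imp[of 0] by simp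
    then have \<gamma>: "continuous_on UNIV \<gamma>" by simp
    have "continuous_on UNIV (\<lambda>x. \<gamma> (x - (x \<bullet> \<nu>) *\<^sub>R \<nu>))"
      by (rule continuous_on_compose2[OF \<gamma>]) (auto intro!: continuous_intros)
    then have op2: "open {x. x \<bullet> \<nu> < \<gamma> (x - (x \<bullet> \<nu>) *\<^sub>R \<nu>)}"
      by (intro open_Collect_less continuous_intros)
    have E: "x \<bullet> \<nu> = \<gamma> (x - (x \<bullet> \<nu>) *\<^sub>R \<nu>)" if x: "x \<in> frontier \<Omega> \<inter> ball p r" for x
    proof -
      have "x \<notin> \<Omega>" using x op by (auto simp: frontier_def interior_open)
      then have "\<not> \<gamma> (x - (x \<bullet> \<nu>) *\<^sub>R \<nu>) < x \<bullet> \<nu>" using eq x by auto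
      moreover have "\<not> x \<bullet> \<nu> < \<gamma> (x - (x \<bullet> \<nu>) *\<^sub>R \<nu>)"
      proof
        assume lt: "x \<bullet> \<nu> < \<gamma> (x - (x \<bullet> \<nu>) *\<^sub>R \<nu>)"
        \<comment> \<open>The part of the ball strictly below the graph is open and misses
          \<open>\<Omega>\<close>, so it contains no point of the closure.\<close>
        let ?U = "ball p r \<inter> {x. x \<bullet> \<nu> < \<gamma> (x - (x \<bullet> \<nu>) *\<^sub>R \<nu>)}"
        have "open ?U" "x \<in> ?U" using op2 lt x by auto
        moreover have "?U \<inter> \<Omega> = {}" using eq by fastforce
        ultimately have "x \<notin> closure \<Omega>"
          using open_Int_closure_eq_empty by fastforce
        then show False using x by (auto simp: frontier_def)
      qed
      ultimately show ?thesis by linarith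
    qed
    have "emeasure lborel (frontier \<Omega> \<inter> ball p r) = 0"
    proof (rule null_set_if_sparse_lines)
      fix x t t' assume a: "x + t *\<^sub>R \<nu> \<in> frontier \<Omega> \<inter> ball p r" "x + t' *\<^sub>R \<nu> \<in> frontier \<Omega> \<inter> ball p r"
      have nn: "\<nu> \<bullet> \<nu> = 1" using r(2) by (simp add: norm_eq_1)
      have pr: "x + t *\<^sub>R \<nu> - ((x + t *\<^sub>R \<nu>) \<bullet> \<nu>) *\<^sub>R \<nu> = x - (x \<bullet> \<nu>) *\<^sub>R \<nu>" for t
        by (simp add: inner_add_left nn algebra_simps)
      from E[OF a(1)] E[OF a(2)] have "(x + t *\<^sub>R \<nu>) \<bullet> \<nu> = (x + t' *\<^sub>R \<nu>) \<bullet> \<nu>"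
        by (simp only: pr)
      then show "t = t'" by (simp add: inner_add_left nn)
    qed auto
    with r(1) show ?thesis by (auto simp: null_sets_def)
  qed
  then obtain r where r: "\<And>p. p \<in> frontier \<Omega> \<Longrightarrow> r p > 0 \<and> frontier \<Omega> \<inter> ball p (r p) \<in> null_sets lborel"
    by metis
  have "compact (frontier \<Omega>)" using bd by (rule compact_frontier_bounded)
  moreover have "\<And>B. B \<in> (\<lambda>p. ball p (r p)) ` frontier \<Omega> \<Longrightarrow> open B" by auto
  moreover have "frontier \<Omega> \<subseteq> \<Union> ((\<lambda>p. ball p (r p)) ` frontier \<Omega>)" using r by fastforce
  ultimately obtain C where C: "C \<subseteq> frontier \<Omega>" "finite C" "frontier \<Omega> \<subseteq> (\<Union>p\<in>C. ball p (r p))"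
    by (rule compactE_image[of "frontier \<Omega>" "frontier \<Omega>" "\<lambda>p. ball p (r p)"]) auto
  have "(\<Union>p\<in>C. frontier \<Omega> \<inter> ball p (r p)) \<in> null_sets lborel"
    using C r by (intro null_sets.finite_UN) auto
  moreover have "(\<Union>p\<in>C. frontier \<Omega> \<inter> ball p (r p)) = frontier \<Omega>" using C by blast
  ultimately show ?thesis by simp
qed

section \<open>The spectrum of a weak gradient\<close>

lemma integrable_L2_mult_bounded:
  fixes u w :: "'a::euclidean_space \<Rightarrow> real"
  assumes [measurable]: "u \<in> borel_measurable borel" "w \<in> borel_measurable borel"
    and u2: "integrable lborel (\<lambda>x. (u x)\<^sup>2)"
    and w: "\<And>x. \<bar>w x\<bar> \<le> B" "\<And>x. x \<notin> cball c R \<Longrightarrow> w x = 0"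
  shows "integrable lborel (\<lambda>x. u x * w x)" "integrable lborel (\<lambda>x. (u x * w x)\<^sup>2)"
proof -
  have w2: "(w x)\<^sup>2 \<le> B\<^sup>2" for x using w(1)[of x] by (metis abs_ge_zero power2_abs power_mono)
  have "integrable lborel (\<lambda>x. (w x)\<^sup>2)"
    by (rule Bochner_Integration.integrable_bound[OF integrable_indicator_cball[of c R "B\<^sup>2"]])
      (use w w2 in \<open>auto simp: indicator_def\<close>)
  then show "integrable lborel (\<lambda>x. u x * w x)" by (intro integrable_L2_mult u2) auto
  show "integrable lborel (\<lambda>x. (u x * w x)\<^sup>2)"
  proof (rule Bochner_Integration.integrable_bound)
    show "integrable lborel (\<lambda>x. B\<^sup>2 * (u x)\<^sup>2)" using u2 by simp
    show "AE x in lborel. norm ((u x * w x)\<^sup>2) \<le> norm (B\<^sup>2 * (u x)\<^sup>2)"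
      using mult_left_mono[OF w2 zero_le_power2] by (intro AE_I2) (simp add: power_mult_distrib mult.commute[of "B\<^sup>2"])
  qed measurable
qed

lemma integrable_L2_bounded_support:
  fixes u :: "'a::euclidean_space \<Rightarrow> real"
  assumes [measurable]: "u \<in> borel_measurable borel"
    and u2: "integrable lborel (\<lambda>x. (u x)\<^sup>2)"
    and supp: "AE x in lborel. x \<notin> cball c R \<longrightarrow> u x = 0"
  shows "integrable lborel u"
proof -
  have "integrable lborel (\<lambda>x. u x * indicator (cball c R) x)"
    by (rule integrable_L2_mult_bounded(1)[where B = 1 and c = c and R = R])
      (use u2 in \<open>auto simp: indicator_def\<close>)
  moreover have "AE x in lborel. u x * indicator (cball c R) x = u x"
    using supp by eventually_elim (auto simp: indicator_def)
  moreover have m: "u \<in> borel_measurable lborel" by simp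
  ultimately show ?thesis by (intro integrable_cong_AE_imp[OF _ m])
qed

text \<open>\<open>f\<close> stands for a cosine or sine of \<open>\<xi> \<bullet> x\<close> and
  \<open>d\<close> for its derivative in that argument. The term with \<open>bump 2\<close> is the
  error caused by the cutoff.\<close>

lemma weak_gradient_bump:
  fixes u :: "'a::euclidean_space \<Rightarrow> real"
  assumes g: "is_weak_gradient u g" and i: "i \<in> Basis" and R: "0 \<le> R"
    and f: "\<And>k. Ck k f" "\<And>x. (f has_derivative (\<lambda>h. d x * (\<xi> \<bullet> h))) (at x)"
  shows "(LINT x|lborel. u x * (bump 0 c R x * (d x * (\<xi> \<bullet> i)) - 2 * bump 2 c R x * ((x - c) \<bullet> i) * f x))
    = - (LINT x|lborel. (g x \<bullet> i) * (bump 0 c R x * f x))"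
proof -
  have "((\<lambda>x. bump 0 c R x * f x) has_derivative
      (\<lambda>h. bump 0 c R x * (d x * (\<xi> \<bullet> h)) + (- 2 * bump 2 c R x) * ((x - c) \<bullet> h) * f x)) (at x)" for x
    by (rule has_derivative_mult[OF has_derivative_bump f(2)])
  then have fd: "frechet_derivative (\<lambda>x. bump 0 c R x * f x) (at x) =
      (\<lambda>h. bump 0 c R x * (d x * (\<xi> \<bullet> h)) + (- 2 * bump 2 c R x) * ((x - c) \<bullet> h) * f x)" for x
    by (rule frechet_derivative_at[symmetric])
  have "test_function (\<lambda>x. bump 0 c R x * f x)" using f(1) R by (rule test_function_bump_mult)
  with g i have "(LINT x|lborel. u x * frechet_derivative (\<lambda>x. bump 0 c R x * f x) (at x) i)
      = - (LINT x|lborel. (g x \<bullet> i) * (bump 0 c R x * f x))"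
    unfolding is_weak_gradient_def by blast
  then show ?thesis by (simp add: fd)
qed

lemma has_derivative_cos_sin_inner:
  "((\<lambda>x. cos (\<xi> \<bullet> x)) has_derivative (\<lambda>h. - sin (\<xi> \<bullet> x) * (\<xi> \<bullet> h))) (at x)"
  "((\<lambda>x. sin (\<xi> \<bullet> x)) has_derivative (\<lambda>h. cos (\<xi> \<bullet> x) * (\<xi> \<bullet> h))) (at x)"
  by (auto intro!: derivative_eq_intros)

text \<open>Localised by a bump, the gradient has vanishing power spectrum, so Plancherel's theorem
  plays the part of the fundamental lemma of the calculus of variations.\<close>

lemma weak_gradient_eq_0_on_ball:
  fixes u :: "'a::euclidean_space \<Rightarrow> real"
  assumes u0: "AE x in lborel. x \<notin> \<Omega> \<longrightarrow> u x = 0" and disj: "ball c R \<inter> \<Omega> = {}" and R: "0 < R"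
    and g: "L2_function g" "is_weak_gradient u g"
  shows "AE x in lborel. x \<in> ball c R \<longrightarrow> g x = 0"
proof -
  have [measurable]: "g \<in> borel_measurable borel" using g(1) by (simp add: L2_function_def)
  have gi2: "integrable lborel (\<lambda>x. (g x \<bullet> i)\<^sup>2)" if i: "i \<in> Basis" for i
  proof (rule Bochner_Integration.integrable_bound)
    show "integrable lborel (\<lambda>x. (norm (g x))\<^sup>2)" using g(1) by (simp add: L2_function_def)
    show "AE x in lborel. norm ((g x \<bullet> i)\<^sup>2) \<le> norm ((norm (g x))\<^sup>2)"
      using Basis_le_norm[OF i] by (auto simp: abs_le_square_iff[symmetric])
  qed measurable
  have "AE x in lborel. x \<in> ball c R \<longrightarrow> g x \<bullet> i = 0" if i: "i \<in> Basis" for i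
  proof -
    define h where "h x = (g x \<bullet> i) * bump 0 c R x" for x
    have bb: "bump 0 c R x = 0" if "x \<notin> cball c R" for x
      using that R by (intro bump_eq_0) (auto simp: dist_norm norm_minus_commute)
    have h: "integrable lborel h" "integrable lborel (\<lambda>x. (h x)\<^sup>2)"
      unfolding h_def[abs_def] using integrable_L2_mult_bounded[OF _ measurable_bump gi2[OF i] abs_bump(1) bb] by auto
    \<comment> \<open>On \<open>\<Omega>\<close> both bumps vanish, as the ball misses
      \<open>\<Omega>\<close>; elsewhere \<open>u\<close> does. Arbitrary \<open>a\<close>,
      \<open>b\<close> and \<open>e\<close> cover the cosine and the sine at once.\<close>
    have z: "AE x in lborel. u x * (bump 0 c R x * a x - 2 * bump 2 c R x * b x * e x) = 0" for a b e :: "'a \<Rightarrow> real"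
      using u0
    proof eventually_elim
      case (elim x)
      show ?case
      proof (cases "x \<in> \<Omega>")
        case True
        then have "R \<le> norm (x - c)" using disj by (force simp: dist_norm norm_minus_commute)
        then show ?thesis using R by (simp add: bump_eq_0)
      qed (use elim in simp)
    qed
    have "(LINT x|lborel. (g x \<bullet> i) * (bump 0 c R x * cos (\<xi> \<bullet> x))) = 0"
      "(LINT x|lborel. (g x \<bullet> i) * (bump 0 c R x * sin (\<xi> \<bullet> x))) = 0" for \<xi>
    proof -
      have "- (LINT x|lborel. (g x \<bullet> i) * (bump 0 c R x * cos (\<xi> \<bullet> x))) = 0"
        unfolding weak_gradient_bump[OF g(2) i order_less_imp_le[OF R] conjunct1[OF Ck_sin_cos] has_derivative_cos_sin_inner(1), symmetric]
        by (rule integral_eq_zero_AE[OF z])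
      then show "(LINT x|lborel. (g x \<bullet> i) * (bump 0 c R x * cos (\<xi> \<bullet> x))) = 0" by simp
      have "- (LINT x|lborel. (g x \<bullet> i) * (bump 0 c R x * sin (\<xi> \<bullet> x))) = 0"
        unfolding weak_gradient_bump[OF g(2) i order_less_imp_le[OF R] conjunct2[OF Ck_sin_cos] has_derivative_cos_sin_inner(2), symmetric]
        by (rule integral_eq_zero_AE[OF z])
      then show "(LINT x|lborel. (g x \<bullet> i) * (bump 0 c R x * sin (\<xi> \<bullet> x))) = 0" by simp
    qed
    then have "power_spectrum h = (\<lambda>_. 0)"
      by (auto simp: power_spectrum_def cos_transform_def sin_transform_def h_def mult.assoc)
    with plancherel(2)[OF h] have "(LINT x|lborel. (h x)\<^sup>2) = 0" by simp
    then have "AE x in lborel. (h x)\<^sup>2 = 0"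
      by (subst (asm) integral_nonneg_eq_0_iff_AE[OF h(2)]) auto
    then show ?thesis
    proof eventually_elim
      case (elim x)
      show ?case
      proof
        assume "x \<in> ball c R"
        then have "0 < bump 0 c R x" by (intro bump_0_pos) (simp add: dist_norm norm_minus_commute)
        with elim show "g x \<bullet> i = 0" by (simp add: h_def)
      qed
    qed
  qed
  then have "AE x in lborel. \<forall>i\<in>Basis. x \<in> ball c R \<longrightarrow> g x \<bullet> i = 0"
    by (intro AE_finite_allI) auto
  then show ?thesis by eventually_elim (auto intro: euclidean_eqI)
qed

text \<open>The balls missing \<open>\<Omega>\<close> cover the complement of its closure, and by
  Lindelof countably many of them suffice, so the exceptional null sets add up to a null set. Only
  the frontier remains, and it is null because the boundary is a local graph.\<close>

lemma weak_gradient_eq_0_outside: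
  fixes u :: "'a::euclidean_space \<Rightarrow> real"
  assumes \<Omega>: "C1_bounded_domain \<Omega>"
    and u0: "AE x in lborel. x \<notin> \<Omega> \<longrightarrow> u x = 0"
    and g: "L2_function g" "is_weak_gradient u g"
  shows "AE x in lborel. x \<notin> \<Omega> \<longrightarrow> g x = 0"
proof -
  have op: "open \<Omega>" and fr: "frontier \<Omega> \<in> null_sets lborel"
    using \<Omega> frontier_null_set by (auto simp: C1_bounded_domain_def)
  define F where "F = {ball c R | c R. 0 < R \<and> ball c R \<inter> \<Omega> = {}}"
  have "\<And>S. S \<in> F \<Longrightarrow> open S" by (auto simp: F_def)
  then obtain F' where F': "F' \<subseteq> F" "countable F'" "\<Union>F' = \<Union>F" by (rule Lindelof)
  have "AE x in lborel. \<forall>B\<in>F'. x \<in> B \<longrightarrow> g x = 0"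
    using F' weak_gradient_eq_0_on_ball[OF u0 _ _ g]
    by (subst AE_ball_countable) (auto simp: F_def)
  moreover have "AE x in lborel. x \<notin> frontier \<Omega>" using fr by (rule AE_not_in)
  ultimately show ?thesis
  proof eventually_elim
    case (elim x)
    show ?case
    proof
      assume "x \<notin> \<Omega>"
      with elim(2) op have "x \<in> - closure \<Omega>" by (auto simp: frontier_def interior_open)
      then obtain R where "0 < R" "ball x R \<subseteq> - closure \<Omega>"
        using open_contains_ball[of "- closure \<Omega>"] by (auto simp: open_Compl)
      then have "ball x R \<in> F" "x \<in> ball x R"
        using closure_subset[of \<Omega>] by (auto simp: F_def)
      with F'(3) elim(1) show "g x = 0" by blast
    qed
  qed
qed

section \<open>Integration by parts against cosines and sines\<close>

text \<open>The argument of \<open>flat_exp\<close> tends to infinity with the radius, where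
  \<open>exp (- (1/t))\<close> tends to 1; index 2 carries a further \<open>1 / t^2\<close>. The
  cutoff thus disappears along with its derivative.\<close>

lemma bump_tendsto:
  "(\<lambda>k. bump 0 0 (real k) x) \<longlonglongrightarrow> 1" "(\<lambda>k. bump 2 0 (real k) x) \<longlonglongrightarrow> 0"
proof -
  have t: "filterlim (\<lambda>k. (real k)\<^sup>2 - (norm x)\<^sup>2) at_top sequentially" by real_asymp
  have ev: "\<forall>\<^sub>F t in at_top. exp (- (1 / t)) / t ^ m = flat_exp m t" for m
    using eventually_gt_at_top[of "0::real"] by eventually_elim (simp add: flat_exp_def)
  have "((\<lambda>t::real. exp (- (1 / t)) / t ^ 0) \<longlongrightarrow> 1) at_top" by simp real_asymp
  then have "(flat_exp 0 \<longlongrightarrow> 1) at_top" using ev by (rule Lim_transform_eventually)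
  then show "(\<lambda>k. bump 0 0 (real k) x) \<longlonglongrightarrow> 1"
    unfolding bump_def diff_0_right by (rule filterlim_compose[OF _ t])
  have "((\<lambda>t::real. exp (- (1 / t)) / t ^ 2) \<longlongrightarrow> 0) at_top" by real_asymp
  then have "(flat_exp 2 \<longlongrightarrow> 0) at_top" using ev by (rule Lim_transform_eventually)
  then show "(\<lambda>k. bump 2 0 (real k) x) \<longlonglongrightarrow> 0"
    unfolding bump_def diff_0_right by (rule filterlim_compose[OF _ t])
qed

text \<open>The functions \<open>f\<close> are reached as limits of their cut-off versions. The
  derivative of the bump grows at most linearly in \<open>x\<close>, uniformly in its radius, and
  \<open>u\<close> lives in a fixed ball, so dominated convergence removes the cutoff.\<close>

lemma weak_gradient_integration_by_parts:
  fixes u :: "'a::euclidean_space \<Rightarrow> real"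
  assumes g: "is_weak_gradient u g" and i: "i \<in> Basis"
    and u: "integrable lborel u" and gi: "integrable lborel (\<lambda>x. g x \<bullet> i)"
    and supp: "AE x in lborel. x \<notin> cball 0 \<rho> \<longrightarrow> u x = 0"
    and f: "\<And>k. Ck k f" "\<And>x. (f has_derivative (\<lambda>h. d x * (\<xi> \<bullet> h))) (at x)"
    and b: "\<And>x. \<bar>f x\<bar> \<le> 1" "\<And>x. \<bar>d x\<bar> \<le> 1" and [measurable]: "d \<in> borel_measurable borel"
  shows "(LINT x|lborel. u x * (d x * (\<xi> \<bullet> i))) = - (LINT x|lborel. (g x \<bullet> i) * f x)"
proof -
  have "continuous_on UNIV f" using f(1)[of 0] by simp
  then have [measurable]: "f \<in> borel_measurable borel" by (rule borel_measurable_continuous_onI)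
  have [measurable]: "u \<in> borel_measurable borel" using u by (simp add: borel_measurable_integrable)
  have [measurable]: "(\<lambda>x. g x \<bullet> i) \<in> borel_measurable borel" using gi by (simp add: borel_measurable_integrable)
  define L where "L k x = u x * (bump 0 0 (real k) x * (d x * (\<xi> \<bullet> i)) - 2 * bump 2 0 (real k) x * ((x - 0) \<bullet> i) * f x)" for k x
  have "(\<lambda>k. LINT x|lborel. L k x) \<longlonglongrightarrow> (LINT x|lborel. u x * (d x * (\<xi> \<bullet> i)))"
  proof (rule integral_dominated_convergence)
    \<comment> \<open>The error term is at most \<open>2 * 2 * \<rho>\<close>: a 2 from the
      derivative of the bump, a 2 from the bound on \<open>bump 2\<close>, and \<open>\<rho>\<close>
      for a coordinate on the support of \<open>u\<close>.\<close>
    show "integrable lborel (\<lambda>x. \<bar>u x\<bar> * (\<bar>\<xi> \<bullet> i\<bar> + 4 * \<rho>))" using u by simp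
    show "AE x in lborel. (\<lambda>k. L k x) \<longlonglongrightarrow> u x * (d x * (\<xi> \<bullet> i))"
    proof (intro AE_I2)
      fix x
      have "(\<lambda>k. L k x) \<longlonglongrightarrow> u x * (1 * (d x * (\<xi> \<bullet> i)) - 2 * 0 * ((x - 0) \<bullet> i) * f x)"
        unfolding L_def by (intro tendsto_intros bump_tendsto)
      then show "(\<lambda>k. L k x) \<longlonglongrightarrow> u x * (d x * (\<xi> \<bullet> i))" by simp
    qed
    show "AE x in lborel. norm (L k x) \<le> \<bar>u x\<bar> * (\<bar>\<xi> \<bullet> i\<bar> + 4 * \<rho>)" for k
      using supp
    proof eventually_elim
      case (elim x)
      show ?case
      proof (cases "x \<in> cball 0 \<rho>")
        case True
        then have x: "\<bar>x \<bullet> i\<bar> \<le> \<rho>" using Basis_le_norm[OF i, of x] by simp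
        have "\<bar>bump 0 0 (real k) x * (d x * (\<xi> \<bullet> i))\<bar> \<le> 1 * (1 * \<bar>\<xi> \<bullet> i\<bar>)"
          unfolding abs_mult by (intro mult_mono abs_bump b) auto
        moreover have "\<bar>2 * bump 2 0 (real k) x * (x \<bullet> i) * f x\<bar> \<le> 2 * 2 * \<rho> * 1"
          unfolding abs_mult using x by (intro mult_mono abs_bump b) auto
        ultimately show ?thesis
          unfolding L_def real_norm_def abs_mult[of "u x"] by (intro mult_left_mono) auto
      qed (use elim in \<open>simp add: L_def\<close>)
    qed
  qed (auto simp: L_def[abs_def])
  moreover have "(\<lambda>k. - (LINT x|lborel. (g x \<bullet> i) * (bump 0 0 (real k) x * f x))) \<longlonglongrightarrow> - (LINT x|lborel. (g x \<bullet> i) * f x)"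
  proof (intro tendsto_minus integral_dominated_convergence)
    show "integrable lborel (\<lambda>x. \<bar>g x \<bullet> i\<bar>)" using gi by simp
    show "AE x in lborel. (\<lambda>k. (g x \<bullet> i) * (bump 0 0 (real k) x * f x)) \<longlonglongrightarrow> (g x \<bullet> i) * f x"
    proof (intro AE_I2)
      fix x
      have "(\<lambda>k. (g x \<bullet> i) * (bump 0 0 (real k) x * f x)) \<longlonglongrightarrow> (g x \<bullet> i) * (1 * f x)"
        by (intro tendsto_intros bump_tendsto)
      then show "(\<lambda>k. (g x \<bullet> i) * (bump 0 0 (real k) x * f x)) \<longlonglongrightarrow> (g x \<bullet> i) * f x" by simp
    qed
    have "\<bar>g x \<bullet> i\<bar> * \<bar>bump 0 0 (real k) x * f x\<bar> \<le> \<bar>g x \<bullet> i\<bar> * (1 * 1)" for k x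
      unfolding abs_mult by (intro mult_mono abs_bump b) auto
    then show "AE x in lborel. norm ((g x \<bullet> i) * (bump 0 0 (real k) x * f x)) \<le> \<bar>g x \<bullet> i\<bar>" for k
      by (simp add: abs_mult)
  qed measurable
  moreover have "(LINT x|lborel. L k x) = - (LINT x|lborel. (g x \<bullet> i) * (bump 0 0 (real k) x * f x))" for k
    unfolding L_def by (rule weak_gradient_bump[OF g i _ f]) simp
  ultimately show ?thesis by (simp add: LIMSEQ_unique)
qed

text \<open>Differentiation exchanges the cosine and sine transforms up to the factor
  \<open>\<xi> \<bullet> i\<close> and a sign, which the sum of squares does not see.\<close>

lemma power_spectrum_weak_gradient:
  fixes u :: "'a::euclidean_space \<Rightarrow> real"
  assumes "is_weak_gradient u g" "i \<in> Basis" "integrable lborel u" "integrable lborel (\<lambda>x. g x \<bullet> i)"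
    and "AE x in lborel. x \<notin> cball 0 \<rho> \<longrightarrow> u x = 0"
  shows "power_spectrum (\<lambda>x. g x \<bullet> i) \<xi> = (\<xi> \<bullet> i)\<^sup>2 * power_spectrum u \<xi>"
proof -
  note parts = weak_gradient_integration_by_parts[OF assms]
  have "(LINT x|lborel. u x * (- sin (\<xi> \<bullet> x) * (\<xi> \<bullet> i))) = - cos_transform (\<lambda>x. g x \<bullet> i) \<xi>"
    unfolding cos_transform_def
    by (rule parts[OF conjunct1[OF Ck_sin_cos] has_derivative_cos_sin_inner(1)]) auto
  also have "(LINT x|lborel. u x * (- sin (\<xi> \<bullet> x) * (\<xi> \<bullet> i))) = - (\<xi> \<bullet> i) * sin_transform u \<xi>"
    unfolding sin_transform_def integral_mult_right_zero[symmetric]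
    by (intro Bochner_Integration.integral_cong) auto
  finally have c: "cos_transform (\<lambda>x. g x \<bullet> i) \<xi> = (\<xi> \<bullet> i) * sin_transform u \<xi>" by simp
  have "(LINT x|lborel. u x * (cos (\<xi> \<bullet> x) * (\<xi> \<bullet> i))) = - sin_transform (\<lambda>x. g x \<bullet> i) \<xi>"
    unfolding sin_transform_def
    by (rule parts[OF conjunct2[OF Ck_sin_cos] has_derivative_cos_sin_inner(2)]) auto
  also have "(LINT x|lborel. u x * (cos (\<xi> \<bullet> x) * (\<xi> \<bullet> i))) = (\<xi> \<bullet> i) * cos_transform u \<xi>"
    unfolding cos_transform_def integral_mult_right_zero[symmetric]
    by (intro Bochner_Integration.integral_cong) auto
  finally have s: "sin_transform (\<lambda>x. g x \<bullet> i) \<xi> = - (\<xi> \<bullet> i) * cos_transform u \<xi>" by simp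
  show ?thesis by (simp add: power_spectrum_def c s power_mult_distrib algebra_simps)
qed

lemma XX_integrable:
  assumes "u \<in> XX \<Omega>" "bounded \<Omega>"
  shows "u \<in> borel_measurable borel" "integrable lborel u" "integrable lborel (\<lambda>x. (u x)\<^sup>2)"
    "AE x in lborel. x \<notin> \<Omega> \<longrightarrow> u x = 0"
proof -
  show [measurable]: "u \<in> borel_measurable borel" and u2: "integrable lborel (\<lambda>x. (u x)\<^sup>2)"
    and u0: "AE x in lborel. x \<notin> \<Omega> \<longrightarrow> u x = 0"
    using assms(1) by (auto simp: XX_def H1_def L2_function_def)
  obtain \<rho> where \<rho>: "\<Omega> \<subseteq> cball 0 \<rho>" using bounded_subset_ballD[OF assms(2), of 0] ball_subset_cball by blast
  have "AE x in lborel. x \<notin> cball 0 \<rho> \<longrightarrow> u x = 0"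
    using u0 by eventually_elim (use \<rho> in auto)
  then show "integrable lborel u" by (rule integrable_L2_bounded_support[rotated 2]) (use u2 in simp_all)
qed

lemma weak_grad:
  assumes "u \<in> H1"
  shows "L2_function (weak_grad u)" "is_weak_gradient u (weak_grad u)"
proof -
  have "\<exists>g. L2_function g \<and> is_weak_gradient u g" using assms by (simp add: H1_def)
  from someI_ex[OF this] show "L2_function (weak_grad u)" "is_weak_gradient u (weak_grad u)"
    by (simp_all add: weak_grad_def)
qed

lemma gradient_energy:
  fixes u :: "'a::euclidean_space \<Rightarrow> real"
  assumes \<Omega>: "C1_bounded_domain \<Omega>" and u: "u \<in> XX \<Omega>"
  shows "integrable lborel (\<lambda>\<xi>. (norm \<xi>)\<^sup>2 * power_spectrum u \<xi>)"
    and "(LINT \<xi>|lborel. (norm \<xi>)\<^sup>2 * power_spectrum u \<xi>)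
      = (2 * pi) ^ DIM('a) * (LINT x:\<Omega>|lborel. (norm (weak_grad u x))\<^sup>2)"
proof -
  define g where "g = weak_grad u"
  have bd: "bounded \<Omega>" using \<Omega> by (simp add: C1_bounded_domain_def)
  note u' = XX_integrable[OF u bd]
  have g: "L2_function g" "is_weak_gradient u g"
    using u weak_grad by (auto simp: g_def XX_def)
  have [measurable]: "g \<in> borel_measurable borel" and g2: "integrable lborel (\<lambda>x. (norm (g x))\<^sup>2)"
    using g(1) by (simp_all add: L2_function_def)
  have g0: "AE x in lborel. x \<notin> \<Omega> \<longrightarrow> g x = 0"
    by (rule weak_gradient_eq_0_outside[OF \<Omega> u'(4) g])
  obtain \<rho> where \<rho>: "\<Omega> \<subseteq> cball 0 \<rho>" using bounded_subset_ballD[OF bd, of 0] ball_subset_cball by blast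
  have gi2: "integrable lborel (\<lambda>x. (g x \<bullet> i)\<^sup>2)" if i: "i \<in> Basis" for i
    by (rule Bochner_Integration.integrable_bound[OF g2])
      (use Basis_le_norm[OF i] in \<open>auto simp: abs_le_square_iff[symmetric]\<close>)
  have gi: "integrable lborel (\<lambda>x. g x \<bullet> i)" if i: "i \<in> Basis" for i
  proof (rule integrable_L2_bounded_support[OF _ gi2[OF i]])
    show "AE x in lborel. x \<notin> cball 0 \<rho> \<longrightarrow> g x \<bullet> i = 0"
      using g0 by eventually_elim (use \<rho> in auto)
  qed measurable
  have "AE x in lborel. x \<notin> cball 0 \<rho> \<longrightarrow> u x = 0"
    using u'(4) by eventually_elim (use \<rho> in auto)
  note ps = power_spectrum_weak_gradient[OF g(2) _ u'(2) gi this]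
  have n2: "(norm x)\<^sup>2 = (\<Sum>b\<in>Basis. (x \<bullet> b)\<^sup>2)" for x :: 'a
    unfolding power2_norm_eq_inner by (subst euclidean_inner) (simp add: power2_eq_square)
  have sum: "(norm \<xi>)\<^sup>2 * power_spectrum u \<xi> = (\<Sum>i\<in>Basis. power_spectrum (\<lambda>x. g x \<bullet> i) \<xi>)" for \<xi>
    by (simp add: n2 sum_distrib_right ps)
  show "integrable lborel (\<lambda>\<xi>. (norm \<xi>)\<^sup>2 * power_spectrum u \<xi>)"
    unfolding sum by (intro Bochner_Integration.integrable_sum plancherel(1) gi gi2)
  have "(LINT \<xi>|lborel. (norm \<xi>)\<^sup>2 * power_spectrum u \<xi>) = (\<Sum>i\<in>Basis. (2 * pi) ^ DIM('a) * (LINT x|lborel. (g x \<bullet> i)\<^sup>2))"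
    unfolding sum by (subst Bochner_Integration.integral_sum) (simp_all add: plancherel gi gi2)
  also have "\<dots> = (2 * pi) ^ DIM('a) * (LINT x|lborel. (norm (g x))\<^sup>2)"
    unfolding n2 by (subst Bochner_Integration.integral_sum) (simp_all add: gi2 sum_distrib_left)
  \<comment> \<open>The whole-space integral supplied by Plancherel reduces to
    \<open>\<Omega>\<close>, because the weak gradient vanishes almost everywhere outside.\<close>
  also have "(LINT x|lborel. (norm (g x))\<^sup>2) = (LINT x:\<Omega>|lborel. (norm (g x))\<^sup>2)"
    unfolding set_lebesgue_integral_def
  proof (rule integral_cong_AE)
    have "\<Omega> \<in> sets borel" using \<Omega> by (auto simp: C1_bounded_domain_def)
    then show "(\<lambda>x. indicat_real \<Omega> x *\<^sub>R (norm (g x))\<^sup>2) \<in> borel_measurable lborel" by measurable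
    show "AE x in lborel. (norm (g x))\<^sup>2 = indicat_real \<Omega> x *\<^sub>R (norm (g x))\<^sup>2"
      using g0 by eventually_elim (auto simp: indicator_def)
  qed measurable
  finally show "(LINT \<xi>|lborel. (norm \<xi>)\<^sup>2 * power_spectrum u \<xi>)
      = (2 * pi) ^ DIM('a) * (LINT x:\<Omega>|lborel. (norm (weak_grad u x))\<^sup>2)" by (simp add: g_def)
qed

section \<open>The spectrum of the fractional form\<close>

text \<open>Euler's integral for Gamma after scaling the variable by \<open>r^2\<close>. With
  \<open>r = norm y\<close> each integrand is a Gaussian in \<open>y\<close>.\<close>

lemma nn_integral_gaussian_mixture:
  assumes q: "0 < q" and r: "0 < (r::real)"
  shows "(\<integral>\<^sup>+t. ennreal (indicator {0..} t * (t powr (q - 1) * exp (- (r\<^sup>2 * t)))) \<partial>lborel)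
    = ennreal (Gamma q / r powr (2 * q))"
proof -
  let ?I = "\<integral>\<^sup>+t. ennreal (indicator {0..} t * (t powr (q - 1) * exp (- (r\<^sup>2 * t)))) \<partial>lborel"
  have r2: "0 < r\<^sup>2" using r by simp
  have "ennreal (Gamma q) = (\<integral>\<^sup>+t. ennreal (indicator {0..} t * t powr (q - 1) / exp t) \<partial>lborel)"
    by (rule Gamma_conv_nn_integral_real[OF q])
  also have "\<dots> = ennreal (r\<^sup>2) * (\<integral>\<^sup>+t. ennreal (indicator {0..} (0 + r\<^sup>2 * t) * (0 + r\<^sup>2 * t) powr (q - 1) / exp (0 + r\<^sup>2 * t)) \<partial>lborel)"
    using r2 by (subst nn_integral_real_affine[where c = "r\<^sup>2" and t = 0]) auto
  also have "(\<integral>\<^sup>+t. ennreal (indicator {0..} (0 + r\<^sup>2 * t) * (0 + r\<^sup>2 * t) powr (q - 1) / exp (0 + r\<^sup>2 * t)) \<partial>lborel)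
      = (\<integral>\<^sup>+t. ennreal ((r\<^sup>2) powr (q - 1)) * ennreal (indicator {0..} t * (t powr (q - 1) * exp (- (r\<^sup>2 * t)))) \<partial>lborel)"
    using r2 by (intro nn_integral_cong)
      (auto simp: indicator_def powr_mult exp_minus ennreal_mult[symmetric] field_simps zero_le_mult_iff)
  also have "\<dots> = ennreal ((r\<^sup>2) powr (q - 1)) * ?I" by (subst nn_integral_cmult) auto
  finally have "ennreal (Gamma q) = ennreal (r\<^sup>2 * (r\<^sup>2) powr (q - 1)) * ?I"
    using r2 by (simp add: ennreal_mult mult.assoc)
  also have "r\<^sup>2 * (r\<^sup>2) powr (q - 1) = r powr (2 * q)"
    using r by (simp add: powr_powr powr_numeral[symmetric] powr_add[symmetric] del: powr_numeral)
  finally have "ennreal (Gamma q) = ennreal (r powr (2 * q)) * ?I" .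
  then have "ennreal (inverse (r powr (2 * q))) * ennreal (Gamma q)
      = (ennreal (inverse (r powr (2 * q))) * ennreal (r powr (2 * q))) * ?I"
    by (simp add: mult.assoc)
  also have "ennreal (inverse (r powr (2 * q))) * ennreal (r powr (2 * q)) = 1"
    using r by (simp add: ennreal_mult[symmetric])
  finally show ?thesis using r q by (simp add: ennreal_mult[symmetric] field_simps Gamma_real_nonneg)
qed

text \<open>The Gaussian transform with parameter \<open>2 * t\<close>, at frequency 0 minus at
  frequency \<open>\<xi>\<close>.\<close>

lemma nn_integral_gaussian_one_minus_cos:
  fixes \<xi> :: "'a::euclidean_space"
  assumes t: "0 < (t::real)"
  shows "(\<integral>\<^sup>+y. ennreal ((1 - cos (\<xi> \<bullet> y)) * exp (- ((norm y)\<^sup>2 * t))) \<partial>lborel)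
    = ennreal ((pi / t) powr (real DIM('a) / 2) * (1 - exp (- ((norm \<xi>)\<^sup>2 / (4 * t)))))"
proof -
  have t2: "0 < 2 * t" using t by simp
  have e: "exp (- (2 * t) * (norm y)\<^sup>2 / 2) = exp (- ((norm y)\<^sup>2 * t))" for y :: 'a by (simp add: mult.commute)
  have g: "integrable lborel (\<lambda>y::'a. exp (- ((norm y)\<^sup>2 * t)))"
    using gaussian_fourier(1)[OF t2, where 'a = 'a] unfolding e .
  have gc: "integrable lborel (\<lambda>y::'a. cos (\<xi> \<bullet> y) * exp (- ((norm y)\<^sup>2 * t)))"
    using integrable_mult_cos_sin(1)[OF g, of \<xi>] by (simp add: mult.commute)
  have p: "sqrt (pi / t) ^ DIM('a) = (pi / t) powr (real DIM('a) / 2)"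
    using t by (simp add: powr_half_sqrt[symmetric] powr_realpow[symmetric] powr_powr mult.commute)
  have i: "(LINT y|lborel. cos (v \<bullet> y) * exp (- ((norm y)\<^sup>2 * t))) = (pi / t) powr (real DIM('a) / 2) * exp (- ((norm v)\<^sup>2 / (4 * t)))" for v :: 'a
    using gaussian_fourier(2)[OF t2, of v] unfolding e by (simp add: p)
  have "(LINT y|lborel. (1 - cos (\<xi> \<bullet> y)) * exp (- ((norm y)\<^sup>2 * t)))
      = (pi / t) powr (real DIM('a) / 2) * (1 - exp (- ((norm \<xi>)\<^sup>2 / (4 * t))))"
    using g gc i[of 0] i[of \<xi>] by (simp add: left_diff_distrib right_diff_distrib)
  moreover have "integrable lborel (\<lambda>y::'a. (1 - cos (\<xi> \<bullet> y)) * exp (- ((norm y)\<^sup>2 * t)))"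
    using g gc by (simp add: left_diff_distrib)
  ultimately show ?thesis by (subst nn_integral_eq_integral) auto
qed

text \<open>What the kernel integral becomes, up to constants, once the space variable has been
  integrated against each Gaussian; \<open>r\<close> is the norm of the frequency. With values in
  \<open>ennreal\<close>, homogeneity can be proved before finiteness.\<close>

definition fractional_profile :: "real \<Rightarrow> real \<Rightarrow> ennreal" where
  "fractional_profile s r = (\<integral>\<^sup>+t. ennreal (indicator {0<..} t * (t powr (s - 1) * (1 - exp (- (r\<^sup>2 / (4 * t)))))) \<partial>lborel)"

lemma fractional_profile_scale:
  assumes "0 < s" "0 \<le> r"
  shows "fractional_profile s r = ennreal (r powr (2 * s)) * fractional_profile s 1"
proof (cases "r = 0")
  case True
  then show ?thesis by (simp add: fractional_profile_def)
next
  case False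
  with assms have r: "0 < r" "0 < r\<^sup>2" by auto
  have "fractional_profile s r = ennreal (r\<^sup>2) * (\<integral>\<^sup>+t. ennreal (indicator {0<..} (0 + r\<^sup>2 * t) * ((0 + r\<^sup>2 * t) powr (s - 1) * (1 - exp (- (r\<^sup>2 / (4 * (0 + r\<^sup>2 * t))))))) \<partial>lborel)"
    unfolding fractional_profile_def using r by (subst nn_integral_real_affine[where c = "r\<^sup>2" and t = 0]) auto
  also have "(\<integral>\<^sup>+t. ennreal (indicator {0<..} (0 + r\<^sup>2 * t) * ((0 + r\<^sup>2 * t) powr (s - 1) * (1 - exp (- (r\<^sup>2 / (4 * (0 + r\<^sup>2 * t))))))) \<partial>lborel)
      = (\<integral>\<^sup>+t. ennreal ((r\<^sup>2) powr (s - 1)) * ennreal (indicator {0<..} t * (t powr (s - 1) * (1 - exp (- (1\<^sup>2 / (4 * t)))))) \<partial>lborel)"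
    using r by (intro nn_integral_cong) (auto simp: indicator_def powr_mult ennreal_mult[symmetric] zero_less_mult_iff mult.assoc)
  also have "\<dots> = ennreal ((r\<^sup>2) powr (s - 1)) * fractional_profile s 1"
    unfolding fractional_profile_def by (subst nn_integral_cmult) auto
  also have "ennreal (r\<^sup>2) * (ennreal ((r\<^sup>2) powr (s - 1)) * fractional_profile s 1) = ennreal (r\<^sup>2 * (r\<^sup>2) powr (s - 1)) * fractional_profile s 1"
    by (simp add: ennreal_mult mult.assoc)
  also have "r\<^sup>2 * (r\<^sup>2) powr (s - 1) = r powr (2 * s)"
    using r by (simp add: powr_powr powr_numeral[symmetric] powr_add[symmetric] del: powr_numeral)
  finally show ?thesis .
qed

text \<open>Near 0 the power \<open>s - 1\<close> is integrable since \<open>s > 0\<close>. At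
  infinity \<open>1 - exp (- (1 / (4 * t))) \<le> 1 / t\<close> improves the exponent to
  \<open>s - 2\<close>, integrable since \<open>s < 1\<close>.\<close>

lemma fractional_profile_1_finite:
  assumes s: "0 < s" "s < 1"
  shows "fractional_profile s 1 < \<infinity>"
proof -
  have "((\<lambda>t. t powr (s - 1)) has_integral (1 powr (s - 1 + 1) / (s - 1 + 1))) {0..1}"
    by (rule has_integral_powr_from_0) (use s in auto)
  then have 1: "(\<integral>\<^sup>+t. ennreal (indicator {0..1} t * t powr (s - 1)) \<partial>lborel) = ennreal (1 powr (s - 1 + 1) / (s - 1 + 1))"
    by (intro nn_integral_has_integral_lebesgue) auto
  have "((\<lambda>t. t powr (s - 2)) has_integral - (1 powr (s - 2 + 1)) / (s - 2 + 1)) {1..}"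
    by (rule has_integral_powr_to_inf) (use s in auto)
  then have 2: "(\<integral>\<^sup>+t. ennreal (indicator {1..} t * t powr (s - 2)) \<partial>lborel) = ennreal (- (1 powr (s - 2 + 1)) / (s - 2 + 1))"
    by (intro nn_integral_has_integral_lebesgue) auto
  have "fractional_profile s 1 \<le> (\<integral>\<^sup>+t. ennreal (indicator {0..1} t * t powr (s - 1)) + ennreal (indicator {1..} t * t powr (s - 2)) \<partial>lborel)"
    unfolding fractional_profile_def
  proof (intro nn_integral_mono)
    fix t :: real
    show "ennreal (indicator {0<..} t * (t powr (s - 1) * (1 - exp (- (1\<^sup>2 / (4 * t))))))
        \<le> ennreal (indicator {0..1} t * t powr (s - 1)) + ennreal (indicator {1..} t * t powr (s - 2))"
    proof (cases "0 < t \<and> t \<le> 1")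
      case True
      then have "t powr (s - 1) * (1 - exp (- (1\<^sup>2 / (4 * t)))) \<le> t powr (s - 1)"
        by (intro mult_left_le) auto
      with True show ?thesis
        by (intro order_trans[OF _ add_increasing2[OF _ order_refl]]) (auto simp: indicator_def intro!: ennreal_leI)
    next
      case False
      show ?thesis
      proof (cases "0 < t")
        case True
        with False have t: "1 < t" by simp
        have "1 - exp (- (1 / (4 * t))) \<le> 1 / (4 * t)" using exp_ge_add_one_self[of "- (1 / (4 * t))"] by linarith
        also have "\<dots> \<le> 1 / t" using t by (simp add: field_simps)
        finally have "t powr (s - 1) * (1 - exp (- (1 / (4 * t)))) \<le> t powr (s - 1) * (1 / t)"
          by (intro mult_left_mono) auto
        also have "\<dots> = t powr (s - 2)" using t powr_diff[of t "s - 1" 1] by simp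
        finally show ?thesis using t by (auto simp: indicator_def intro!: ennreal_leI)
      qed simp
    qed
  qed
  also have "\<dots> < \<infinity>" by (subst nn_integral_add) (auto simp: 1 2)
  finally show ?thesis .
qed

text \<open>Positivity is what later permits cancelling the kernel constant against
  \<open>frac_const\<close>.\<close>

lemma fractional_profile_1_pos:
  assumes s: "0 < s" "s < 1"
  shows "0 < fractional_profile s 1"
proof -
  define c where "c = 1 - exp (- (1/4::real))"
  have c: "0 < c" by (simp add: c_def)
  have "ennreal c = (\<integral>\<^sup>+t. ennreal c * indicator {0<..1::real} t \<partial>lborel)"
    by (subst nn_integral_cmult_indicator) auto
  also have "\<dots> \<le> fractional_profile s 1"
    unfolding fractional_profile_def
  proof (intro nn_integral_mono)
    fix t :: real
    show "ennreal c * indicator {0<..1} t \<le> ennreal (indicator {0<..} t * (t powr (s - 1) * (1 - exp (- (1\<^sup>2 / (4 * t))))))"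
    proof (cases "0 < t \<and> t \<le> 1")
      case True
      have "1 * c \<le> t powr (s - 1) * (1 - exp (- (1 / (4 * t))))"
      proof (intro mult_mono)
        have "1 = 1 powr (s - 1)" by simp
        also have "\<dots> \<le> t powr (s - 1)" using True s by (intro powr_mono2') auto
        finally show "1 \<le> t powr (s - 1)" .
        show "c \<le> 1 - exp (- (1 / (4 * t)))" unfolding c_def using True by (simp add: field_simps)
      qed (use c in auto)
      with True show ?thesis by (auto simp: indicator_def intro!: ennreal_leI)
    qed (auto simp: indicator_def)
  qed
  finally show ?thesis using c by (simp add: ennreal_less_zero_iff less_le_trans[of 0 "ennreal c"])
qed

text \<open>Writing the kernel as a superposition of Gaussians shows that this integral depends only on
  \<open>norm \<xi>\<close>, without an appeal to the rotation invariance of Lebesgue measure.\<close>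

lemma nn_integral_fractional_kernel:
  assumes s: "0 < s" "s < 1"
  obtains C where "0 < C"
    "\<And>\<xi>::'a::euclidean_space. (\<integral>\<^sup>+y. ennreal ((1 - cos (\<xi> \<bullet> y)) / norm y powr (real DIM('a) + 2 * s)) \<partial>lborel)
      = ennreal (C * norm \<xi> powr (2 * s))"
proof -
  \<comment> \<open>Half the exponent of the kernel, since the Gaussian mixture yields the power
    \<open>2 * q\<close> of the norm.\<close>
  define q where "q = real DIM('a) / 2 + s"
  have q: "0 < q" "2 * q = real DIM('a) + 2 * s" using s by (auto simp: q_def)
  have Gq: "0 < Gamma q" using q by (simp add: Gamma_real_pos)
  obtain J where J: "fractional_profile s 1 = ennreal J" "0 < J"
    using fractional_profile_1_finite[OF s] fractional_profile_1_pos[OF s]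
    by (cases "fractional_profile s 1") (auto simp: ennreal_less_zero_iff)
  have main: "ennreal (Gamma q) * (\<integral>\<^sup>+y. ennreal ((1 - cos (\<xi> \<bullet> y)) / norm y powr (real DIM('a) + 2 * s)) \<partial>lborel)
      = ennreal (pi powr (real DIM('a) / 2) * J * norm \<xi> powr (2 * s))" for \<xi> :: 'a
  proof -
    let ?h = "\<lambda>y t. ennreal (1 - cos (\<xi> \<bullet> y)) * ennreal (indicator {0..} t * (t powr (q - 1) * exp (- ((norm y)\<^sup>2 * t))))"
    have "ennreal (Gamma q) * (\<integral>\<^sup>+y. ennreal ((1 - cos (\<xi> \<bullet> y)) / norm y powr (real DIM('a) + 2 * s)) \<partial>lborel)
        = (\<integral>\<^sup>+y. ennreal (Gamma q) * ennreal ((1 - cos (\<xi> \<bullet> y)) / norm y powr (real DIM('a) + 2 * s)) \<partial>lborel)"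
      by (subst nn_integral_cmult) auto
    also have "\<dots> = (\<integral>\<^sup>+y. (\<integral>\<^sup>+t. ?h y t \<partial>lborel) \<partial>lborel)"
    proof (intro nn_integral_cong)
      fix y :: 'a
      show "ennreal (Gamma q) * ennreal ((1 - cos (\<xi> \<bullet> y)) / norm y powr (real DIM('a) + 2 * s)) = (\<integral>\<^sup>+t. ?h y t \<partial>lborel)"
      proof (cases "y = 0")
        case False
        have "(\<integral>\<^sup>+t. ?h y t \<partial>lborel) = ennreal (1 - cos (\<xi> \<bullet> y)) * ennreal (Gamma q / norm y powr (2 * q))"
          using False by (subst nn_integral_cmult) (auto simp: nn_integral_gaussian_mixture[OF q(1)])
        then show ?thesis unfolding q(2)[symmetric] using Gq by (simp add: ennreal_mult[symmetric] mult.commute)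
      qed simp
    qed
    also have "\<dots> = (\<integral>\<^sup>+t. (\<integral>\<^sup>+y. ?h y t \<partial>lborel) \<partial>lborel)"
      by (rule lborel_pair.Fubini') measurable
    also have "\<dots> = (\<integral>\<^sup>+t. ennreal (pi powr (real DIM('a) / 2)) * ennreal (indicator {0<..} t * (t powr (s - 1) * (1 - exp (- ((norm \<xi>)\<^sup>2 / (4 * t)))))) \<partial>lborel)"
    proof (intro nn_integral_cong)
      fix t :: real
      show "(\<integral>\<^sup>+y. ?h y t \<partial>lborel) = ennreal (pi powr (real DIM('a) / 2)) * ennreal (indicator {0<..} t * (t powr (s - 1) * (1 - exp (- ((norm \<xi>)\<^sup>2 / (4 * t))))))"
      proof (cases "0 < t")
        case True
        have "(\<integral>\<^sup>+y. ?h y t \<partial>lborel) = (\<integral>\<^sup>+y. ennreal (t powr (q - 1)) * ennreal ((1 - cos (\<xi> \<bullet> y)) * exp (- ((norm y)\<^sup>2 * t))) \<partial>lborel)"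
          using True by (intro nn_integral_cong) (auto simp: ennreal_mult[symmetric] ac_simps)
        also have "\<dots> = ennreal (t powr (q - 1)) * ennreal ((pi / t) powr (real DIM('a) / 2) * (1 - exp (- ((norm \<xi>)\<^sup>2 / (4 * t)))))"
          by (subst nn_integral_cmult) (auto simp: nn_integral_gaussian_one_minus_cos[OF True])
        also have "\<dots> = ennreal ((t powr (q - 1) * (pi / t) powr (real DIM('a) / 2)) * (1 - exp (- ((norm \<xi>)\<^sup>2 / (4 * t)))))"
          using True by (simp add: ennreal_mult[symmetric] mult.assoc)
        \<comment> \<open>As \<open>q - 1 = DIM('a) / 2 + (s - 1)\<close>, the dimension cancels and
          the exponent of the profile remains.\<close>
        also have "t powr (q - 1) * (pi / t) powr (real DIM('a) / 2) = pi powr (real DIM('a) / 2) * t powr (s - 1)"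
        proof -
          have "t powr (q - 1) = t powr (real DIM('a) / 2) * t powr (s - 1)"
            by (simp add: q_def powr_add[symmetric] algebra_simps)
          then show ?thesis using True by (simp add: powr_divide)
        qed
        finally show ?thesis using True by (simp add: ennreal_mult[symmetric] mult.assoc)
      next
        case False
        \<comment> \<open>At \<open>t = 0\<close> the indicator of \<open>{0..}\<close> equals 1,
          but \<open>0 powr x = 0\<close>. So the mixture over \<open>{0..}\<close> and the profile
          over \<open>{0<..}\<close> agree.\<close>
        then have z: "?h y t = 0" for y by (cases "t = 0") (auto simp: indicator_def)
        show ?thesis unfolding z using False by simp
      qed
    qed
    also have "\<dots> = ennreal (pi powr (real DIM('a) / 2)) * fractional_profile s (norm \<xi>)"
      unfolding fractional_profile_def by (subst nn_integral_cmult) auto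
    also have "\<dots> = ennreal (pi powr (real DIM('a) / 2) * J * norm \<xi> powr (2 * s))"
      using J by (simp add: fractional_profile_scale[OF s(1), of "norm \<xi>"] ennreal_mult[symmetric] ac_simps)
    finally show ?thesis .
  qed
  define C where "C = pi powr (real DIM('a) / 2) * J / Gamma q"
  show ?thesis
  proof (rule that[of C])
    show "0 < C" using Gq J by (simp add: C_def)
    fix \<xi> :: 'a
    let ?K = "\<integral>\<^sup>+y. ennreal ((1 - cos (\<xi> \<bullet> y)) / norm y powr (real DIM('a) + 2 * s)) \<partial>lborel"
    have "?K = (ennreal (inverse (Gamma q)) * ennreal (Gamma q)) * ?K"
      using Gq by (simp add: ennreal_mult[symmetric])
    also have "\<dots> = ennreal (inverse (Gamma q)) * ennreal (pi powr (real DIM('a) / 2) * J * norm \<xi> powr (2 * s))"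
      by (simp add: mult.assoc main)
    also have "\<dots> = ennreal (C * norm \<xi> powr (2 * s))"
      using Gq J by (simp add: ennreal_mult[symmetric] C_def field_simps)
    finally show "?K = ennreal (C * norm \<xi> powr (2 * s))" .
  qed
qed

section \<open>From increments to the quadratic form\<close>

lemma nn_integral_shift_diff:
  fixes u :: "'a::euclidean_space \<Rightarrow> real"
  assumes u: "integrable lborel u" and u2: "integrable lborel (\<lambda>x. (u x)\<^sup>2)"
  shows "(\<integral>\<^sup>+x. ennreal ((u (x + y) - u x)\<^sup>2) \<partial>lborel)
    = ennreal (2 / (2 * pi) ^ DIM('a)) * (\<integral>\<^sup>+\<xi>. ennreal ((1 - cos (\<xi> \<bullet> y)) * power_spectrum u \<xi>) \<partial>lborel)"
proof -
  have [measurable]: "u \<in> borel_measurable borel" using u by (simp add: borel_measurable_integrable)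
  let ?v = "\<lambda>x. u (x + y) - u x"
  have v: "integrable lborel ?v" "integrable lborel (\<lambda>x. (?v x)\<^sup>2)"
    using integrable_lborel_shift[OF u, of y] integrable_lborel_shift[OF u2, of y] u u2
    by (auto intro!: integrable_L2_diff)
  define c A D where "c = (1/2 :: real)" and "A = (2 * pi) ^ DIM('a)" and "D = (LINT x|lborel. (?v x)\<^sup>2)"
  have pos: "0 \<le> c" "0 < A" "0 \<le> D" by (auto simp: c_def A_def D_def)
  have half: "(1 - cos (\<xi> \<bullet> y)) * power_spectrum u \<xi> = c * power_spectrum ?v \<xi>" for \<xi>
    by (simp add: power_spectrum_shift_diff[OF u] c_def)
  have "(\<integral>\<^sup>+\<xi>. ennreal ((1 - cos (\<xi> \<bullet> y)) * power_spectrum u \<xi>) \<partial>lborel)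
      = (\<integral>\<^sup>+\<xi>. ennreal c * ennreal (power_spectrum ?v \<xi>) \<partial>lborel)"
    unfolding half by (intro nn_integral_cong ennreal_mult pos power_spectrum_nonneg)
  also have "\<dots> = ennreal c * (\<integral>\<^sup>+\<xi>. ennreal (power_spectrum ?v \<xi>) \<partial>lborel)"
    by (rule nn_integral_cmult) measurable
  also have "(\<integral>\<^sup>+\<xi>. ennreal (power_spectrum ?v \<xi>) \<partial>lborel) = ennreal (A * D)"
    using plancherel[OF v] by (subst nn_integral_eq_integral) (auto simp: power_spectrum_nonneg A_def D_def)
  also have "ennreal c * ennreal (A * D) = ennreal (c * (A * D))"
    by (rule ennreal_mult[symmetric]) (use pos in auto)
  also have "ennreal (2 / A) * ennreal (c * (A * D)) = ennreal (2 / A * (c * (A * D)))"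
    by (rule ennreal_mult[symmetric]) (use pos in auto)
  also have "2 / A * (c * (A * D)) = D" using pos by (simp add: c_def)
  also have "ennreal D = (\<integral>\<^sup>+x. ennreal ((?v x)\<^sup>2) \<partial>lborel)"
    unfolding D_def
    using v(2) by (subst nn_integral_eq_integral) auto
  finally show ?thesis by (simp add: A_def)
qed

text \<open>After the substitution \<open>x = z + y\<close>, Tonelli leaves the squared L^2 norms of
  the increments by \<open>z\<close>, weighted by the kernel. Increments are diagonal in frequency,
  and a second exchange integrates the kernel against
  \<open>1 - cos (\<xi> \<bullet> z)\<close>.\<close>

lemma frac_form_power_spectrum:
  fixes u :: "'a::euclidean_space \<Rightarrow> real"
  assumes s: "0 < s" "s < 1"
    and u: "integrable lborel u" and u2: "integrable lborel (\<lambda>x. (u x)\<^sup>2)"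
    and fin: "integrable lborel (\<lambda>\<xi>. norm \<xi> powr (2 * s) * power_spectrum u \<xi>)"
  shows "(2 * pi) ^ DIM('a) * frac_form s u u = (LINT \<xi>|lborel. norm \<xi> powr (2 * s) * power_spectrum u \<xi>)"
proof -
  have [measurable]: "u \<in> borel_measurable borel" using u by (simp add: borel_measurable_integrable)
  let ?p = "real DIM('a) + 2 * s"
  obtain C where C: "0 < C"
    "\<And>\<xi>::'a. (\<integral>\<^sup>+y. ennreal ((1 - cos (\<xi> \<bullet> y)) / norm y powr ?p) \<partial>lborel) = ennreal (C * norm \<xi> powr (2 * s))"
    using nn_integral_fractional_kernel[OF s] by blast
  \<comment> \<open>The basis vector chosen inside \<open>frac_const\<close>. Being a unit vector,
    it makes the kernel identity evaluate the very integral that \<open>frac_const\<close>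
    inverts.\<close>
  define e where "e = (SOME i::'a. i \<in> Basis)"
  have "e \<in> Basis" unfolding e_def by (rule someI_ex) (simp add: ex_in_conv)
  then have "norm e = 1" by simp
  then have "(LINT \<zeta>|lborel. (1 - cos (\<zeta> \<bullet> e)) / norm \<zeta> powr ?p) = C"
    using C(2)[of e] C(1) by (subst integral_eq_nn_integral) (auto simp: inner_commute)
  then have fc: "frac_const TYPE('a) s = inverse C" by (simp add: frac_const_def e_def)
  define I where "I = (LINT \<xi>|lborel. norm \<xi> powr (2 * s) * power_spectrum u \<xi>)"
  have I: "0 \<le> I" by (simp add: I_def power_spectrum_nonneg)
  define f where "f = (\<lambda>(y, x). (u x - u y) * (u x - u y) / norm (x - y) powr ?p)"
  have [measurable]: "f \<in> borel_measurable (lborel \<Otimes>\<^sub>M lborel)" unfolding f_def by measurable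
  have f0: "0 \<le> f z" for z by (auto simp: f_def split_beta)
  let ?G = "\<lambda>z \<xi>. ennreal ((1 - cos (\<xi> \<bullet> z)) / norm z powr ?p) * ennreal (power_spectrum u \<xi>)"
  have "(\<integral>\<^sup>+z. ennreal (f z) \<partial>(lborel \<Otimes>\<^sub>M lborel)) = (\<integral>\<^sup>+y. (\<integral>\<^sup>+x. ennreal (f (y, x)) \<partial>lborel) \<partial>lborel)"
    by (rule lborel.nn_integral_fst[symmetric]) measurable
  also have "\<dots> = (\<integral>\<^sup>+y. (\<integral>\<^sup>+z. ennreal (f (y, z + y)) \<partial>lborel) \<partial>lborel)"
    by (intro nn_integral_cong nn_integral_lborel_shift[symmetric]) measurable
  also have "\<dots> = (\<integral>\<^sup>+z. (\<integral>\<^sup>+y. ennreal (f (y, z + y)) \<partial>lborel) \<partial>lborel)"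
    by (rule lborel_pair.Fubini') measurable
  also have "\<dots> = (\<integral>\<^sup>+z. (\<integral>\<^sup>+y. ennreal (1 / norm z powr ?p) * ennreal ((u (y + z) - u y)\<^sup>2) \<partial>lborel) \<partial>lborel)"
    by (intro nn_integral_cong) (simp add: f_def ennreal_mult[symmetric] power2_eq_square add.commute)
  also have "\<dots> = (\<integral>\<^sup>+z. ennreal (1 / norm z powr ?p) * (ennreal (2 / (2 * pi) ^ DIM('a)) * (\<integral>\<^sup>+\<xi>. ennreal ((1 - cos (\<xi> \<bullet> z)) * power_spectrum u \<xi>) \<partial>lborel)) \<partial>lborel)"
    by (subst nn_integral_cmult) (auto simp: nn_integral_shift_diff[OF u u2])
  also have "\<dots> = (\<integral>\<^sup>+z. ennreal (2 / (2 * pi) ^ DIM('a)) * (\<integral>\<^sup>+\<xi>. ?G z \<xi> \<partial>lborel) \<partial>lborel)"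
  proof (intro nn_integral_cong)
    fix z :: 'a
    have "(\<integral>\<^sup>+\<xi>. ?G z \<xi> \<partial>lborel) = (\<integral>\<^sup>+\<xi>. ennreal (1 / norm z powr ?p) * ennreal ((1 - cos (\<xi> \<bullet> z)) * power_spectrum u \<xi>) \<partial>lborel)"
      by (intro nn_integral_cong) (simp add: ennreal_mult[symmetric] power_spectrum_nonneg)
    also have "\<dots> = ennreal (1 / norm z powr ?p) * (\<integral>\<^sup>+\<xi>. ennreal ((1 - cos (\<xi> \<bullet> z)) * power_spectrum u \<xi>) \<partial>lborel)"
      by (rule nn_integral_cmult) measurable
    finally show "ennreal (1 / norm z powr ?p) * (ennreal (2 / (2 * pi) ^ DIM('a)) * (\<integral>\<^sup>+\<xi>. ennreal ((1 - cos (\<xi> \<bullet> z)) * power_spectrum u \<xi>) \<partial>lborel))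
      = ennreal (2 / (2 * pi) ^ DIM('a)) * (\<integral>\<^sup>+\<xi>. ?G z \<xi> \<partial>lborel)"
      by (simp only: ac_simps)
  qed
  also have "\<dots> = ennreal (2 / (2 * pi) ^ DIM('a)) * (\<integral>\<^sup>+z. (\<integral>\<^sup>+\<xi>. ?G z \<xi> \<partial>lborel) \<partial>lborel)"
    by (rule nn_integral_cmult) measurable
  also have "(\<integral>\<^sup>+z. (\<integral>\<^sup>+\<xi>. ?G z \<xi> \<partial>lborel) \<partial>lborel) = (\<integral>\<^sup>+\<xi>. (\<integral>\<^sup>+z. ?G z \<xi> \<partial>lborel) \<partial>lborel)"
    by (rule lborel_pair.Fubini') measurable
  also have "\<dots> = (\<integral>\<^sup>+\<xi>. ennreal C * ennreal (norm \<xi> powr (2 * s) * power_spectrum u \<xi>) \<partial>lborel)"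
    using C by (intro nn_integral_cong, subst nn_integral_multc)
      (auto simp: ennreal_mult[symmetric] power_spectrum_nonneg mult.assoc)
  also have "\<dots> = ennreal C * ennreal I"
    unfolding I_def using fin
    by (subst nn_integral_cmult) (auto simp: nn_integral_eq_integral power_spectrum_nonneg)
  also have "ennreal (2 / (2 * pi) ^ DIM('a)) * (ennreal C * ennreal I) = ennreal (2 * C * I / (2 * pi) ^ DIM('a))"
    using C(1) I by (simp add: ennreal_mult[symmetric] field_simps)
  finally have nn: "(\<integral>\<^sup>+z. ennreal (f z) \<partial>(lborel \<Otimes>\<^sub>M lborel)) = ennreal (2 * C * I / (2 * pi) ^ DIM('a))" .
  \<comment> \<open>Finiteness of the double integral justifies returning from extended non-negative
    integrals to the iterated Bochner integrals of \<open>frac_form\<close>.\<close>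
  have fi: "integrable (lborel \<Otimes>\<^sub>M lborel) f"
    by (rule integrableI_nn_integral_finite[OF _ _ nn]) (use f0 C I in auto)
  have "(LINT y|lborel. LINT x|lborel. f (y, x)) = (LINT z|(lborel \<Otimes>\<^sub>M lborel). f z)"
    by (rule lborel_pair.integral_fst'[OF fi])
  also have "\<dots> = 2 * C * I / (2 * pi) ^ DIM('a)"
    using f0 C I by (subst integral_eq_nn_integral) (auto simp: nn)
  finally have "(LINT y|lborel. LINT x|lborel. f (y, x)) = 2 * C * I / (2 * pi) ^ DIM('a)" .
  then show ?thesis using C(1) by (simp add: frac_form_def fc f_def I_def field_simps)
qed

section \<open>Bessel's inequality and the bathtub principle\<close>

text \<open>Expands the non-negative squared distance from \<open>w\<close> to its projection on the
  span.\<close>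

lemma bessel_inequality:
  fixes u :: "'i \<Rightarrow> 'a \<Rightarrow> real"
  assumes I: "finite I" and [measurable]: "\<And>i. i \<in> I \<Longrightarrow> u i \<in> borel_measurable M"
    and u2: "\<And>i. i \<in> I \<Longrightarrow> integrable M (\<lambda>x. (u i x)\<^sup>2)"
    and on: "\<And>i j. i \<in> I \<Longrightarrow> j \<in> I \<Longrightarrow> (LINT x|M. u i x * u j x) = (if i = j then 1 else 0)"
    and [measurable]: "w \<in> borel_measurable M" and w2: "integrable M (\<lambda>x. (w x)\<^sup>2)"
  shows "(\<Sum>i\<in>I. (LINT x|M. u i x * w x)\<^sup>2) \<le> (LINT x|M. (w x)\<^sup>2)"
proof -
  define c where "c i = (LINT x|M. u i x * w x)" for i
  have iuw: "integrable M (\<lambda>x. u i x * w x)" if "i \<in> I" for i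
    by (rule integrable_L2_mult) (use that u2 w2 in auto)
  have iuu: "integrable M (\<lambda>x. u i x * u j x)" if "i \<in> I" "j \<in> I" for i j
    by (rule integrable_L2_mult) (use that u2 in auto)
  have sq: "(w x - (\<Sum>i\<in>I. c i * u i x))\<^sup>2
      = (w x)\<^sup>2 - 2 * (\<Sum>i\<in>I. c i * (u i x * w x)) + (\<Sum>i\<in>I. \<Sum>j\<in>I. c i * c j * (u i x * u j x))" for x
  proof -
    have "(\<Sum>i\<in>I. c i * u i x)\<^sup>2 = (\<Sum>i\<in>I. \<Sum>j\<in>I. c i * c j * (u i x * u j x))"
      unfolding power2_eq_square sum_product by (intro sum.cong refl) (simp add: ac_simps)
    moreover have "w x * (\<Sum>i\<in>I. c i * u i x) = (\<Sum>i\<in>I. c i * (u i x * w x))"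
      unfolding sum_distrib_left by (intro sum.cong refl) (simp add: ac_simps)
    ultimately show ?thesis by (simp add: power2_diff mult.assoc)
  qed
  have "0 \<le> (LINT x|M. (w x - (\<Sum>i\<in>I. c i * u i x))\<^sup>2)" by simp
  also have "\<dots> = (LINT x|M. (w x)\<^sup>2) - 2 * (\<Sum>i\<in>I. c i * c i) + (\<Sum>i\<in>I. \<Sum>j\<in>I. c i * c j * (if i = j then 1 else 0))"
  proof -
    have A: "integrable M (\<lambda>x. 2 * (\<Sum>i\<in>I. c i * (u i x * w x)))"
      by (intro integrable_mult_right Bochner_Integration.integrable_sum iuw)
    have B: "integrable M (\<lambda>x. \<Sum>i\<in>I. \<Sum>j\<in>I. c i * c j * (u i x * u j x))"
      by (intro integrable_mult_right Bochner_Integration.integrable_sum iuu)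
    have a: "(LINT x|M. (\<Sum>i\<in>I. c i * (u i x * w x))) = (\<Sum>i\<in>I. c i * c i)"
      by (subst Bochner_Integration.integral_sum) (auto simp: iuw c_def)
    have b: "(LINT x|M. (\<Sum>i\<in>I. \<Sum>j\<in>I. c i * c j * (u i x * u j x))) = (\<Sum>i\<in>I. \<Sum>j\<in>I. c i * c j * (if i = j then 1 else 0))"
    proof (subst Bochner_Integration.integral_sum)
      show "(\<Sum>i\<in>I. LINT x|M. (\<Sum>j\<in>I. c i * c j * (u i x * u j x))) = (\<Sum>i\<in>I. \<Sum>j\<in>I. c i * c j * (if i = j then 1 else 0))"
        by (intro sum.cong refl, subst Bochner_Integration.integral_sum) (auto simp: iuu on intro!: sum.cong)
    qed (intro integrable_mult_right Bochner_Integration.integrable_sum iuu)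
    show ?thesis unfolding sq using w2 A B by (simp add: a b)
  qed
  also have "(\<Sum>i\<in>I. \<Sum>j\<in>I. c i * c j * (if i = j then 1 else 0)) = (\<Sum>i\<in>I. c i * c i)"
    using I by (simp add: if_distrib[of "(*) _"] cong: if_cong)
  finally show ?thesis by (simp add: c_def power2_eq_square)
qed

text \<open>A layer-cake argument in place of polar coordinates: the deficit at \<open>x\<close> is
  the integral of \<open>p * t powr (p - 1)\<close> from \<open>norm x\<close> to \<open>R\<close>,
  and Fubini reduces everything to volumes of balls.\<close>

lemma integral_ball_powr_deficit:
  fixes R p :: real
  assumes R: "0 \<le> R" and p: "0 < p"
  shows "integrable lborel (\<lambda>x::'a::euclidean_space. indicator (cball 0 R) x * (R powr p - norm x powr p))"
    and "(LINT x::'a|lborel. indicator (cball 0 R) x * (R powr p - norm x powr p))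
      = unit_ball_vol (real DIM('a)) * p / (real DIM('a) + p) * R powr (real DIM('a) + p)"
proof -
  let ?n = "real DIM('a)" and ?w = "unit_ball_vol (real DIM('a))"
  have ftc: "(\<integral>\<^sup>+t. ennreal (indicator {b..R} t * (e * t powr (e - 1))) \<partial>lborel) = ennreal (R powr e - b powr e)"
    if "0 \<le> b" "b \<le> R" "0 < e" for b e
  proof (rule nn_integral_has_integral_lebesgue)
    \<comment> \<open>For \<open>b = 0\<close> and \<open>e < 1\<close> the integrand is unbounded
      near the left end, so the derivative is taken in the interior only.\<close>
    show "((\<lambda>t. e * t powr (e - 1)) has_integral R powr e - b powr e) {b..R}"
    proof (rule fundamental_theorem_of_calculus_interior[OF that(2)])
      show "continuous_on {b..R} (\<lambda>t. t powr e)"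
        using that by (intro continuous_on_powr') (auto intro!: continuous_intros)
      show "((\<lambda>t. t powr e) has_vector_derivative e * t powr (e - 1)) (at t)" if "t \<in> {b<..<R}" for t
        using that \<open>0 \<le> b\<close> unfolding has_real_derivative_iff_has_vector_derivative[symmetric]
        by (auto intro!: derivative_eq_intros)
    qed
  qed (use that in auto)
  let ?k = "\<lambda>(x::'a) t. if norm x \<le> t \<and> t \<le> R then ennreal (p * t powr (p - 1)) else 0"
  have "(\<integral>\<^sup>+x. ennreal (indicator (cball 0 R) x * (R powr p - norm x powr p)) \<partial>(lborel::'a measure))
      = (\<integral>\<^sup>+x. (\<integral>\<^sup>+t. ?k x t \<partial>lborel) \<partial>lborel)"
  proof (intro nn_integral_cong)
    fix x :: 'a
    show "ennreal (indicator (cball 0 R) x * (R powr p - norm x powr p)) = (\<integral>\<^sup>+t. ?k x t \<partial>lborel)"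
    proof (cases "norm x \<le> R")
      case True
      have "(\<integral>\<^sup>+t. ?k x t \<partial>lborel) = (\<integral>\<^sup>+t. ennreal (indicator {norm x..R} t * (p * t powr (p - 1))) \<partial>lborel)"
        by (intro nn_integral_cong) (auto simp: indicator_def)
      then show ?thesis using True by (simp add: ftc[OF norm_ge_zero True p])
    next
      case False
      then have z: "?k x t = 0" for t by auto
      show ?thesis unfolding z using False by simp
    qed
  qed
  also have "\<dots> = (\<integral>\<^sup>+t. (\<integral>\<^sup>+x. ?k x t \<partial>lborel) \<partial>lborel)"
    by (rule lborel_pair.Fubini') measurable
  also have "\<dots> = (\<integral>\<^sup>+t. ennreal (?w * p / (?n + p)) * ennreal (indicator {0..R} t * ((?n + p) * t powr (?n + p - 1))) \<partial>lborel)"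
  proof (intro nn_integral_cong)
    fix t :: real
    show "(\<integral>\<^sup>+x. ?k x t \<partial>lborel)
        = ennreal (?w * p / (?n + p)) * ennreal (indicator {0..R} t * ((?n + p) * t powr (?n + p - 1)))"
    proof (cases "t \<in> {0..R}")
      case True
      have "(\<integral>\<^sup>+x. ?k x t \<partial>lborel) = (\<integral>\<^sup>+x. ennreal (p * t powr (p - 1)) * indicator (cball 0 t) x \<partial>(lborel::'a measure))"
        using True by (intro nn_integral_cong) (auto simp: indicator_def)
      also have "\<dots> = ennreal (p * t powr (p - 1)) * ennreal (?w * t ^ DIM('a))"
        using True by (simp add: nn_integral_cmult_indicator emeasure_cball)
      also have "\<dots> = ennreal (p * t powr (p - 1) * (?w * t ^ DIM('a)))"
        using True p by (intro ennreal_mult[symmetric]) auto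
      also have "p * t powr (p - 1) * (?w * t ^ DIM('a)) = ?w * p / (?n + p) * ((?n + p) * t powr (?n + p - 1))"
      proof (cases "t = 0")
        case False
        then have "t powr (?n + p - 1) = t powr (p - 1) * t ^ DIM('a)"
          using True by (simp add: powr_realpow[symmetric] powr_add[symmetric] algebra_simps)
        then show ?thesis using p by (simp add: field_simps add_nonneg_eq_0_iff)
      qed simp
      also have "ennreal (?w * p / (?n + p) * ((?n + p) * t powr (?n + p - 1)))
          = ennreal (?w * p / (?n + p)) * ennreal (indicator {0..R} t * ((?n + p) * t powr (?n + p - 1)))"
        using True p by (subst ennreal_mult) auto
      finally show ?thesis .
    next
      case False
      have z: "?k x t = 0" for x using False norm_ge_zero[of x] by (auto simp del: norm_ge_zero)
      show ?thesis unfolding z using False by simp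
    qed
  qed
  also have "\<dots> = ennreal (?w * p / (?n + p)) * ennreal (R powr (?n + p) - 0 powr (?n + p))"
    using R p by (subst nn_integral_cmult) (auto simp: ftc)
  also have "\<dots> = ennreal (?w * p / (?n + p) * R powr (?n + p))"
    using p by (simp only: powr_0 diff_0_right) (intro ennreal_mult[symmetric], auto)
  finally have nn: "(\<integral>\<^sup>+x. ennreal (indicator (cball 0 R) x * (R powr p - norm x powr p)) \<partial>(lborel::'a measure))
    = ennreal (?w * p / (?n + p) * R powr (?n + p))" .
  have nonneg: "0 \<le> indicator (cball 0 R) x * (R powr p - norm x powr p)" for x :: 'a
    using p by (auto simp: indicator_def intro!: powr_mono2)
  have m: "(\<lambda>x::'a. indicator (cball 0 R) x * (R powr p - norm x powr p)) \<in> borel_measurable lborel"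
    by (intro borel_measurable_times borel_measurable_indicator) auto
  have C: "0 \<le> ?w * p / (?n + p) * R powr (?n + p)" using p by simp
  show "integrable lborel (\<lambda>x::'a. indicator (cball 0 R) x * (R powr p - norm x powr p))"
    by (rule integrableI_nn_integral_finite[OF m _ nn]) (use nonneg in simp)
  show "(LINT x::'a|lborel. indicator (cball 0 R) x * (R powr p - norm x powr p)) = ?w * p / (?n + p) * R powr (?n + p)"
    using nonneg m C by (subst integral_eq_nn_integral) (auto simp: nn)
qed

text \<open>The Berezin-Li-Yau bathtub principle: moving mass of \<open>F\<close> into the ball where \<open>F\<close> would
  attain its maximal value \<open>M\<close> decreases the \<open>p\<close>-th moment.\<close>

lemma bathtub:
  fixes F :: "'a::euclidean_space \<Rightarrow> real" and p M :: real
  assumes F: "integrable lborel F" "\<And>x. 0 \<le> F x" "\<And>x. F x \<le> M" and M: "0 < M" and p: "0 < p"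
    and Fp: "integrable lborel (\<lambda>x. norm x powr p * F x)"
    and \<kappa>: "(LINT x|lborel. F x) = \<kappa>" "0 < \<kappa>"
  shows "real DIM('a) / (real DIM('a) + p) * \<kappa> * (\<kappa> / (M * unit_ball_vol (real DIM('a)))) powr (p / real DIM('a))
    \<le> (LINT x|lborel. norm x powr p * F x)"
proof -
  let ?n = "real DIM('a)" and ?w = "unit_ball_vol (real DIM('a))"
  have n: "0 < ?n" by simp
  \<comment> \<open>The power \<open>DIM('a)\<close> of the radius \<open>R\<close> at which a ball
    filled to height \<open>M\<close> has mass \<open>\<kappa>\<close>.\<close>
  define Q where "Q = \<kappa> / (M * ?w)"
  have w: "0 < ?w" by simp
  have Q: "0 < Q" unfolding Q_def by (intro divide_pos_pos mult_pos_pos \<kappa> M w)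
  have MQ: "M * ?w * Q = \<kappa>" using M less_imp_neq[OF w] by (simp add: Q_def)
  define R where "R = Q powr (1 / ?n)"
  have R: "0 < R" using Q by (simp add: R_def)
  have Rp: "R powr p = Q powr (p / ?n)" by (simp add: R_def powr_powr)
  have Rn: "R powr ?n = Q" using Q n by (simp add: R_def powr_powr)
  note def = integral_ball_powr_deficit[where 'a = 'a, OF less_imp_le[OF R] p]
  \<comment> \<open>The moment of the filled ball, written as \<open>R powr p\<close> times its mass
    minus \<open>M\<close> times the deficit.\<close>
  have "?n / (?n + p) * \<kappa> * R powr p = R powr p * \<kappa> - M * (?w * p / (?n + p) * R powr (?n + p))"
  proof -
    have "M * (?w * p / (?n + p) * R powr (?n + p)) = p / (?n + p) * (M * ?w * R powr ?n) * R powr p"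
      by (simp add: powr_add)
    also have "M * ?w * R powr ?n = \<kappa>" by (simp only: Rn MQ)
    finally have e: "M * (?w * p / (?n + p) * R powr (?n + p)) = p / (?n + p) * \<kappa> * R powr p" .
    have "?n / (?n + p) = 1 - p / (?n + p)" using n p by (simp add: field_simps)
    moreover have "(1 - \<theta>) * \<kappa> * y = y * \<kappa> - \<theta> * \<kappa> * y" for \<theta> y by (simp add: algebra_simps)
    ultimately show ?thesis unfolding e by simp
  qed
  also have "\<dots> = (LINT x|lborel. R powr p * F x - M * (indicator (cball 0 R) x * (R powr p - norm x powr p)))"
    using F(1) def \<kappa>(1) by simp
  also have "\<dots> \<le> (LINT x|lborel. norm x powr p * F x)"
  proof (rule integral_mono[OF _ Fp])
    show "integrable lborel (\<lambda>x. R powr p * F x - M * (indicator (cball 0 R) x * (R powr p - norm x powr p)))"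
      using F(1) def(1) by auto
    fix x :: 'a
    \<comment> \<open>Equivalently, \<open>R powr p - norm x powr p\<close> times (\<open>M\<close>
      on the ball, 0 elsewhere, minus \<open>F x\<close>) is non-negative: both factors have the
      same sign inside the ball, and likewise outside.\<close>
    show "R powr p * F x - M * (indicator (cball 0 R) x * (R powr p - norm x powr p)) \<le> norm x powr p * F x"
    proof (cases "norm x \<le> R")
      case True
      then have "norm x powr p \<le> R powr p" using p by (intro powr_mono2) auto
      then have "0 \<le> (R powr p - norm x powr p) * (M - F x)" using F(3)[of x] by simp
      with True show ?thesis by (simp add: algebra_simps)
    next
      case False
      then have "R powr p \<le> norm x powr p" using p R by (intro powr_mono2) auto
      then have "R powr p * F x \<le> norm x powr p * F x" using F(2) by (intro mult_right_mono)
      with False show ?thesis by simp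
    qed
  qed
  finally show ?thesis by (simp add: Rp Q_def)
qed

section \<open>Lower bounds for sums of eigenvalues\<close>

text \<open>Bessel's inequality for cosine and sine cut off to \<open>\<Omega>\<close>. The cutoff
  makes them square integrable without changing the coefficients, since each \<open>u i\<close>
  vanishes almost everywhere outside; \<open>cos^2 + sin^2 = 1\<close> then leaves the
  volume.\<close>

lemma sum_power_spectrum_le_volume:
  fixes u :: "'i \<Rightarrow> 'a::euclidean_space \<Rightarrow> real"
  assumes I: "finite I" and \<Omega>: "open \<Omega>" "bounded \<Omega>"
    and u: "\<And>i. i \<in> I \<Longrightarrow> u i \<in> XX \<Omega>"
    and on: "\<And>i j. i \<in> I \<Longrightarrow> j \<in> I \<Longrightarrow> (LINT x|lborel. u i x * u j x) = (if i = j then 1 else 0)"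
  shows "(\<Sum>i\<in>I. power_spectrum (u i) \<xi>) \<le> measure lborel \<Omega>"
proof -
  note XX = XX_integrable[OF u \<Omega>(2)]
  have [measurable]: "\<Omega> \<in> sets borel" using \<Omega> by simp
  have fin: "emeasure lborel \<Omega> < \<infinity>" using \<Omega>(2) by (rule emeasure_bounded_finite)
  have ind: "integrable lborel (indicat_real \<Omega>)" using fin by (intro integrable_real_indicator) auto
  have bessel: "(\<Sum>i\<in>I. (LINT x|lborel. u i x * f x)\<^sup>2) \<le> (LINT x|lborel. indicator \<Omega> x * (f x)\<^sup>2)"
    and int: "integrable lborel (\<lambda>x. indicator \<Omega> x * (f x)\<^sup>2)"
    if [measurable]: "f \<in> borel_measurable borel" and f: "\<And>x. \<bar>f x\<bar> \<le> 1" for f :: "'a \<Rightarrow> real"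
  proof -
    have sq: "(indicator \<Omega> x * f x)\<^sup>2 = indicator \<Omega> x * (f x)\<^sup>2" for x
      by (simp add: indicator_def)
    show i: "integrable lborel (\<lambda>x. indicator \<Omega> x * (f x)\<^sup>2)"
      by (rule Bochner_Integration.integrable_bound[OF ind])
        (use f in \<open>auto simp: abs_mult abs_square_le_1 intro!: mult_left_le\<close>)
    have "(\<Sum>i\<in>I. (LINT x|lborel. u i x * (indicator \<Omega> x * f x))\<^sup>2) \<le> (LINT x|lborel. (indicator \<Omega> x * f x)\<^sup>2)"
      by (rule bessel_inequality[OF I _ _ on]) (use XX i in \<open>auto simp: sq\<close>)
    also have "(\<Sum>i\<in>I. (LINT x|lborel. u i x * (indicator \<Omega> x * f x))\<^sup>2) = (\<Sum>i\<in>I. (LINT x|lborel. u i x * f x)\<^sup>2)"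
    proof (intro sum.cong refl arg_cong[where f = "\<lambda>x. x\<^sup>2"] integral_cong_AE)
      fix i assume i: "i \<in> I"
      have [measurable]: "u i \<in> borel_measurable borel" using XX i by simp
      show "(\<lambda>x. u i x * (indicator \<Omega> x * f x)) \<in> borel_measurable lborel" "(\<lambda>x. u i x * f x) \<in> borel_measurable lborel"
        by measurable
      show "AE x in lborel. u i x * (indicator \<Omega> x * f x) = u i x * f x"
        using XX(4)[OF i] by eventually_elim (auto simp: indicator_def)
    qed
    finally show "(\<Sum>i\<in>I. (LINT x|lborel. u i x * f x)\<^sup>2) \<le> (LINT x|lborel. indicator \<Omega> x * (f x)\<^sup>2)"
      by (simp add: sq)
  qed
  have "(\<Sum>i\<in>I. power_spectrum (u i) \<xi>)
      \<le> (LINT x|lborel. indicator \<Omega> x * (cos (\<xi> \<bullet> x))\<^sup>2) + (LINT x|lborel. indicator \<Omega> x * (sin (\<xi> \<bullet> x))\<^sup>2)"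
    unfolding power_spectrum_def cos_transform_def sin_transform_def sum.distrib
    by (intro add_mono bessel) auto
  also have "\<dots> = (LINT x|lborel. indicator \<Omega> x * (cos (\<xi> \<bullet> x))\<^sup>2 + indicator \<Omega> x * (sin (\<xi> \<bullet> x))\<^sup>2)"
    by (rule Bochner_Integration.integral_add[symmetric]; intro int) auto
  also have "\<dots> = (LINT x|lborel. indicator \<Omega> x)"
    by (intro Bochner_Integration.integral_cong refl) (simp add: distrib_left[symmetric])
  finally show ?thesis by simp
qed

text \<open>The unit ball has volume \<open>pi powr (n / 2) / Gamma (1 + n / 2)\<close>. Its power
  of \<open>pi\<close> merges with \<open>(2 * pi) ^ N\<close> into
  \<open>(4 * pi) powr (n / 2)\<close>.\<close>

lemma weyl_constant:
  fixes n \<kappa> V p :: real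
  assumes n: "n = real N" "0 < N" and pos: "0 < \<kappa>" "0 < V"
  shows "((2 * pi) ^ N * \<kappa> / (V * unit_ball_vol n)) powr (p / n)
    = (4 * pi) powr (p / 2) * (Gamma (1 + n / 2) / V) powr (p / n) * \<kappa> powr (p / n)"
proof -
  have G: "0 < Gamma (1 + n / 2)" using n by (intro Gamma_real_pos) auto
  have "4 * pi = (2 * pi)\<^sup>2 / pi" by (simp add: power2_eq_square)
  then have "(4 * pi) powr (n / 2) = ((2 * pi)\<^sup>2) powr (n / 2) / pi powr (n / 2)"
    by (simp only: powr_divide)
  also have "((2 * pi)\<^sup>2) powr (n / 2) = (2 * pi) powr n"
  proof -
    have "(2 * pi)\<^sup>2 = (2 * pi) powr 2" by (rule powr_numeral[symmetric]) simp
    then show ?thesis by (simp only: powr_powr) simp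
  qed
  also have "\<dots> = (2 * pi) ^ N" unfolding n(1) by (rule powr_realpow) simp
  finally have c: "(4 * pi) powr (n / 2) = (2 * pi) ^ N / pi powr (n / 2)" .
  have "(2 * pi) ^ N * \<kappa> / (V * unit_ball_vol n) = ((2 * pi) ^ N / pi powr (n / 2)) * (Gamma (1 + n / 2) / V) * \<kappa>"
    by (simp add: unit_ball_vol_def ac_simps)
  also have "\<dots> = (4 * pi) powr (n / 2) * (Gamma (1 + n / 2) / V) * \<kappa>" by (simp only: c)
  finally have "((2 * pi) ^ N * \<kappa> / (V * unit_ball_vol n)) powr (p / n)
      = ((4 * pi) powr (n / 2)) powr (p / n) * (Gamma (1 + n / 2) / V) powr (p / n) * \<kappa> powr (p / n)"
    using pos G by (simp only: powr_mult)
  also have "((4 * pi) powr (n / 2)) powr (p / n) = (4 * pi) powr (p / 2)"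
    using n by (simp add: powr_powr)
  finally show ?thesis .
qed

text \<open>Order \<open>p\<close> and energies \<open>E\<close> are left general to serve
  \<open>p = 2\<close> and \<open>p = 2 * s\<close> alike. The bathtub has mass
  \<open>(2 * pi) ^ DIM('a) * card I\<close> and ceiling \<open>V\<close>; one Plancherel factor
  cancels, the other sits inside the Weyl constant.\<close>

lemma spectral_moment_lower_bound:
  fixes u :: "'i \<Rightarrow> 'a::euclidean_space \<Rightarrow> real"
  assumes I: "finite I" "I \<noteq> {}" and \<Omega>: "open \<Omega>" "bounded \<Omega>" "\<Omega> \<noteq> {}"
    and u: "\<And>i. i \<in> I \<Longrightarrow> u i \<in> XX \<Omega>"
    and on: "\<And>i j. i \<in> I \<Longrightarrow> j \<in> I \<Longrightarrow> (LINT x|lborel. u i x * u j x) = (if i = j then 1 else 0)"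
    and p: "0 < p"
    and E: "\<And>i. i \<in> I \<Longrightarrow> integrable lborel (\<lambda>\<xi>. norm \<xi> powr p * power_spectrum (u i) \<xi>)"
      "\<And>i. i \<in> I \<Longrightarrow> (LINT \<xi>|lborel. norm \<xi> powr p * power_spectrum (u i) \<xi>) = (2 * pi) ^ DIM('a) * E i"
    and n: "n = real DIM('a)" and V: "V = measure lborel \<Omega>"
  shows "n * real (card I) / (n + p) * ((4 * pi) powr (p / 2) * (Gamma (1 + n / 2) / V) powr (p / n) * real (card I) powr (p / n))
    \<le> (\<Sum>i\<in>I. E i)"
proof -
  note XX = XX_integrable[OF u \<Omega>(2)]
  let ?c = "(2 * pi) ^ DIM('a)" and ?k = "real (card I)"
  have c: "0 < ?c" by simp
  have k: "0 < ?k" using I by (simp add: card_gt_0_iff)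
  \<comment> \<open>The volume becomes the ceiling of the bathtub, which must be positive.\<close>
  have V0: "0 < V"
  proof -
    obtain x r where xr: "0 < r" "ball x r \<subseteq> \<Omega>" using \<Omega> open_contains_ball by blast
    have "0 < measure lborel (ball x r)" using xr(1) by (rule content_ball_pos)
    also have "\<dots> \<le> measure lborel \<Omega>"
      using xr(2) emeasure_bounded_finite[OF \<Omega>(2)] \<Omega>(1)
      by (auto intro!: measure_mono_fmeasurable simp: fmeasurable_def)
    finally show ?thesis unfolding V .
  qed
  define F where "F \<xi> = (\<Sum>i\<in>I. power_spectrum (u i) \<xi>)" for \<xi>
  have F: "integrable lborel F" unfolding F_def[abs_def]
    by (intro Bochner_Integration.integrable_sum plancherel(1) XX)
  have sq: "(LINT x|lborel. (u i x)\<^sup>2) = 1" if "i \<in> I" for i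
    using on[OF that that] by (simp add: power2_eq_square)
  have F1: "(LINT \<xi>|lborel. F \<xi>) = ?c * ?k"
    unfolding F_def by (subst Bochner_Integration.integral_sum) (auto simp: plancherel XX sq)
  have pF: "norm \<xi> powr p * F \<xi> = (\<Sum>i\<in>I. norm \<xi> powr p * power_spectrum (u i) \<xi>)" for \<xi>
    by (simp add: F_def sum_distrib_left)
  have Fp: "integrable lborel (\<lambda>\<xi>. norm \<xi> powr p * F \<xi>)"
    unfolding pF by (intro Bochner_Integration.integrable_sum E)
  have Fp1: "(LINT \<xi>|lborel. norm \<xi> powr p * F \<xi>) = ?c * (\<Sum>i\<in>I. E i)"
    unfolding pF by (subst Bochner_Integration.integral_sum) (auto simp: E sum_distrib_left)
  have "n / (n + p) * (?c * ?k) * ((?c * ?k) / (V * unit_ball_vol n)) powr (p / n) \<le> ?c * (\<Sum>i\<in>I. E i)"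
    unfolding Fp1[symmetric] n
  proof (rule bathtub[OF F _ _ V0 p Fp F1])
    show "0 \<le> F \<xi>" for \<xi> unfolding F_def by (intro sum_nonneg power_spectrum_nonneg)
    show "F \<xi> \<le> V" for \<xi> unfolding F_def V
      by (rule sum_power_spectrum_le_volume[OF I(1) \<Omega>(1,2) u on])
    show "0 < ?c * ?k" using c k by (rule mult_pos_pos)
  qed
  then have "?c * (n * ?k / (n + p) * ((4 * pi) powr (p / 2) * (Gamma (1 + n / 2) / V) powr (p / n) * ?k powr (p / n)))
      \<le> ?c * (\<Sum>i\<in>I. E i)"
    unfolding weyl_constant[OF n DIM_positive k V0] by (simp only: times_divide_eq_left times_divide_eq_right ac_simps)
  then show ?thesis using c by (simp only: mult_le_cancel_left_pos)
qed

theorem theorem1p1: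
  fixes \<Omega> :: "'a::euclidean_space set"
    and s a b n V :: real
    and lam :: "nat \<Rightarrow> real"
    and u :: "nat \<Rightarrow> 'a \<Rightarrow> real"
    and k :: nat
  assumes "n = real DIM('a)"
    and "V = measure lborel \<Omega>"
    and "0 < s" "s < 1" "0 < a"
    and "C1_bounded_domain \<Omega>"
    and "mixed_eigen_listing a b s \<Omega> lam u"
    and "1 \<le> k"
  shows "(0 < b \<longrightarrow>
      (\<Sum>i=1..k. lam i) \<ge> n * real k *
        max (4 * a * pi / (n + 2) * (Gamma (1 + n / 2) / V) powr (2 / n) * real k powr (2 / n))
            ((4 * pi) powr s * b / (n + 2 * s) * (Gamma (1 + n / 2) / V) powr (2 * s / n)
               * real k powr (2 * s / n)))
    \<and> (\<forall>C\<^sub>E. 1 \<le> C\<^sub>E \<and> embedding_inequality s \<Omega> C\<^sub>E \<and> - a / C\<^sub>E < b \<and> b < 0 \<longrightarrow>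
      (\<Sum>i=1..k. lam i) \<ge> n * real k * (a + C\<^sub>E * b) *
        max (4 * pi / (n + 2) * (Gamma (1 + n / 2) / V) powr (2 / n) * real k powr (2 / n))
            ((4 * pi) powr s / ((n + 2 * s) * C\<^sub>E) * (Gamma (1 + n / 2) / V) powr (2 * s / n)
               * real k powr (2 * s / n)))"
proof -
  note n = assms(1) and V = assms(2) and s = assms(3,4) and a = assms(5) and \<Omega> = assms(6)
    and listing = assms(7)
  have \<Omega>': "open \<Omega>" "bounded \<Omega>" "\<Omega> \<noteq> {}" using \<Omega> by (auto simp: C1_bounded_domain_def)
  have [measurable]: "\<Omega> \<in> sets borel" using \<Omega>' by simp
  let ?I = "{1..k}"
  have ef: "mixed_eigenfunction a b s \<Omega> (lam i) (u i)" if "i \<in> ?I" for i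
    using listing that by (auto simp: mixed_eigen_listing_def)
  then have u: "u i \<in> XX \<Omega>" if "i \<in> ?I" for i
    using that by (auto simp: mixed_eigenfunction_def)
  note XX = XX_integrable[OF u \<Omega>'(2)]
  have on\<Omega>: "(LINT x:\<Omega>|lborel. u i x * u j x) = (if i = j then 1 else 0)" if "i \<in> ?I" "j \<in> ?I" for i j
    using listing that by (auto simp: mixed_eigen_listing_def)
  have on: "(LINT x|lborel. u i x * u j x) = (if i = j then 1 else 0)" if ij: "i \<in> ?I" "j \<in> ?I" for i j
  proof -
    have [measurable]: "u i \<in> borel_measurable borel" "u j \<in> borel_measurable borel" using XX ij by auto
    have "(LINT x|lborel. u i x * u j x) = (LINT x:\<Omega>|lborel. u i x * u j x)"
      unfolding set_lebesgue_integral_def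
    proof (rule integral_cong_AE)
      show "AE x in lborel. u i x * u j x = indicator \<Omega> x *\<^sub>R (u i x * u j x)"
        using XX(4)[OF ij(1)] by eventually_elim (auto simp: indicator_def)
    qed measurable
    with on\<Omega>[OF ij] show ?thesis by simp
  qed
  define G where "G i = (LINT x:\<Omega>|lborel. (norm (weak_grad (u i) x))\<^sup>2)" for i
  define S where "S i = frac_form s (u i) (u i)" for i
  \<comment> \<open>The weak equation for \<open>u i\<close>, tested with \<open>u i\<close>
    itself.\<close>
  have lam: "lam i = a * G i + b * S i" if i: "i \<in> ?I" for i
  proof -
    have "a * (LINT x:\<Omega>|lborel. weak_grad (u i) x \<bullet> weak_grad (u i) x) + b * frac_form s (u i) (u i)
        = lam i * (LINT x:\<Omega>|lborel. u i x * u i x)"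
      using ef[OF i] u[OF i] unfolding mixed_eigenfunction_def by blast
    then show ?thesis using on\<Omega>[OF i i] by (simp add: G_def S_def power2_norm_eq_inner)
  qed
  have p2: "norm \<xi> powr 2 = (norm \<xi>)\<^sup>2" for \<xi> :: 'a by simp
  have G: "integrable lborel (\<lambda>\<xi>. norm \<xi> powr 2 * power_spectrum (u i) \<xi>)"
    "(LINT \<xi>|lborel. norm \<xi> powr 2 * power_spectrum (u i) \<xi>) = (2 * pi) ^ DIM('a) * G i" if "i \<in> ?I" for i
    unfolding p2 G_def by (rule gradient_energy[OF \<Omega> u[OF that]])+
  have S1: "integrable lborel (\<lambda>\<xi>. norm \<xi> powr (2 * s) * power_spectrum (u i) \<xi>)" if i: "i \<in> ?I" for i
  proof (rule Bochner_Integration.integrable_bound)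
    show "integrable lborel (\<lambda>\<xi>. power_spectrum (u i) \<xi> + norm \<xi> powr 2 * power_spectrum (u i) \<xi>)"
      by (intro Bochner_Integration.integrable_add plancherel(1) XX G i)
    have [measurable]: "u i \<in> borel_measurable borel" using XX i by simp
    show "(\<lambda>\<xi>. norm \<xi> powr (2 * s) * power_spectrum (u i) \<xi>) \<in> borel_measurable lborel" by measurable
    \<comment> \<open>Since \<open>0 < s < 1\<close>, finite mass and finite second moment control
      the intermediate moment.\<close>
    have "r powr (2 * s) \<le> 1 + r powr 2" if "0 \<le> r" for r :: real
    proof (cases "r \<le> 1")
      case True
      then have "r powr (2 * s) \<le> 1 powr (2 * s)" using s that by (intro powr_mono2) auto
      then show ?thesis by (simp add: add_increasing2)
    next
      case False
      then have "r powr (2 * s) \<le> r powr 2" using s by (intro powr_mono) auto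
      then show ?thesis by linarith
    qed
    then have "norm \<xi> powr (2 * s) * power_spectrum (u i) \<xi> \<le> (1 + norm \<xi> powr 2) * power_spectrum (u i) \<xi>" for \<xi>
      by (intro mult_right_mono power_spectrum_nonneg) auto
    then show "AE \<xi> in lborel. norm (norm \<xi> powr (2 * s) * power_spectrum (u i) \<xi>)
        \<le> norm (power_spectrum (u i) \<xi> + norm \<xi> powr 2 * power_spectrum (u i) \<xi>)"
      by (intro AE_I2) (simp add: power_spectrum_nonneg distrib_right)
  qed
  have S2: "(LINT \<xi>|lborel. norm \<xi> powr (2 * s) * power_spectrum (u i) \<xi>) = (2 * pi) ^ DIM('a) * S i" if i: "i \<in> ?I" for i
    unfolding S_def by (rule frac_form_power_spectrum[OF s XX(2,3)[OF i] S1[OF i], symmetric])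
  have I: "finite ?I" "?I \<noteq> {}" "card ?I = k" using assms(8) by auto
  let ?g = "Gamma (1 + n / 2) / V"
  define X where "X = 4 * pi / (n + 2) * ?g powr (2 / n) * real k powr (2 / n)"
  define Y where "Y = (4 * pi) powr s / (n + 2 * s) * ?g powr (2 * s / n) * real k powr (2 * s / n)"
  have n0: "0 < n" by (simp add: n)
  have XY: "0 \<le> X" "0 \<le> Y" unfolding X_def Y_def using n0 s by auto
  have GX: "n * real k * X \<le> (\<Sum>i=1..k. G i)"
    using spectral_moment_lower_bound[OF I(1,2) \<Omega>' u on _ G n V] by (simp add: X_def I ac_simps)
  have SY: "n * real k * Y \<le> (\<Sum>i=1..k. S i)"
    using spectral_moment_lower_bound[OF I(1,2) \<Omega>' u on _ S1 S2 n V] s by (simp add: Y_def I ac_simps)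
  have nk: "0 \<le> n * real k" using n0 by simp
  have G0: "0 \<le> (\<Sum>i=1..k. G i)" using GX XY nk by (meson mult_nonneg_nonneg order_trans)
  have S0: "0 \<le> (\<Sum>i=1..k. S i)" using SY XY nk by (meson mult_nonneg_nonneg order_trans)
  have sum: "(\<Sum>i=1..k. lam i) = a * (\<Sum>i=1..k. G i) + b * (\<Sum>i=1..k. S i)"
    by (simp add: lam sum.distrib sum_distrib_left)
  show ?thesis
  proof (intro conjI impI allI)
    assume b: "0 < b"
    \<comment> \<open>Both energy sums are non-negative, so either term may be dropped; each choice
      yields one entry of the maximum.\<close>
    have "a * (n * real k * X) \<le> (\<Sum>i=1..k. lam i)" "b * (n * real k * Y) \<le> (\<Sum>i=1..k. lam i)"
      using mult_left_mono[OF GX, of a] mult_left_mono[OF SY, of b] mult_nonneg_nonneg[of a, OF _ G0]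
        mult_nonneg_nonneg[of b, OF _ S0] a b unfolding sum by linarith+
    then have "n * real k * max (a * X) (b * Y) \<le> (\<Sum>i=1..k. lam i)"
      by (simp add: max_def ac_simps)
    then show "n * real k *
        max (4 * a * pi / (n + 2) * ?g powr (2 / n) * real k powr (2 / n))
            ((4 * pi) powr s * b / (n + 2 * s) * ?g powr (2 * s / n) * real k powr (2 * s / n))
        \<le> (\<Sum>i=1..k. lam i)"
      by (simp add: X_def Y_def ac_simps)
  next
    fix C assume C: "1 \<le> C \<and> embedding_inequality s \<Omega> C \<and> - a / C < b \<and> b < 0"
    have C0: "0 < C" "- a / C < b" using C by auto
    then have "- a < b * C" by (simp only: pos_divide_less_eq)
    then have aC: "0 \<le> a + C * b" by (simp add: mult.commute)
    have SG: "(\<Sum>i=1..k. S i) \<le> C * (\<Sum>i=1..k. G i)"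
      unfolding sum_distrib_left using C u
      by (intro sum_mono) (auto simp: embedding_inequality_def G_def S_def)
    \<comment> \<open>The negative \<open>b\<close> reverses the embedding inequality, leaving the
      gradient energy with total coefficient \<open>a + C * b\<close>.\<close>
    have "b * (C * (\<Sum>i=1..k. G i)) \<le> b * (\<Sum>i=1..k. S i)" using SG C by (intro mult_left_mono_neg) auto
    then have le: "(a + C * b) * (\<Sum>i=1..k. G i) \<le> (\<Sum>i=1..k. lam i)"
      unfolding sum by (simp add: algebra_simps)
    \<comment> \<open>A second lower bound for the gradient energy, obtained through the fractional
      one at the price of the embedding constant; it yields the entry \<open>Y / C\<close>.\<close>
    have "n * real k * Y \<le> C * (\<Sum>i=1..k. G i)" using SY SG by linarith
    then have "n * real k * (Y / C) \<le> (\<Sum>i=1..k. G i)" using C by (simp add: field_simps)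
    with GX have "n * real k * max X (Y / C) \<le> (\<Sum>i=1..k. G i)" by (simp add: max_def)
    then have "(a + C * b) * (n * real k * max X (Y / C)) \<le> (a + C * b) * (\<Sum>i=1..k. G i)"
      using aC by (rule mult_left_mono)
    with le have "n * real k * (a + C * b) * max X (Y / C) \<le> (\<Sum>i=1..k. lam i)"
      by (simp add: ac_simps)
    then show "n * real k * (a + C * b) *
        max (4 * pi / (n + 2) * ?g powr (2 / n) * real k powr (2 / n))
            ((4 * pi) powr s / ((n + 2 * s) * C) * ?g powr (2 * s / n) * real k powr (2 * s / n))
        \<le> (\<Sum>i=1..k. lam i)"
      by (simp add: X_def Y_def)
  qed
qed

end
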